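(* Let $m\in\mathbb Z_+$, $f\in W_2^m$, $j\in\mathbb Z$, and let $\{\psi^{(\nu)}_{i,k}\,:\,\nu=1,\dots,r,\ i\in\mathbb Z,\ k\in\mathbb Z_+\}$ be a compactly supported tight wavelet frame in $L^2(G)$. Then $$\Big\|f-\sum_{i=-\infty}^{j}\sum_{\nu=1}^r\sum_{k\in\mathbb Z_+}\langle f,\psi^{(\nu)}_{i,k}\rangle\psi^{(\nu)}_{i,k}\Big\|_2\le C\,p^{-jm}\,\|f\|_{2,m},$$ where $C$ does not depend on $f$ and $j$.
   Context: Fix an integer $p\ge2$. The Vilenkin group $G=G_p$ is the set of sequences $x=(x_j)_{j\in\mathbb Z}$ with $x_j\in\{0,\dots,p-1\}$ and $x_j\neq0$ for at most finitely many negative $j$; the operation $\oplus$ is coordinatewise addition modulo $p$, $\ominus$ is its inverse operation, and $\theta$ is the zero sequence. The topology is given by the neighborhoods of zero $U_l=\{x\in G:x_j=0\text{ for }j\le l\}$, $l\in\mathbb Z$; $U=U_0$; $\mu$ is the Haar measure with $\mu(U)=1$; $\langle\cdot,\cdot\rangle$ and $\|\cdot\|_2$ are the inner product and norm of $L^2(G)$. Put $\|\theta\|=0$ and, for $x\ne\theta$, $\|x\|=p^{-k(x)}$, where $k(x)$ is the integer $k$ with $x_k\ne0$ and $x_j=0$ for all $j<k$. Put $\lambda(x)=\sum_jx_jp^{-j}$ and $H=\{x\in G:x_j=0\text{ for }j>0\}$; for $\alpha\in\mathbb Z_+=\{0,1,2,\dots\}$, $h_{[\alpha]}$ is the unique element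 of $H$ with $\lambda(h_{[\alpha]})=\alpha$. $A$ is the automorphism $(Ax)_j=x_{j+1}$. $\chi(x,\omega)=\exp\big(\frac{2\pi i}{p}\sum_{j\in\mathbb Z}x_j\omega_{1-j}\big)$, and the Fourier transform is $\widehat f(\omega)=\int_Gf(x)\overline{\chi(x,\omega)}\,d\mu(x)$, extended to $L^2(G)$ in the standard way. For functions $\psi^{(1)},\dots,\psi^{(r)}\in L^2(G)$ ($r\in\mathbb N$) put $\psi^{(\nu)}_{i,k}(x)=p^{i/2}\psi^{(\nu)}(A^ix\ominus h_{[k]})$. The system $\{\psi^{(\nu)}_{i,k}\}$ is a tight frame in $L^2(G)$ if there exists a constant $B$ such that $\sum_{i\in\mathbb Z}\sum_{k\in\mathbb Z_+}\sum_{\nu=1}^r|\langle f,\psi^{(\nu)}_{i,k}\rangle|^2=B\|f\|_2^2$ for all $f\in L^2(G)$. A wavelet frame is compactly supported if each function $\psi^{(\nu)}$ is compactly supported. The frame is arbitrary, not necessarily generated by a refinable function. $W_2^m=\{f\in L^2(G):\int_G\|\omega\|^{2k}|\widehat f(\omega)|^2\,d\mu(\omega)<\infty\text{ for }k=0,1,\dots,m\}$ with norm $\|f\|_{2,m}=\sum_{k=0}^m\big(\int_G\|\omega\|^{2k}|\widehat f(\omega)|^2\,d\mu(\omega)\big)^{1/2}$.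
   Formalization: For m > 0 the tight frame is assumed to have constant B = 1; for any other B the full frame series equals Bf rather than f, so the estimate fails as j tends to infinity. For m = 0 any B is allowed. *)

theory Defs
  imports "HOL-Analysis.Analysis"
begin

subsection \<open>The Vilenkin group\<close>

text \<open>The parameter \<open>p\<close> prevents \<open>G\<close> from being a type; it is a carrier set inside
  \<open>int \<Rightarrow> nat\<close>. Since a function \<open>G \<rightarrow> \<complex>\<close> is a total function here, only its values on
  the carrier matter.\<close>

definition vilenkin :: "nat \<Rightarrow> (int \<Rightarrow> nat) set" where
  "vilenkin p = {x. (\<forall>j. x j < p) \<and> finite {j. j < 0 \<and> x j \<noteq> 0}}"

definition vzero :: "int \<Rightarrow> nat" where
  "vzero = (\<lambda>_. 0)"

definition vadd :: "nat \<Rightarrow> (int \<Rightarrow> nat) \<Rightarrow> (int \<Rightarrow> nat) \<Rightarrow> (int \<Rightarrow> nat)" where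
  "vadd p x y = (\<lambda>j. (x j + y j) mod p)"

definition vneg :: "nat \<Rightarrow> (int \<Rightarrow> nat) \<Rightarrow> (int \<Rightarrow> nat)" where
  "vneg p x = (\<lambda>j. (p - x j) mod p)"

definition vdiff :: "nat \<Rightarrow> (int \<Rightarrow> nat) \<Rightarrow> (int \<Rightarrow> nat) \<Rightarrow> (int \<Rightarrow> nat)" where
  "vdiff p x y = vadd p x (vneg p y)"

definition vnbhd :: "nat \<Rightarrow> int \<Rightarrow> (int \<Rightarrow> nat) set" where
  "vnbhd p l = {x \<in> vilenkin p. \<forall>j\<le>l. x j = 0}"

definition vtopology :: "nat \<Rightarrow> (int \<Rightarrow> nat) topology" where
  "vtopology p = topology (\<lambda>S. S \<subseteq> vilenkin p \<and>
     (\<forall>x\<in>S. \<exists>l. vadd p x ` vnbhd p l \<subseteq> S))"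

lemma openin_vtopology:
  "openin (vtopology p) S \<longleftrightarrow>
     S \<subseteq> vilenkin p \<and> (\<forall>x\<in>S. \<exists>l. vadd p x ` vnbhd p l \<subseteq> S)"
proof -
  let ?P = "\<lambda>S. S \<subseteq> vilenkin p \<and> (\<forall>x\<in>S. \<exists>l. vadd p x ` vnbhd p l \<subseteq> S)"
  have "istopology ?P"
    unfolding istopology_def
  proof (intro conjI allI impI)
    fix S T assume S: "?P S" and T: "?P T"
    then show "S \<inter> T \<subseteq> vilenkin p" by blast
    show "\<forall>x\<in>S \<inter> T. \<exists>l. vadd p x ` vnbhd p l \<subseteq> S \<inter> T"
    proof
      fix x assume "x \<in> S \<inter> T"
      with S T obtain l l' where l: "vadd p x ` vnbhd p l \<subseteq> S" "vadd p x ` vnbhd p l' \<subseteq> T"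
        by blast
      have "vnbhd p (max l l') \<subseteq> vnbhd p l \<inter> vnbhd p l'"
        by (auto simp: vnbhd_def)
      with l show "\<exists>l. vadd p x ` vnbhd p l \<subseteq> S \<inter> T"
        by blast
    qed
  next
    fix \<K> assume "\<forall>K\<in>\<K>. ?P K"
    then show "\<Union>\<K> \<subseteq> vilenkin p" "\<forall>x\<in>\<Union>\<K>. \<exists>l. vadd p x ` vnbhd p l \<subseteq> \<Union>\<K>"
      by (blast, meson Union_iff Union_upper order_trans)
  qed
  then show ?thesis
    by (simp add: vtopology_def topology_inverse')
qed

definition haar_measure :: "nat \<Rightarrow> (int \<Rightarrow> nat) measure \<Rightarrow> bool" where
  "haar_measure p \<mu> \<longleftrightarrow>
     space \<mu> = vilenkin p \<and>
     sets \<mu> = sigma_sets (vilenkin p) {S. openin (vtopology p) S} \<and>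
     (\<forall>x\<in>vilenkin p. \<forall>S\<in>sets \<mu>. emeasure \<mu> (vadd p x ` S) = emeasure \<mu> S) \<and>
     (\<forall>K. compactin (vtopology p) K \<longrightarrow> emeasure \<mu> K < \<infinity>) \<and>
     emeasure \<mu> (vnbhd p 0) = 1"

definition vnorm :: "nat \<Rightarrow> (int \<Rightarrow> nat) \<Rightarrow> real" where
  "vnorm p x = (if x = vzero then 0
     else real p powi (- (THE k. x k \<noteq> 0 \<and> (\<forall>j<k. x j = 0))))"

definition vlambda :: "nat \<Rightarrow> (int \<Rightarrow> nat) \<Rightarrow> real" where
  "vlambda p x = (\<Sum>\<^sub>\<infinity>j\<in>UNIV. real (x j) * real p powi (- j))"

definition vH :: "nat \<Rightarrow> (int \<Rightarrow> nat) set" where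
  "vH p = {x \<in> vilenkin p. \<forall>j>0. x j = 0}"

definition vh :: "nat \<Rightarrow> nat \<Rightarrow> (int \<Rightarrow> nat)" where
  "vh p \<alpha> = (THE h. h \<in> vH p \<and> vlambda p h = real \<alpha>)"

text \<open>The integer power \<open>A\<^sup>i\<close> of the automorphism \<open>(A x)\<^sub>j = x\<^sub>j\<^sub>+\<^sub>1\<close>.\<close>

definition vdilate :: "int \<Rightarrow> (int \<Rightarrow> nat) \<Rightarrow> (int \<Rightarrow> nat)" where
  "vdilate i x = (\<lambda>j. x (j + i))"

text \<open>For \<open>x\<close>, \<open>\<omega>\<close> in the carrier only finitely many terms of the sum are nonzero.\<close>

definition vchar :: "nat \<Rightarrow> (int \<Rightarrow> nat) \<Rightarrow> (int \<Rightarrow> nat) \<Rightarrow> complex" where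
  "vchar p x \<omega> = exp (2 * pi * \<i> / of_nat p *
     (\<Sum>\<^sub>\<infinity>j\<in>UNIV. of_nat (x j * \<omega> (1 - j))))"


subsection \<open>The space of square-integrable functions\<close>

text \<open>Functions are not identified modulo null sets: \<open>l2norm\<close> is a seminorm, and limits in
  \<open>L\<^sup>2\<close> are determined up to equality almost everywhere.\<close>

definition L2 :: "'a measure \<Rightarrow> ('a \<Rightarrow> complex) set" where
  "L2 M = {f \<in> borel_measurable M. integrable M (\<lambda>x. (cmod (f x))\<^sup>2)}"

definition l2norm :: "'a measure \<Rightarrow> ('a \<Rightarrow> complex) \<Rightarrow> real" where
  "l2norm M f = sqrt (\<integral>x. (cmod (f x))\<^sup>2 \<partial>M)"

definition l2inner :: "'a measure \<Rightarrow> ('a \<Rightarrow> complex) \<Rightarrow> ('a \<Rightarrow> complex) \<Rightarrow> complex" where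
  "l2inner M f g = (\<integral>x. f x * cnj (g x) \<partial>M)"

text \<open>Unconditional convergence in \<open>L\<^sup>2\<close> of the family \<open>(g t)\<close>, \<open>t \<in> I\<close>, to \<open>s\<close>; the analogue of
  \<^const>\<open>has_sum\<close> for the seminorm \<open>l2norm\<close>.\<close>

definition l2_has_sum ::
    "'a measure \<Rightarrow> ('i \<Rightarrow> 'a \<Rightarrow> complex) \<Rightarrow> 'i set \<Rightarrow> ('a \<Rightarrow> complex) \<Rightarrow> bool" where
  "l2_has_sum M g I s \<longleftrightarrow> (\<forall>t\<in>I. g t \<in> L2 M) \<and> s \<in> L2 M \<and>
     ((\<lambda>F. l2norm M (\<lambda>x. s x - (\<Sum>t\<in>F. g t x))) \<longlongrightarrow> 0) (finite_subsets_at_top I)"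


subsection \<open>Fourier transform and Sobolev spaces\<close>

definition vfourier ::
    "nat \<Rightarrow> (int \<Rightarrow> nat) measure \<Rightarrow> ((int \<Rightarrow> nat) \<Rightarrow> complex) \<Rightarrow> (int \<Rightarrow> nat) \<Rightarrow> complex" where
  "vfourier p \<mu> f \<omega> = (\<integral>x. f x * cnj (vchar p x \<omega>) \<partial>\<mu>)"

text \<open>Extension by continuity from \<open>L\<^sup>1 \<inter> L\<^sup>2\<close>, the choice being among functions that agree almost
  everywhere.\<close>

definition vfourier_L2 ::
    "nat \<Rightarrow> (int \<Rightarrow> nat) measure \<Rightarrow> ((int \<Rightarrow> nat) \<Rightarrow> complex) \<Rightarrow> (int \<Rightarrow> nat) \<Rightarrow> complex" where
  "vfourier_L2 p \<mu> f = (SOME F. F \<in> L2 \<mu> \<and>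
     (\<exists>u :: nat \<Rightarrow> (int \<Rightarrow> nat) \<Rightarrow> complex.
        (\<forall>n. integrable \<mu> (u n) \<and> u n \<in> L2 \<mu> \<and> vfourier p \<mu> (u n) \<in> L2 \<mu>) \<and>
        (\<lambda>n. l2norm \<mu> (\<lambda>x. u n x - f x)) \<longlonglongrightarrow> 0 \<and>
        (\<lambda>n. l2norm \<mu> (\<lambda>\<omega>. vfourier p \<mu> (u n) \<omega> - F \<omega>)) \<longlonglongrightarrow> 0))"

definition sobolev ::
    "nat \<Rightarrow> (int \<Rightarrow> nat) measure \<Rightarrow> nat \<Rightarrow> ((int \<Rightarrow> nat) \<Rightarrow> complex) set" where
  "sobolev p \<mu> m = {f \<in> L2 \<mu>. \<forall>k\<le>m.
     integrable \<mu> (\<lambda>\<omega>. vnorm p \<omega> ^ (2 * k) * (cmod (vfourier_L2 p \<mu> f \<omega>))\<^sup>2)}"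

definition sobolev_norm ::
    "nat \<Rightarrow> (int \<Rightarrow> nat) measure \<Rightarrow> nat \<Rightarrow> ((int \<Rightarrow> nat) \<Rightarrow> complex) \<Rightarrow> real" where
  "sobolev_norm p \<mu> m f = (\<Sum>k=0..m.
     sqrt (\<integral>\<omega>. vnorm p \<omega> ^ (2 * k) * (cmod (vfourier_L2 p \<mu> f \<omega>))\<^sup>2 \<partial>\<mu>))"


subsection \<open>Wavelet frames\<close>

definition wavelet ::
    "nat \<Rightarrow> ((int \<Rightarrow> nat) \<Rightarrow> complex) \<Rightarrow> int \<Rightarrow> nat \<Rightarrow> (int \<Rightarrow> nat) \<Rightarrow> complex" where
  "wavelet p \<psi> i k x =
     complex_of_real (real p powr (of_int i / 2)) * \<psi> (vdiff p (vdilate i x) (vh p k))"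

text \<open>The frame constant \<open>B\<close> is an argument because the expansion \<open>f = \<Sum>\<langle>f, \<psi>\<^sub>i\<^sub>,\<^sub>k\<rangle> \<psi>\<^sub>i\<^sub>,\<^sub>k\<close> holds
  only for \<open>B = 1\<close>; for general \<open>B\<close> the sum is \<open>B f\<close>.  Consequently, by letting
  \<open>j \<rightarrow> \<infinity>\<close>, an approximation order \<open>p\<^sup>-\<^sup>j\<^sup>m\<close> with \<open>m > 0\<close> is possible only for \<open>B = 1\<close>.\<close>

definition tight_wavelet_frame ::
    "nat \<Rightarrow> (int \<Rightarrow> nat) measure \<Rightarrow> nat \<Rightarrow> (nat \<Rightarrow> (int \<Rightarrow> nat) \<Rightarrow> complex) \<Rightarrow> real \<Rightarrow> bool" where
  "tight_wavelet_frame p \<mu> r \<psi> B \<longleftrightarrow>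
     (\<forall>\<nu>\<in>{1..r}. \<psi> \<nu> \<in> L2 \<mu>) \<and>
     (\<forall>f\<in>L2 \<mu>. ((\<lambda>(i, \<nu>, k). (cmod (l2inner \<mu> f (wavelet p (\<psi> \<nu>) i k)))\<^sup>2)
        has_sum (B * (l2norm \<mu> f)\<^sup>2)) (UNIV \<times> {1..r} \<times> UNIV))"

text \<open>Compact support of the class of \<open>f\<close> modulo null sets.\<close>

definition compactly_supported ::
    "nat \<Rightarrow> (int \<Rightarrow> nat) measure \<Rightarrow> ((int \<Rightarrow> nat) \<Rightarrow> complex) \<Rightarrow> bool" where
  "compactly_supported p \<mu> f \<longleftrightarrow>
     (\<exists>K. compactin (vtopology p) K \<and> (AE x in \<mu>. x \<notin> K \<longrightarrow> f x = 0))"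

end

(* Being compactly supported, each psi vanishes outside some ball U_{-L}. Testing the frame
   identity on the indicator function of U shows that psi has mean zero: each level i >= L contains
   p^i wavelets supported in U, and together they contribute |int psi|^2 to a convergent sum. Hence
   psi_{i,k} is supported in a coset of U_{i-L} and is orthogonal to every function that is constant
   on these cosets. So the coefficients at levels i > j do not change when f is replaced by
   f - P f, where P averages over the cosets of U_{j-L}. As P is the multiplication of the Fourier
   transform by the indicator function of the dual ball U_{L-j}, only frequencies of norm at least
   p^(j-L) remain in f - P f, which gives the factor p^(-jm). The tight frame property with B = 1
   bounds the remainder of the expansion by the l2 norm of the remaining coefficients. *)

theory Submission
  imports Defs
begin

subsection \<open>The space of square-integrable functions\<close>

text \<open>The Fourier transform of an L2 function is known only as some limit of transforms, so
  each statement about it is proved for integrable square-integrable \<open>u\<close> and carried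
  over by continuity. The source is one identity: the energy of the transform of \<open>u\<close> on
  the frequency ball \<open>U_{-n}\<close> equals the squared norm of
  \<open>vavg p \<mu> n u\<close>. Since the averages tend to \<open>u\<close> as \<open>n\<close>
  grows, the limit is Plancherel's identity, and the difference of the two expresses
  \<open>u - vavg p \<mu> n u\<close> as a high-frequency tail. Convergence of the averages is thus
  the analytic core; it rests on an induction over the sigma-algebra generated by cosets, and the
  same generator determines how translations and dilations act on the Haar measure. For
  \<open>m = 0\<close> the frame constant is arbitrary and the expansion need not reproduce
  \<open>f\<close>; there the boundedness of the frame operator takes the place of the
  reconstruction. The infinite remainder is controlled through finite families of coefficients
  only.\<close>

lemma L2_measurable: "f \<in> L2 M \<Longrightarrow> f \<in> borel_measurable M"
  and L2_square_integrable: "f \<in> L2 M \<Longrightarrow> integrable M (\<lambda>x. (cmod (f x))\<^sup>2)"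
  by (auto simp: L2_def)

lemma l2norm_nonneg [simp]: "0 \<le> l2norm M f"
  by (simp add: l2norm_def)

lemma l2norm_power2: "(l2norm M f)\<^sup>2 = (\<integral>x. (cmod (f x))\<^sup>2 \<partial>M)"
  by (simp add: l2norm_def)

lemma cmod_add_power2_le: "(cmod (a + b))\<^sup>2 \<le> 2 * (cmod a)\<^sup>2 + 2 * (cmod b)\<^sup>2"
proof -
  have "(cmod (a + b))\<^sup>2 \<le> (cmod a + cmod b)\<^sup>2"
    by (simp add: norm_triangle_ineq power_mono)
  also have "\<dots> \<le> 2 * (cmod a)\<^sup>2 + 2 * (cmod b)\<^sup>2"
    using sum_squares_bound[of "cmod a" "cmod b"] by (simp add: power2_sum)
  finally show ?thesis .
qed

lemma L2_add:
  assumes "f \<in> L2 M" "g \<in> L2 M"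
  shows "(\<lambda>x. f x + g x) \<in> L2 M"
proof -
  have [measurable]: "f \<in> borel_measurable M" "g \<in> borel_measurable M"
    using assms by (auto simp: L2_def)
  have "integrable M (\<lambda>x. 2 * (cmod (f x))\<^sup>2 + 2 * (cmod (g x))\<^sup>2)"
    using assms by (auto simp: L2_def)
  then have "integrable M (\<lambda>x. (cmod (f x + g x))\<^sup>2)"
    by (rule Bochner_Integration.integrable_bound) (auto simp: cmod_add_power2_le)
  then show ?thesis
    by (auto simp: L2_def)
qed

lemma L2_scale: "f \<in> L2 M \<Longrightarrow> (\<lambda>x. c * f x) \<in> L2 M"
  by (auto simp: L2_def norm_mult power_mult_distrib)

lemma L2_zero: "(\<lambda>x. 0) \<in> L2 M"
  by (simp add: L2_def)

lemma L2_diff: "f \<in> L2 M \<Longrightarrow> g \<in> L2 M \<Longrightarrow> (\<lambda>x. f x - g x) \<in> L2 M"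
  using L2_add[of f M "\<lambda>x. (-1) * g x"] L2_scale[of g M "-1"] by simp

lemma L2_sum: "(\<And>t. t \<in> F \<Longrightarrow> g t \<in> L2 M) \<Longrightarrow> (\<lambda>x. \<Sum>t\<in>F. g t x) \<in> L2 M"
  by (induction F rule: infinite_finite_induct) (auto intro: L2_add L2_zero)

lemma L2_bounded:
  assumes "g \<in> L2 M" "f \<in> borel_measurable M" "\<And>x. x \<in> space M \<Longrightarrow> cmod (f x) \<le> cmod (g x)"
  shows "f \<in> L2 M"
proof -
  note [measurable] = assms(2)
  have "integrable M (\<lambda>x. (cmod (f x))\<^sup>2)"
    by (rule Bochner_Integration.integrable_bound[OF L2_square_integrable[OF assms(1)]])
       (auto simp: assms(3) power_mono)
  then show ?thesis
    by (simp add: L2_def assms)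
qed

lemma borel_measurable_cnj [measurable (raw)]:
  "f \<in> borel_measurable M \<Longrightarrow> (\<lambda>x. cnj (f x)) \<in> borel_measurable M"
  by (rule borel_measurable_continuous_on[OF continuous_on_cnj[OF continuous_on_id]])

lemma L2_integrable_mult:
  assumes "f \<in> L2 M" "g \<in> L2 M"
  shows "integrable M (\<lambda>x. f x * cnj (g x))"
proof -
  have [measurable]: "f \<in> borel_measurable M" "g \<in> borel_measurable M"
    using assms by (auto simp: L2_def)
  have "integrable M (\<lambda>x. (cmod (f x))\<^sup>2 + (cmod (g x))\<^sup>2)"
    using assms by (auto simp: L2_def)
  then show ?thesis
  proof (rule Bochner_Integration.integrable_bound)
    have "a * b \<le> a\<^sup>2 + b\<^sup>2" if "a \<ge> 0" "b \<ge> 0" for a b :: real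
      using sum_squares_bound[of a b] mult_nonneg_nonneg[OF that] by linarith
    then show "AE x in M. cmod (f x * cnj (g x)) \<le> norm ((cmod (f x))\<^sup>2 + (cmod (g x))\<^sup>2)"
      by (auto simp: norm_mult)
  qed measurable
qed

lemma l2inner_self: "l2inner M f f = complex_of_real ((l2norm M f)\<^sup>2)"
  unfolding l2inner_def l2norm_power2 complex_norm_square[symmetric]
  by (rule integral_complex_of_real)

lemma l2inner_commute: "l2inner M g f = cnj (l2inner M f g)"
  using Bochner_Integration.integral_cnj[of M "\<lambda>x. f x * cnj (g x)"] by (simp add: l2inner_def mult.commute)

lemma l2inner_diff_left:
  assumes "f \<in> L2 M" "g \<in> L2 M" "h \<in> L2 M"
  shows "l2inner M (\<lambda>x. f x - g x) h = l2inner M f h - l2inner M g h"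
  using assms by (simp add: l2inner_def left_diff_distrib L2_integrable_mult)

lemma l2inner_scale_left: "l2inner M (\<lambda>x. c * f x) h = c * l2inner M f h"
  by (simp add: l2inner_def mult.assoc)

lemma l2inner_sum_left:
  assumes "\<And>t. t \<in> F \<Longrightarrow> g t \<in> L2 M" "h \<in> L2 M"
  shows "l2inner M (\<lambda>x. \<Sum>t\<in>F. g t x) h = (\<Sum>t\<in>F. l2inner M (g t) h)"
  using assms unfolding l2inner_def
  by (subst Bochner_Integration.integral_sum[symmetric])
     (auto simp: sum_distrib_right L2_integrable_mult)

lemma l2norm_add_power2:
  assumes "f \<in> L2 M" "g \<in> L2 M"
  shows "(l2norm M (\<lambda>x. f x + g x))\<^sup>2 = (l2norm M f)\<^sup>2 + 2 * Re (l2inner M f g) + (l2norm M g)\<^sup>2"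
proof -
  have int: "integrable M (\<lambda>x. Re (f x * cnj (g x)))"
    by (rule integrable_Re) (rule L2_integrable_mult[OF assms])
  have "(cmod (f x + g x))\<^sup>2 = ((cmod (f x))\<^sup>2 + 2 * Re (f x * cnj (g x))) + (cmod (g x))\<^sup>2" for x
    unfolding cmod_power2 by (simp add: power2_eq_square algebra_simps)
  then have "(l2norm M (\<lambda>x. f x + g x))\<^sup>2
      = (\<integral>x. ((cmod (f x))\<^sup>2 + 2 * Re (f x * cnj (g x))) + (cmod (g x))\<^sup>2 \<partial>M)"
    by (simp only: l2norm_power2)
  also have "\<dots> = (\<integral>x. (cmod (f x))\<^sup>2 \<partial>M) + 2 * (\<integral>x. Re (f x * cnj (g x)) \<partial>M)
      + (\<integral>x. (cmod (g x))\<^sup>2 \<partial>M)"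
    using int assms by (simp add: L2_square_integrable del: complex_cnj times_complex.simps)
  also have "(\<integral>x. Re (f x * cnj (g x)) \<partial>M) = Re (l2inner M f g)"
    unfolding l2inner_def by (rule integral_Re) (rule L2_integrable_mult[OF assms])
  finally show ?thesis
    by (simp only: l2norm_power2)
qed

lemma l2norm_scale: "l2norm M (\<lambda>x. c * f x) = cmod c * l2norm M f"
  by (simp add: l2norm_def norm_mult power_mult_distrib real_sqrt_mult)

lemma l2norm_diff_power2:
  assumes "f \<in> L2 M" "g \<in> L2 M"
  shows "(l2norm M (\<lambda>x. f x - g x))\<^sup>2 = (l2norm M f)\<^sup>2 - 2 * Re (l2inner M f g) + (l2norm M g)\<^sup>2"
proof -
  have "l2inner M f (\<lambda>x. (-1) * g x) = - l2inner M f g"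
    by (simp add: l2inner_def)
  then show ?thesis
    using l2norm_add_power2[OF assms(1) L2_scale[OF assms(2), of "-1"]] l2norm_scale[of M "-1" g]
    by simp
qed

lemma l2norm_minus_commute: "l2norm M (\<lambda>x. f x - g x) = l2norm M (\<lambda>x. g x - f x)"
  by (simp add: l2norm_def norm_minus_commute)

lemma l2_Cauchy_Schwarz_cmod:
  assumes "f \<in> L2 M" "g \<in> L2 M"
  shows "(\<integral>x. cmod (f x) * cmod (g x) \<partial>M) \<le> l2norm M f * l2norm M g"
proof -
  let ?a = "l2norm M f" and ?b = "l2norm M g"
  have int: "integrable M (\<lambda>x. cmod (f x) * cmod (g x))"
    using integrable_norm[OF L2_integrable_mult[OF assms]] by (simp add: norm_mult)
  have sq: "integrable M (\<lambda>x. (cmod (f x))\<^sup>2)" "integrable M (\<lambda>x. (cmod (g x))\<^sup>2)"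
    using assms by (auto simp: L2_def)
  show ?thesis
  proof (cases "?a = 0 \<or> ?b = 0")
    case True
    then have "(AE x in M. f x = 0) \<or> (AE x in M. g x = 0)"
      using sq by (auto simp: l2norm_def integral_nonneg_eq_0_iff_AE)
    then have "AE x in M. cmod (f x) * cmod (g x) = 0"
      by auto
    then have "(\<integral>x. cmod (f x) * cmod (g x) \<partial>M) = 0"
      by (rule integral_eq_zero_AE)
    then show ?thesis
      by simp
  next
    case False
    then have a: "?a > 0" and b: "?b > 0"
      by (auto simp: less_le)
    \<comment> \<open>This weight minimises the integrated bound
      \<open>a b <= t/2 a^2 + b^2/(2 t)\<close>. It needs both norms to be positive, hence the
      separate degenerate case.\<close>
    define t where "t = ?b / ?a"
    have t: "t > 0"
      using a b by (simp add: t_def)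
    have "(\<integral>x. cmod (f x) * cmod (g x) \<partial>M)
        \<le> (\<integral>x. t / 2 * (cmod (f x))\<^sup>2 + (cmod (g x))\<^sup>2 / (2 * t) \<partial>M)"
    proof (rule integral_mono[OF int])
      fix x
      have "0 \<le> (t * cmod (f x) - cmod (g x))\<^sup>2 / (2 * t)"
        using t by simp
      also have "\<dots> = t / 2 * (cmod (f x))\<^sup>2 + (cmod (g x))\<^sup>2 / (2 * t) - cmod (f x) * cmod (g x)"
        using t by (simp add: field_simps power2_eq_square)
      finally show "cmod (f x) * cmod (g x) \<le> t / 2 * (cmod (f x))\<^sup>2 + (cmod (g x))\<^sup>2 / (2 * t)"
        by simp
    qed (use sq in simp)
    also have "\<dots> = t / 2 * ?a\<^sup>2 + ?b\<^sup>2 / (2 * t)"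
      using sq by (simp add: l2norm_power2)
    also have "\<dots> = ?a * ?b"
      using a b by (simp add: t_def field_simps power2_eq_square)
    finally show ?thesis .
  qed
qed

lemma l2_Cauchy_Schwarz:
  assumes "f \<in> L2 M" "g \<in> L2 M"
  shows "cmod (l2inner M f g) \<le> l2norm M f * l2norm M g"
proof -
  have "cmod (l2inner M f g) \<le> (\<integral>x. cmod (f x * cnj (g x)) \<partial>M)"
    unfolding l2inner_def by (rule integral_norm_bound)
  also have "\<dots> = (\<integral>x. cmod (f x) * cmod (g x) \<partial>M)"
    by (simp add: norm_mult)
  also have "\<dots> \<le> l2norm M f * l2norm M g"
    by (rule l2_Cauchy_Schwarz_cmod[OF assms])
  finally show ?thesis .
qed

lemma l2norm_triangle:
  assumes "f \<in> L2 M" "g \<in> L2 M"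
  shows "l2norm M (\<lambda>x. f x + g x) \<le> l2norm M f + l2norm M g"
proof (rule power2_le_imp_le)
  have "Re (l2inner M f g) \<le> l2norm M f * l2norm M g"
    using complex_Re_le_cmod l2_Cauchy_Schwarz[OF assms] by (rule order_trans)
  then show "(l2norm M (\<lambda>x. f x + g x))\<^sup>2 \<le> (l2norm M f + l2norm M g)\<^sup>2"
    by (simp add: l2norm_add_power2[OF assms] power2_sum)
qed simp

lemma l2norm_triangle_diff:
  assumes "f \<in> L2 M" "g \<in> L2 M" "h \<in> L2 M"
  shows "l2norm M (\<lambda>x. f x - h x) \<le> l2norm M (\<lambda>x. f x - g x) + l2norm M (\<lambda>x. g x - h x)"
  using l2norm_triangle[OF L2_diff[OF assms(1,2)] L2_diff[OF assms(2,3)]] by simp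

lemma l2norm_le_diff:
  assumes "f \<in> L2 M" "g \<in> L2 M"
  shows "l2norm M f \<le> l2norm M g + l2norm M (\<lambda>x. f x - g x)"
  using l2norm_triangle_diff[OF assms L2_zero] by simp

lemma tendsto_l2norm:
  assumes "\<And>n. u n \<in> L2 M" "f \<in> L2 M" "((\<lambda>n. l2norm M (\<lambda>x. u n x - f x)) \<longlongrightarrow> 0) F"
  shows "((\<lambda>n. l2norm M (u n)) \<longlongrightarrow> l2norm M f) F"
proof -
  have "\<bar>l2norm M (u n) - l2norm M f\<bar> \<le> l2norm M (\<lambda>x. u n x - f x)" for n
    using l2norm_le_diff[OF assms(1,2), of n] l2norm_le_diff[OF assms(2) assms(1)[of n]]
      l2norm_minus_commute[of M "u n" f] by linarith
  then have "((\<lambda>n. l2norm M (u n) - l2norm M f) \<longlongrightarrow> 0) F"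
    by (intro Lim_null_comparison[OF _ assms(3)]) (auto intro!: always_eventually)
  then show ?thesis
    by (simp add: LIM_zero_iff)
qed

lemma L2_nn_integral:
  assumes "f \<in> L2 M"
  shows "(\<integral>\<^sup>+x. ennreal ((cmod (f x))\<^sup>2) \<partial>M) = ennreal ((l2norm M f)\<^sup>2)"
  unfolding l2norm_power2 by (rule nn_integral_eq_integral) (use assms in \<open>auto simp: L2_def\<close>)

text \<open>Fatou arguments deliver only a bound on a nonnegative integral; its finiteness already
  gives integrability, so membership and norm bound are obtained together.\<close>

lemma L2_I_nn_integral:
  assumes "f \<in> borel_measurable M" "(\<integral>\<^sup>+x. ennreal ((cmod (f x))\<^sup>2) \<partial>M) \<le> ennreal (e\<^sup>2)" "e \<ge> 0"
  shows "f \<in> L2 M" "l2norm M f \<le> e"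
proof -
  note [measurable] = assms(1)
  show *: "f \<in> L2 M"
    unfolding L2_def using le_less_trans[OF assms(2)]
    by (auto intro!: integrableI_bounded)
  then show "l2norm M f \<le> e"
    using assms(2,3) by (simp add: L2_nn_integral)
qed

text \<open>Riesz--Fischer: a subsequence with \<open>\<Sum>\<^sub>k 2\<^sup>k \<parallel>g\<^sub>k\<^sub>+\<^sub>1 - g\<^sub>k\<parallel>\<^sup>2 < \<infinity>\<close> converges almost everywhere.\<close>

lemma l2_complete:
  assumes g: "\<And>n. g n \<in> L2 M"
    and Cauchy: "\<And>e. e > 0 \<Longrightarrow> \<exists>N. \<forall>m\<ge>N. \<forall>n\<ge>N. l2norm M (\<lambda>x. g m x - g n x) \<le> e"
  shows "\<exists>h\<in>L2 M. (\<lambda>n. l2norm M (\<lambda>x. g n x - h x)) \<longlonglongrightarrow> 0"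
proof -
  have [measurable]: "\<And>n. g n \<in> borel_measurable M"
    using g by (auto simp: L2_def)
  obtain N where N: "\<And>k m n. m \<ge> N k \<Longrightarrow> n \<ge> N k \<Longrightarrow> l2norm M (\<lambda>x. g m x - g n x) \<le> (1/2)^k"
    using Cauchy[of "(1/2)^k" for k] by (metis zero_less_power half_gt_zero_iff zero_less_one)
  \<comment> \<open>\<open>R k\<close> dominates every earlier \<open>N\<close>, which makes
    consecutive differences small, and the summand \<open>k\<close> makes the subsequence cofinal,
    as the Fatou argument below requires.\<close>
  define R where "R k = (\<Sum>i\<le>k. N i) + k" for k
  have RN: "R l \<ge> N k" if "l \<ge> k" for k l
    using member_le_sum[of k "{..l}" N] that by (simp add: R_def)
  have Rk: "R k \<ge> k" for k
    by (simp add: R_def)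
  define d where "d k x = g (R (Suc k)) x - g (R k) x" for k x
  have [measurable]: "\<And>k. d k \<in> borel_measurable M"
    by (simp add: d_def[abs_def])
  have dL2: "d k \<in> L2 M" for k
    unfolding d_def[abs_def] by (rule L2_diff[OF g g])
  have dn: "l2norm M (d k) \<le> (1/2)^k" for k
    unfolding d_def[abs_def] by (rule N) (auto intro: RN)
  \<comment> \<open>The weight \<open>2^k\<close> is a compromise: the squared norms decay like
    \<open>4^-k\<close>, so the integral of \<open>H\<close> stays finite, while finiteness of
    \<open>H x\<close> still forces geometric decay of \<open>d k x\<close>.\<close>
  define H where "H x = (\<Sum>k. ennreal (2^k * (cmod (d k x))\<^sup>2))" for x
  have [measurable]: "H \<in> borel_measurable M"
    by (simp add: H_def[abs_def])
  have "(\<integral>\<^sup>+x. H x \<partial>M) = (\<Sum>k. \<integral>\<^sup>+x. ennreal (2^k * (cmod (d k x))\<^sup>2) \<partial>M)"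
    unfolding H_def by (rule nn_integral_suminf) simp
  also have "\<dots> \<le> (\<Sum>k. ennreal ((1/2)^k))"
  proof (rule suminf_le)
    fix k
    have "(\<integral>\<^sup>+x. ennreal (2^k * (cmod (d k x))\<^sup>2) \<partial>M) = ennreal (2^k * (l2norm M (d k))\<^sup>2)"
      by (simp add: ennreal_mult nn_integral_cmult L2_nn_integral[OF dL2])
    also have "\<dots> \<le> ennreal (2^k * ((1/2)^k)\<^sup>2)"
      using dn[of k] by (intro ennreal_leI mult_left_mono power_mono) auto
    also have "2^k * ((1/2)^k)\<^sup>2 = ((1/2)^k :: real)"
      by (simp add: power2_eq_square power_divide)
    finally show "(\<integral>\<^sup>+x. ennreal (2^k * (cmod (d k x))\<^sup>2) \<partial>M) \<le> ennreal ((1/2)^k)" .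
  qed auto
  also have "\<dots> = ennreal (\<Sum>k. (1/2)^k)"
    by (rule suminf_ennreal_eq) (auto simp: sums_iff summable_geometric)
  finally have "(\<integral>\<^sup>+x. H x \<partial>M) \<noteq> \<infinity>"
    by (auto simp: top_unique)
  then have AEH: "AE x in M. H x \<noteq> \<infinity>"
    by (intro nn_integral_PInf_AE) auto
  have conv: "convergent (\<lambda>k. g (R k) x)" if Hx: "H x \<noteq> \<infinity>" for x
  proof -
    define c where "c = enn2real (H x)"
    have "ennreal (2^k * (cmod (d k x))\<^sup>2) \<le> H x" for k
    proof -
      have "(\<Sum>k\<in>{k}. ennreal (2^k * (cmod (d k x))\<^sup>2)) \<le> H x"
        unfolding H_def by (rule sum_le_suminf) (auto intro: summableI)
      then show ?thesis
        by (simp del: ennreal_mult')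
    qed
    moreover have "H x = ennreal c"
      using Hx by (simp add: c_def less_top)
    ultimately have c: "2^k * (cmod (d k x))\<^sup>2 \<le> c" for k
      using c_def by (metis enn2real_nonneg ennreal_le_iff)
    have c0: "c \<ge> 0"
      by (simp add: c_def)
    have "summable (\<lambda>k. d k x)"
    proof (rule summable_comparison_test)
      have "cmod (d k x) \<le> sqrt c * (1 / sqrt 2)^k" for k
      proof (rule power2_le_imp_le)
        have "(cmod (d k x))\<^sup>2 \<le> c / 2^k"
          using c[of k] by (simp add: field_simps)
        also have "\<dots> = (sqrt c * (1 / sqrt 2)^k)\<^sup>2"
        proof -
          have "((1 / sqrt 2)^k)\<^sup>2 = ((1 / sqrt 2)\<^sup>2)^k"
            by (metis power_mult mult.commute)
          also have "(1 / sqrt 2)\<^sup>2 = (1/2 :: real)"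
            by (simp add: power_divide)
          finally show ?thesis
            using c0 by (simp add: power_mult_distrib power_divide)
        qed
        finally show "(cmod (d k x))\<^sup>2 \<le> (sqrt c * (1 / sqrt 2)^k)\<^sup>2" .
      qed (use c0 in simp)
      then show "\<exists>N. \<forall>n\<ge>N. norm (d n x) \<le> sqrt c * (1 / sqrt 2)^n"
        by blast
      show "summable (\<lambda>k. sqrt c * (1 / sqrt 2)^k)"
        by (intro summable_mult summable_geometric) auto
    qed
    then have "convergent (\<lambda>n. \<Sum>k<n. d k x)"
      by (simp add: summable_iff_convergent)
    moreover have "(\<Sum>k<n. d k x) = g (R n) x - g (R 0) x" for n
      unfolding d_def by (rule sum_lessThan_telescope)
    ultimately have "convergent (\<lambda>n. g (R n) x - g (R 0) x)"
      by simp
    then show ?thesis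
      using convergent_diff_const_right_iff by blast
  qed
  define h where "h x = lim (\<lambda>k. g (R k) x)" for x
  have h[measurable]: "h \<in> borel_measurable M"
    by (simp add: h_def[abs_def])
  have lim: "AE x in M. (\<lambda>k. g (R k) x) \<longlonglongrightarrow> h x"
    using AEH by eventually_elim (use conv in \<open>simp only: h_def convergent_LIMSEQ_iff\<close>)
  \<comment> \<open>Fatou along the subsequence turns a bound on the tail into a bound for the
    limit. It is used with \<open>e = 1\<close> for membership of \<open>h\<close> in L2 and with
    \<open>e / 2\<close> for convergence of the whole sequence.\<close>
  have key: "(\<lambda>x. h x - g m x) \<in> L2 M \<and> l2norm M (\<lambda>x. h x - g m x) \<le> e"
    if e: "e \<ge> 0" and ev: "\<forall>n\<ge>K. l2norm M (\<lambda>x. g n x - g m x) \<le> e" for m K e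
  proof -
    have "(\<integral>\<^sup>+x. ennreal ((cmod (h x - g m x))\<^sup>2) \<partial>M)
        = (\<integral>\<^sup>+x. liminf (\<lambda>k. ennreal ((cmod (g (R k) x - g m x))\<^sup>2)) \<partial>M)"
    proof (rule nn_integral_cong_AE, use lim in eventually_elim)
      fix x assume "(\<lambda>k. g (R k) x) \<longlonglongrightarrow> h x"
      then have "(\<lambda>k. ennreal ((cmod (g (R k) x - g m x))\<^sup>2)) \<longlonglongrightarrow> ennreal ((cmod (h x - g m x))\<^sup>2)"
        by (intro tendsto_intros) auto
      then show "ennreal ((cmod (h x - g m x))\<^sup>2) = liminf (\<lambda>k. ennreal ((cmod (g (R k) x - g m x))\<^sup>2))"
        by (metis lim_imp_Liminf sequentially_bot)
    qed
    also have "\<dots> \<le> liminf (\<lambda>k. \<integral>\<^sup>+x. ennreal ((cmod (g (R k) x - g m x))\<^sup>2) \<partial>M)"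
      by (rule nn_integral_liminf) simp
    also have "\<dots> \<le> liminf (\<lambda>k::nat. ennreal (e\<^sup>2))"
    proof (rule Liminf_mono, rule eventually_sequentiallyI[of K])
      fix k assume "k \<ge> K"
      then have "l2norm M (\<lambda>x. g (R k) x - g m x) \<le> e"
        using ev Rk[of k] by auto
      then show "(\<integral>\<^sup>+x. ennreal ((cmod (g (R k) x - g m x))\<^sup>2) \<partial>M) \<le> ennreal (e\<^sup>2)"
        by (simp add: L2_nn_integral[OF L2_diff[OF g g]] power_mono ennreal_leI)
    qed
    also have "\<dots> = ennreal (e\<^sup>2)"
      by (simp add: Liminf_const)
    finally show ?thesis
      using L2_I_nn_integral[of "\<lambda>x. h x - g m x" M e] e by auto
  qed
  obtain K where K: "\<forall>m\<ge>K. \<forall>n\<ge>K. l2norm M (\<lambda>x. g m x - g n x) \<le> 1"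
    using Cauchy[of 1] by auto
  then have "(\<lambda>x. h x - g K x) \<in> L2 M"
    using key[of 1 K K] by auto
  from L2_add[OF this g[of K]] have "h \<in> L2 M"
    by simp
  moreover have "(\<lambda>n. l2norm M (\<lambda>x. g n x - h x)) \<longlonglongrightarrow> 0"
  proof (rule LIMSEQ_I)
    fix e :: real assume "e > 0"
    then obtain K where K: "\<forall>m\<ge>K. \<forall>n\<ge>K. l2norm M (\<lambda>x. g m x - g n x) \<le> e / 2"
      using Cauchy[of "e/2"] by auto
    have "l2norm M (\<lambda>x. g m x - h x) < e" if "m \<ge> K" for m
      using key[of "e/2" K m] K that \<open>e > 0\<close> l2norm_minus_commute[of M h "g m"] by auto
    then show "\<exists>no. \<forall>n\<ge>no. norm (l2norm M (\<lambda>x. g n x - h x) - 0) < e"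
      by auto
  qed
  ultimately show ?thesis
    by blast
qed

subsection \<open>Balls of the Vilenkin group and uniqueness of the Haar measure\<close>

text \<open>The coset of \<open>U_n\<close> through \<open>x\<close>, described by coordinates
  instead of \<open>vadd\<close>: \<open>x\<close> matters only up to index \<open>n\<close> and may
  lie outside the carrier, in which case the set may be empty.\<close>

definition vcoset :: "nat \<Rightarrow> int \<Rightarrow> (int \<Rightarrow> nat) \<Rightarrow> (int \<Rightarrow> nat) set" where
  "vcoset p n x = {y \<in> vilenkin p. \<forall>j\<le>n. y j = x j}"

lemma mem_vcoset: "y \<in> vcoset p n x \<longleftrightarrow> y \<in> vilenkin p \<and> (\<forall>j\<le>n. y j = x j)"
  by (simp add: vcoset_def)

lemma vcoset_cong: "(\<And>j. j \<le> n \<Longrightarrow> x j = y j) \<Longrightarrow> vcoset p n x = vcoset p n y"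
  by (auto simp: vcoset_def)

lemma vcoset_eqI: "y \<in> vcoset p n x \<Longrightarrow> vcoset p n y = vcoset p n x"
  by (rule vcoset_cong) (simp add: mem_vcoset)

lemma vcoset_antimono: "m \<le> n \<Longrightarrow> vcoset p n x \<subseteq> vcoset p m x"
  by (auto simp: vcoset_def)

text \<open>Ultrametric geometry: by \<open>vcoset_eqI\<close> every point of a coset is a centre of
  it, so a common point places the finer coset inside the coarser one.\<close>

lemma vcoset_subset_or_disjoint:
  assumes "m \<le> n"
  shows "vcoset p n y \<subseteq> vcoset p m x \<or> vcoset p n y \<inter> vcoset p m x = {}"
proof (cases "vcoset p n y \<inter> vcoset p m x = {}")
  case False
  then obtain z where "z \<in> vcoset p n y" "z \<in> vcoset p m x"
    by blast
  then show ?thesis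
    using vcoset_eqI vcoset_antimono[OF assms] by metis
qed simp

lemma vilenkin_less: "x \<in> vilenkin p \<Longrightarrow> x j < p"
  by (simp add: vilenkin_def)

lemma vilenkin_support_bounded:
  assumes "x \<in> vilenkin p"
  shows "\<exists>N::nat. \<forall>j. j \<le> - int N \<longrightarrow> x j = 0"
proof -
  have fin: "finite {j. j < 0 \<and> x j \<noteq> 0}"
    using assms by (simp add: vilenkin_def)
  show ?thesis
  proof (cases "{j. j < 0 \<and> x j \<noteq> 0} = {}")
    case True
    then have "\<forall>j. j \<le> - int 1 \<longrightarrow> x j = 0"
      by auto
    then show ?thesis ..
  next
    case False
    let ?m = "Min {j. j < 0 \<and> x j \<noteq> 0}"
    have "x j = 0" if "j \<le> - int (nat (1 - ?m))" for j
    proof (rule ccontr)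
      assume "x j \<noteq> 0"
      moreover have "?m < 0"
        using Min_in[OF fin False] by blast
      ultimately have "j \<in> {j. j < 0 \<and> x j \<noteq> 0}"
        using that by auto
      then show False
        using Min_le[OF fin, of j] that by auto
    qed
    then show ?thesis
      by blast
  qed
qed

lemma vilenkinI:
  assumes "\<And>j. x j < p" "\<And>j. j \<le> N \<Longrightarrow> x j = 0"
  shows "x \<in> vilenkin p"
proof -
  have "{j. j < 0 \<and> x j \<noteq> 0} \<subseteq> {N..0}"
  proof
    fix j assume "j \<in> {j. j < 0 \<and> x j \<noteq> 0}"
    then show "j \<in> {N..0}"
      using assms(2)[of j] by (cases "j \<le> N") auto
  qed
  then have "finite {j. j < 0 \<and> x j \<noteq> 0}"
    by (rule finite_subset) simp
  then show ?thesis
    using assms by (simp add: vilenkin_def)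
qed

lemma vilenkin_eq_Union: "vilenkin p = (\<Union>N::nat. vcoset p (- int N) vzero)"
  using vilenkin_support_bounded by (fastforce simp: vcoset_def vzero_def)

lemma vnbhd_eq_vcoset: "vnbhd p n = vcoset p n vzero"
  by (simp add: vnbhd_def vcoset_def vzero_def)

lemma vdilate_closed: "x \<in> vilenkin p \<Longrightarrow> vdilate i x \<in> vilenkin p"
proof -
  assume x: "x \<in> vilenkin p"
  obtain N :: nat where "\<And>j. j \<le> - int N \<Longrightarrow> x j = 0"
    using vilenkin_support_bounded[OF x] by blast
  then show ?thesis
    by (intro vilenkinI[of _ _ "- int N - i"]) (auto simp: vdilate_def vilenkin_less[OF x])
qed

lemma vadd_closed:
  assumes "x \<in> vilenkin p" "y \<in> vilenkin p"
  shows "vadd p x y \<in> vilenkin p"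
proof -
  obtain N M :: nat where N: "\<And>j. j \<le> - int N \<Longrightarrow> x j = 0" and M: "\<And>j. j \<le> - int M \<Longrightarrow> y j = 0"
    using vilenkin_support_bounded assms by metis
  show ?thesis
  proof (rule vilenkinI)
    show "vadd p x y j < p" for j
      using vilenkin_less[OF assms(1), of j] by (simp add: vadd_def)
    show "vadd p x y j = 0" if "j \<le> - int (N + M)" for j
      using N[of j] M[of j] that by (simp add: vadd_def)
  qed
qed

lemma vneg_closed:
  assumes "x \<in> vilenkin p"
  shows "vneg p x \<in> vilenkin p"
proof -
  obtain N :: nat where N: "\<And>j. j \<le> - int N \<Longrightarrow> x j = 0"
    using vilenkin_support_bounded assms by metis
  show ?thesis
  proof (rule vilenkinI)
    show "vneg p x j < p" for j
      using vilenkin_less[OF assms(1), of j] by (simp add: vneg_def)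
    show "vneg p x j = 0" if "j \<le> - int N" for j
      using N[of j] that by (simp add: vneg_def)
  qed
qed

lemma vdiff_closed: "x \<in> vilenkin p \<Longrightarrow> y \<in> vilenkin p \<Longrightarrow> vdiff p x y \<in> vilenkin p"
  by (simp add: vdiff_def vadd_closed vneg_closed)

text \<open>The inner \<open>mod\<close> matters only for \<open>b = 0\<close>, where
  \<open>p - b\<close> is not a digit; otherwise both sides describe a subtraction with at most one
  wrap-around.\<close>

lemma vdiff_eq_iff:
  assumes "a < p" "b < p" "c < p"
  shows "(a + (p - b) mod p) mod p = c \<longleftrightarrow> a = (c + b) mod (p::nat)"
proof (cases "b = 0")
  case True
  then show ?thesis
    using assms by auto
next
  case False
  then have "(p - b) mod p = p - b"
    using assms by simp
  then show ?thesis
    using assms by (auto simp: mod_if)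
qed

lemma vdiff_self_coordinate: "a < p \<Longrightarrow> (a + (p - a) mod p) mod p = (0::nat)"
  using vdiff_eq_iff[of a p a 0] by simp

text \<open>Needed to transport the Haar measure: with the next two lemmas, preimages of cosets
  under translations and dilations are again cosets, and only dilations change the level.\<close>

lemma vdiff_mem_vcoset_iff:
  assumes "x \<in> vilenkin p" "h \<in> vilenkin p" "y \<in> vilenkin p"
  shows "vdiff p x h \<in> vcoset p n y \<longleftrightarrow> x \<in> vcoset p n (vadd p y h)"
  using vdiff_closed[OF assms(1,2)] assms(1) vilenkin_less[OF assms(1)] vilenkin_less[OF assms(2)]
    vilenkin_less[OF assms(3)]
  by (auto simp: mem_vcoset vdiff_def vadd_def vneg_def vdiff_eq_iff)

lemma vadd_mem_vcoset_iff:
  assumes "x \<in> vilenkin p" "h \<in> vilenkin p" "y \<in> vilenkin p"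
  shows "vadd p h x \<in> vcoset p n y \<longleftrightarrow> x \<in> vcoset p n (vdiff p y h)"
proof -
  have "(h j + x j) mod p = y j \<longleftrightarrow> x j = (y j + (p - h j) mod p) mod p" for j
    using vdiff_eq_iff[of "y j" p "h j" "x j"] vilenkin_less[OF assms(1)] vilenkin_less[OF assms(2)]
    vilenkin_less[OF assms(3)] by (metis add.commute)
  then show ?thesis
    using vadd_closed[OF assms(2,1)] assms(1)
    by (simp add: mem_vcoset vdiff_def) (simp add: vadd_def vneg_def)
qed

lemma vdilate_mem_vcoset_iff:
  assumes "x \<in> vilenkin p"
  shows "vdilate i x \<in> vcoset p n y \<longleftrightarrow> x \<in> vcoset p (n + i) (vdilate (- i) y)"
proof -
  have "(\<forall>j\<le>n. x (j + i) = y j) \<longleftrightarrow> (\<forall>j\<le>n + i. x j = y (j - i))"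
    by (metis add_le_cancel_right diff_add_cancel add_diff_cancel_right')
  then show ?thesis
    using assms vdilate_closed[OF assms] by (simp add: mem_vcoset vdilate_def)
qed

text \<open>Connects the translates in the definition of the topology with the coordinate
  description; the element of \<open>U_n\<close> that carries \<open>x\<close> to \<open>y\<close>
  is \<open>vdiff p y x\<close>.\<close>

lemma translate_vnbhd:
  assumes x: "x \<in> vilenkin p"
  shows "vadd p x ` vnbhd p n = vcoset p n x"
proof (intro equalityI subsetI)
  fix y assume "y \<in> vadd p x ` vnbhd p n"
  then show "y \<in> vcoset p n x"
    using vadd_closed[OF x] vilenkin_less[OF x]
    by (auto simp: vnbhd_def mem_vcoset) (simp add: vadd_def)
next
  fix y assume y: "y \<in> vcoset p n x"
  then have yG: "y \<in> vilenkin p"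
    by (simp add: mem_vcoset)
  have "y j = (x j + (y j + (p - x j) mod p) mod p) mod p" for j
    using vdiff_eq_iff[of "y j" p "x j" "(y j + (p - x j) mod p) mod p"]
      vilenkin_less[OF x, of j] vilenkin_less[OF yG, of j]
    by (simp add: add.commute)
  then have "y = vadd p x (vdiff p y x)"
    by (auto simp: vadd_def vdiff_def vneg_def)
  moreover have "vdiff p y x \<in> vnbhd p n"
    using vdiff_closed[OF yG x] y vilenkin_less[OF x] vilenkin_less[OF yG]
    by (auto simp: vnbhd_def mem_vcoset vdiff_def vadd_def vneg_def vdiff_self_coordinate)
  ultimately show "y \<in> vadd p x ` vnbhd p n"
    by blast
qed

lemma openin_vtopology_vcoset:
  "openin (vtopology p) S \<longleftrightarrow> S \<subseteq> vilenkin p \<and> (\<forall>x\<in>S. \<exists>l. vcoset p l x \<subseteq> S)"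
  unfolding openin_vtopology by (metis subsetD translate_vnbhd)

lemma openin_vcoset: "openin (vtopology p) (vcoset p n x)"
  unfolding openin_vtopology_vcoset
  by (metis (no_types, lifting) mem_vcoset subsetI vcoset_eqI)

lemma topspace_vtopology: "topspace (vtopology p) = vilenkin p"
proof -
  have "openin (vtopology p) (vilenkin p)"
    unfolding openin_vtopology_vcoset by (auto simp: mem_vcoset)
  then show ?thesis
    by (metis openin_subset openin_topspace openin_vtopology subset_antisym)
qed

text \<open>Generator of the Borel sets. The empty set is included for stability under intersection,
  and centres are taken in the carrier so that the measure formula applies to each nonempty
  member.\<close>

definition vcosets :: "nat \<Rightarrow> (int \<Rightarrow> nat) set set" where
  "vcosets p = insert {} {vcoset p n x |n x. x \<in> vilenkin p}"

lemma vcoset_in_vcosets: "vcoset p n x \<in> vcosets p"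
proof (cases "vcoset p n x = {}")
  case False
  then obtain y where "y \<in> vcoset p n x"
    by blast
  then have "vcoset p n x = vcoset p n y" "y \<in> vilenkin p"
    by (simp_all add: vcoset_eqI) (simp add: mem_vcoset)
  then show ?thesis
    unfolding vcosets_def by blast
qed (simp add: vcosets_def)

lemma Int_stable_vcosets: "Int_stable (vcosets p)"
proof (rule Int_stableI)
  have *: "vcoset p m x \<inter> vcoset p n y \<in> vcosets p" for m n x y
    using vcoset_subset_or_disjoint[of m n p y x] vcoset_subset_or_disjoint[of n m p x y]
      vcoset_in_vcosets[of p n y] vcoset_in_vcosets[of p m x]
    by (cases "m \<le> n") (auto simp: Int_absorb1 Int_absorb2 Int_commute vcosets_def)
  show "a \<inter> b \<in> vcosets p" if "a \<in> vcosets p" "b \<in> vcosets p" for a b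
  proof (cases "a = {} \<or> b = {}")
    case True
    then show ?thesis
      by (auto simp: vcosets_def)
  next
    case False
    then obtain m x n y where "a = vcoset p m x" "b = vcoset p n y"
      using \<open>a \<in> vcosets p\<close> \<open>b \<in> vcosets p\<close> by (auto simp: vcosets_def)
    then show ?thesis
      by (simp add: *)
  qed
qed

lemma countable_vcosets: "countable (vcosets p)"
proof -
  \<comment> \<open>\<open>tr n x\<close> is the graph of the nonzero coordinates of
    \<open>x\<close> up to index \<open>n\<close>. It is finite for \<open>x\<close> in the carrier
    and determines the coset, so cosets are indexed by an integer and a finite set of pairs.\<close>
  define tr :: "int \<Rightarrow> (int \<Rightarrow> nat) \<Rightarrow> (int \<times> nat) set"
    where "tr n x = {(j, x j) |j. j \<le> n \<and> x j \<noteq> 0}" for n x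
  define un :: "int \<Rightarrow> (int \<times> nat) set \<Rightarrow> (int \<Rightarrow> nat) set"
    where "un n S = {y \<in> vilenkin p. tr n y = S}" for n S
  have "vcoset p n x \<in> case_prod un ` (UNIV \<times> Collect finite)" if x: "x \<in> vilenkin p" for n x
  proof -
    obtain N :: nat where N: "\<And>j. j \<le> - int N \<Longrightarrow> x j = 0"
      using vilenkin_support_bounded[OF x] by blast
    have "j \<in> {- int N..n}" if "j \<le> n" "x j \<noteq> 0" for j
      using N[of j] that by force
    then have "tr n x \<subseteq> (\<lambda>j. (j, x j)) ` {- int N..n}"
      by (auto simp: tr_def)
    then have fin: "finite (tr n x)"
      by (rule finite_subset) simp
    have "tr n y = tr n x \<longleftrightarrow> (\<forall>j\<le>n. y j = x j)" for y
    proof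
      assume eq: "tr n y = tr n x"
      show "\<forall>j\<le>n. y j = x j"
      proof (intro allI impI)
        fix j assume "j \<le> n"
        then have "(k \<noteq> 0 \<and> y j = k) \<longleftrightarrow> (k \<noteq> 0 \<and> x j = k)" for k
          using eq by (auto simp: tr_def set_eq_iff)
        then show "y j = x j"
          by metis
      qed
    qed (auto simp: tr_def)
    then have "vcoset p n x = un n (tr n x)"
      by (auto simp: un_def vcoset_def)
    then show ?thesis
      using fin by force
  qed
  then have "vcosets p \<subseteq> insert {} (case_prod un ` (UNIV \<times> Collect finite))"
    by (auto simp: vcosets_def)
  then show ?thesis
    by (rule countable_subset) (auto intro: countable_Collect_finite)
qed

text \<open>An open set is the union of the cosets that it contains, and there are only countably
  many cosets.\<close>

lemma sigma_sets_vcosets: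
  "sigma_sets (vilenkin p) {S. openin (vtopology p) S} = sigma_sets (vilenkin p) (vcosets p)"
proof (rule sigma_sets_eqI)
  fix S assume "S \<in> {S. openin (vtopology p) S}"
  then have S: "S \<subseteq> vilenkin p" "\<And>x. x \<in> S \<Longrightarrow> \<exists>l. vcoset p l x \<subseteq> S"
    by (auto simp: openin_vtopology_vcoset)
  let ?C = "{c \<in> vcosets p. c \<subseteq> S}"
  have "S = \<Union>?C"
  proof (intro equalityI subsetI)
    fix x assume x: "x \<in> S"
    then obtain l where "vcoset p l x \<subseteq> S"
      using S(2) by blast
    moreover have "x \<in> vcoset p l x"
      using x S(1) by (auto simp: mem_vcoset)
    ultimately show "x \<in> \<Union>?C"
      using vcoset_in_vcosets by blast
  qed auto
  moreover have "\<Union>?C \<in> sigma_sets (vilenkin p) (vcosets p)"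
    by (rule sigma_sets_UNION)
       (auto intro: countable_subset[OF _ countable_vcosets[of p]] sigma_sets.Basic)
  ultimately show "S \<in> sigma_sets (vilenkin p) (vcosets p)"
    by simp
next
  fix S assume "S \<in> vcosets p"
  then have "openin (vtopology p) S"
    by (auto simp: vcosets_def openin_vcoset)
  then show "S \<in> sigma_sets (vilenkin p) {S. openin (vtopology p) S}"
    by (simp add: sigma_sets.Basic)
qed

section \<open>Haar measure of cosets and its behaviour under maps\<close>

locale vilenkin_haar =
  fixes p :: nat and \<mu> :: "(int \<Rightarrow> nat) measure"
  assumes p2: "p \<ge> 2" and haar: "haar_measure p \<mu>"
begin

lemma p_pos [simp]: "p > 0"
  using p2 by simp

lemma space_mu [simp]: "space \<mu> = vilenkin p"
  using haar by (simp add: haar_measure_def)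

lemma sets_mu: "sets \<mu> = sigma_sets (vilenkin p) (vcosets p)"
  using haar by (simp add: haar_measure_def sigma_sets_vcosets)

lemma vcoset_sets [measurable, simp]: "vcoset p n x \<in> sets \<mu>"
  by (simp add: sets_mu sigma_sets.Basic vcoset_in_vcosets)

lemma vzero_closed [simp]: "vzero \<in> vilenkin p"
  by (rule vilenkinI[of _ _ 0]) (auto simp: vzero_def)

lemma openin_sets: "openin (vtopology p) S \<Longrightarrow> S \<in> sets \<mu>"
  using haar by (auto simp: haar_measure_def)

lemma emeasure_vcoset_eq_vnbhd:
  "x \<in> vilenkin p \<Longrightarrow> emeasure \<mu> (vcoset p n x) = emeasure \<mu> (vcoset p n vzero)"
  using haar translate_vnbhd[of x p n] vcoset_sets[of n vzero]
  unfolding haar_measure_def vnbhd_eq_vcoset by metis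

text \<open>The coordinate \<open>n + 1\<close> splits \<open>U_n\<close> into \<open>p\<close>
  disjoint cosets of \<open>U_{n+1}\<close>, all of the same measure by invariance.\<close>

lemma emeasure_vcoset_step:
  "emeasure \<mu> (vcoset p n vzero) = ennreal p * emeasure \<mu> (vcoset p (n + 1) vzero)"
proof -
  let ?e = "\<lambda>c. (vzero :: int \<Rightarrow> nat)(n + 1 := c)"
  have e: "?e c \<in> vilenkin p" if "c < p" for c
    by (rule vilenkinI[of _ _ n]) (use that in \<open>auto simp: vzero_def\<close>)
  have "vcoset p n vzero = (\<Union>c<p. vcoset p (n + 1) (?e c))"
  proof (intro equalityI subsetI)
    fix y assume y: "y \<in> vcoset p n vzero"
    have "y \<in> vcoset p (n + 1) (?e (y (n + 1)))"
      unfolding mem_vcoset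
    proof (intro conjI allI impI)
      show "y j = ?e (y (n + 1)) j" if "j \<le> n + 1" for j
        using y that by (cases "j = n + 1") (simp_all add: mem_vcoset)
    qed (use y in \<open>simp add: mem_vcoset\<close>)
    moreover have "y (n + 1) < p"
      using y by (intro vilenkin_less) (simp add: mem_vcoset)
    ultimately show "y \<in> (\<Union>c<p. vcoset p (n + 1) (?e c))"
      by blast
  qed (auto simp: mem_vcoset)
  then have "emeasure \<mu> (vcoset p n vzero) = emeasure \<mu> (\<Union>c<p. vcoset p (n + 1) (?e c))"
    by simp
  also have "\<dots> = (\<Sum>c<p. emeasure \<mu> (vcoset p (n + 1) (?e c)))"
  proof (rule sum_emeasure[symmetric])
    show "disjoint_family_on (\<lambda>c. vcoset p (n + 1) (?e c)) {..<p}"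
      by (auto simp: disjoint_family_on_def mem_vcoset dest!: spec[of _ "n + 1"])
  qed auto
  also have "\<dots> = (\<Sum>c<p. emeasure \<mu> (vcoset p (n + 1) vzero))"
    by (intro sum.cong refl emeasure_vcoset_eq_vnbhd e) auto
  also have "\<dots> = ennreal p * emeasure \<mu> (vcoset p (n + 1) vzero)"
    by (simp add: ennreal_of_nat_eq_real_of_nat)
  finally show ?thesis .
qed

text \<open>The normalisation fixes level 0; the step lemma propagates it upwards by cancelling the
  factor \<open>p\<close> and downwards by multiplying with it.\<close>

lemma emeasure_vcoset_vzero: "emeasure \<mu> (vcoset p n vzero) = ennreal (real p powi (- n))"
proof (induction n rule: int_induct[where k = 0])
  case base
  show ?case
    using haar by (simp add: haar_measure_def vnbhd_eq_vcoset)
next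
  case (step1 i)
  have "ennreal (real p powi (- i)) = ennreal (real p) * ennreal (real p powi (- (i + 1)))"
    using p_pos by (simp add: power_int_diff power_int_minus field_simps flip: ennreal_mult)
  with step1 have "ennreal p * emeasure \<mu> (vcoset p (i + 1) vzero)
      = ennreal p * ennreal (real p powi (- (i + 1)))"
    by (simp add: emeasure_vcoset_step[of i])
  then show ?case
    using p_pos by (simp add: ennreal_mult_cancel_left)
next
  case (step2 i)
  then show ?case
    using emeasure_vcoset_step[of "i - 1"] p_pos
    by (simp add: power_int_diff power_int_minus field_simps flip: ennreal_mult)
qed

lemma emeasure_vcoset:
  "x \<in> vilenkin p \<Longrightarrow> emeasure \<mu> (vcoset p n x) = ennreal (real p powi (- n))"
  by (simp add: emeasure_vcoset_eq_vnbhd emeasure_vcoset_vzero)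

lemma measure_vcoset: "x \<in> vilenkin p \<Longrightarrow> measure \<mu> (vcoset p n x) = real p powi (- n)"
  by (simp add: measure_def emeasure_vcoset)

text \<open>Coordinates are locally constant, so preimages of arbitrary sets are open.\<close>

lemma measurable_coordinate [measurable]: "(\<lambda>x. x j) \<in> measurable \<mu> (count_space UNIV)"
proof (rule measurableI)
  fix A :: "nat set"
  have "openin (vtopology p) ((\<lambda>x. x j) -` A \<inter> space \<mu>)"
    unfolding openin_vtopology_vcoset
  proof (intro conjI ballI)
    fix x assume "x \<in> (\<lambda>x. x j) -` A \<inter> space \<mu>"
    then have "vcoset p j x \<subseteq> (\<lambda>x. x j) -` A \<inter> space \<mu>"
      by (auto simp: mem_vcoset)
    then show "\<exists>l. vcoset p l x \<subseteq> (\<lambda>x. x j) -` A \<inter> space \<mu>" ..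
  qed auto
  then show "(\<lambda>x. x j) -` A \<inter> space \<mu> \<in> sets \<mu>"
    by (rule openin_sets)
qed simp

lemma sigma_finite: "sigma_finite_measure \<mu>"
proof
  show "\<exists>A. countable A \<and> A \<subseteq> sets \<mu> \<and> \<Union> A = space \<mu> \<and> (\<forall>a\<in>A. emeasure \<mu> a \<noteq> \<infinity>)"
    by (rule exI[of _ "range (\<lambda>N::nat. vcoset p (- int N) vzero)"])
       (auto simp: emeasure_vcoset_vzero simp flip: vilenkin_eq_Union)
qed

sublocale sigma_finite_measure \<mu>
  by (rule sigma_finite)

sublocale P: pair_sigma_finite \<mu> \<mu>
  by unfold_locales

lemma measurable_vcosetI:
  assumes "\<And>x. x \<in> vilenkin p \<Longrightarrow> T x \<in> vilenkin p"
    and "\<And>n y. y \<in> vilenkin p \<Longrightarrow> T -` vcoset p n y \<inter> vilenkin p \<in> sets \<mu>"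
  shows "T \<in> measurable \<mu> \<mu>"
proof (rule measurable_sigma_sets[OF sets_mu])
  show "vcosets p \<subseteq> Pow (vilenkin p)"
    by (auto simp: vcosets_def mem_vcoset)
  show "T -` A \<inter> space \<mu> \<in> sets \<mu>" if "A \<in> vcosets p" for A
    using that assms(2) by (auto simp: vcosets_def)
qed (use assms(1) in auto)

text \<open>Uniqueness of measures on an intersection-stable generator, with the balls
  \<open>U_{-N}\<close> of finite measure as exhaustion. Translations give \<open>c = 1\<close>,
  dilation by \<open>i\<close> gives \<open>c = p^-i\<close>.\<close>

lemma distr_eq_density_const:
  assumes T[measurable]: "T \<in> measurable \<mu> \<mu>" and "c \<ge> 0"
    and meas: "\<And>n y. y \<in> vilenkin p \<Longrightarrow>
      emeasure \<mu> (T -` vcoset p n y \<inter> vilenkin p) = ennreal (c * real p powi (- n))"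
  shows "distr \<mu> \<mu> T = density \<mu> (\<lambda>_. ennreal c)"
proof (rule measure_eqI_generator_eq[where E = "vcosets p" and \<Omega> = "vilenkin p"
      and A = "\<lambda>N::nat. vcoset p (- int N) vzero"])
  show "Int_stable (vcosets p)"
    by (rule Int_stable_vcosets)
  show "vcosets p \<subseteq> Pow (vilenkin p)"
    by (auto simp: vcosets_def mem_vcoset)
  show "emeasure (distr \<mu> \<mu> T) X = emeasure (density \<mu> (\<lambda>_. ennreal c)) X" if "X \<in> vcosets p" for X
    using that meas \<open>c \<ge> 0\<close>
    by (auto simp: vcosets_def emeasure_distr emeasure_density_const emeasure_vcoset
        ennreal_mult)
  show "range (\<lambda>N::nat. vcoset p (- int N) vzero) \<subseteq> vcosets p"
    by (auto simp: vcoset_in_vcosets)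
  show "emeasure (distr \<mu> \<mu> T) (vcoset p (- int N) vzero) \<noteq> \<infinity>" for N
    using meas[of vzero "- int N"] by (simp add: emeasure_distr)
qed (auto simp: sets_mu simp flip: vilenkin_eq_Union)

end

subsection \<open>Averaging over cosets of a ball\<close>

text \<open>Symmetric in its two arguments, so that averaging is visibly self-adjoint. With first
  argument \<open>vzero\<close> it is also the cut-off to a ball, in particular on the frequency
  side.\<close>

definition vker :: "int \<Rightarrow> (int \<Rightarrow> nat) \<Rightarrow> (int \<Rightarrow> nat) \<Rightarrow> complex" where
  "vker n x y = (if \<forall>j\<le>n. y j = x j then 1 else 0)"

lemma vker_commute: "vker n x y = vker n y x"
  by (auto simp: vker_def)

lemma cnj_vker [simp]: "cnj (vker n x y) = vker n x y"
  and cmod_vker_power2 [simp]: "(cmod (vker n x y))\<^sup>2 = cmod (vker n x y)"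
  by (auto simp: vker_def)

lemma vker_eq_indicator: "y \<in> vilenkin p \<Longrightarrow> vker n x y = indicator (vcoset p n x) y"
  by (auto simp: vker_def mem_vcoset indicator_def)

lemma cmod_vker_eq_indicator: "y \<in> vilenkin p \<Longrightarrow> cmod (vker n x y) = indicator (vcoset p n x) y"
  by (auto simp: vker_def mem_vcoset indicator_def)

text \<open>The factor \<open>p^n\<close> is the reciprocal of the measure of a coset, so this is
  the conditional expectation onto functions that are constant on cosets of
  \<open>U_n\<close>.\<close>

definition vavg ::
    "nat \<Rightarrow> (int \<Rightarrow> nat) measure \<Rightarrow> int \<Rightarrow> ((int \<Rightarrow> nat) \<Rightarrow> complex) \<Rightarrow> (int \<Rightarrow> nat) \<Rightarrow> complex" where
  "vavg p \<mu> n f x = complex_of_real (real p powi n) * (\<integral>y. vker n x y * f y \<partial>\<mu>)"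

lemma vker_cong: "(\<And>j. j \<le> n \<Longrightarrow> x j = y j) \<Longrightarrow> vker n x = vker n y"
  by (auto simp: vker_def)

lemma vavg_cong: "(\<And>j. j \<le> n \<Longrightarrow> x j = y j) \<Longrightarrow> vavg p \<mu> n f x = vavg p \<mu> n f y"
  unfolding vavg_def using vker_cong[of n x y] by simp

context vilenkin_haar
begin

lemma powi_mult_powi_minus: "real p powi n * real p powi (- n) = 1"
  using p_pos by (simp add: power_int_minus)

lemma measurable_vker_pair [measurable]:
  "(\<lambda>z. vker n (fst z) (snd z)) \<in> borel_measurable (\<mu> \<Otimes>\<^sub>M \<mu>)"
proof -
  have [measurable]: "(\<lambda>z. fst z j) \<in> measurable (\<mu> \<Otimes>\<^sub>M \<mu>) (count_space UNIV)"
    "(\<lambda>z. snd z j) \<in> measurable (\<mu> \<Otimes>\<^sub>M \<mu>) (count_space UNIV)" for j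
    by (rule measurable_compose[OF measurable_fst measurable_coordinate]
        measurable_compose[OF measurable_snd measurable_coordinate])+
  have "Measurable.pred (\<mu> \<Otimes>\<^sub>M \<mu>) (\<lambda>z. \<exists>c. snd z j = c \<and> fst z j = c)" for j
    by measurable
  then have [measurable]: "Measurable.pred (\<mu> \<Otimes>\<^sub>M \<mu>) (\<lambda>z. snd z j = fst z j)" for j
    by (simp add: eq_commute)
  show ?thesis
    unfolding vker_def by measurable
qed

lemma measurable_vker [measurable]: "vker n x \<in> borel_measurable \<mu>"
  unfolding vker_def[abs_def] by measurable

lemma integral_vker:
  assumes "x \<in> vilenkin p"
  shows "(\<integral>y. vker n x y \<partial>\<mu>) = complex_of_real (real p powi (- n))"
    and "(\<integral>y. cmod (vker n x y) \<partial>\<mu>) = real p powi (- n)"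
    and "integrable \<mu> (vker n x)"
    and "(\<integral>\<^sup>+y. ennreal (cmod (vker n x y)) \<partial>\<mu>) = ennreal (real p powi (- n))"
proof -
  have "integral\<^sup>L \<mu> (vker n x) = (\<integral>y. complex_of_real (indicator (vcoset p n x) y) \<partial>\<mu>)"
    by (rule Bochner_Integration.integral_cong) (auto simp: vker_eq_indicator indicator_def)
  then show "(\<integral>y. vker n x y \<partial>\<mu>) = complex_of_real (real p powi (- n))"
    unfolding integral_complex_of_real using measure_vcoset[OF assms, of n]
    by (simp add: Int_absorb2 vcoset_def)
  have "(\<integral>y. cmod (vker n x y) \<partial>\<mu>) = (\<integral>y. indicator (vcoset p n x) y \<partial>\<mu>)"
    by (rule Bochner_Integration.integral_cong) (auto simp: cmod_vker_eq_indicator)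
  then show "(\<integral>y. cmod (vker n x y) \<partial>\<mu>) = real p powi (- n)"
    using measure_vcoset[OF assms, of n] by (simp add: Int_absorb2 vcoset_def)
  have "integrable \<mu> (\<lambda>y. complex_of_real (indicator (vcoset p n x) y))"
    using emeasure_vcoset[OF assms, of n] by (intro integrable_of_real integrable_real_indicator) auto
  then show "integrable \<mu> (vker n x)"
    by (rule Bochner_Integration.integrable_cong[THEN iffD1, rotated -1])
       (auto simp: vker_eq_indicator indicator_def)
  have "(\<integral>\<^sup>+y. ennreal (cmod (vker n x y)) \<partial>\<mu>) = (\<integral>\<^sup>+y. indicator (vcoset p n x) y \<partial>\<mu>)"
    by (rule nn_integral_cong) (auto simp: cmod_vker_eq_indicator indicator_def)
  then show "(\<integral>\<^sup>+y. ennreal (cmod (vker n x y)) \<partial>\<mu>) = ennreal (real p powi (- n))"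
    using emeasure_vcoset[OF assms, of n] by simp
qed

lemma vker_L2: "x \<in> vilenkin p \<Longrightarrow> vker n x \<in> L2 \<mu>"
  using integrable_norm[OF integral_vker(3)] by (auto simp: L2_def)

lemma integrable_vker_mult:
  assumes "x \<in> vilenkin p" "f \<in> L2 \<mu>"
  shows "integrable \<mu> (\<lambda>y. vker n x y * f y)"
  using L2_integrable_mult[OF assms(2) vker_L2[OF assms(1), of n]] by (simp add: mult.commute)

lemma measurable_vavg [measurable]:
  assumes [measurable]: "f \<in> borel_measurable \<mu>"
  shows "vavg p \<mu> n f \<in> borel_measurable \<mu>"
proof -
  have "(\<lambda>x. \<integral>y. (case (x, y) of (x, y) \<Rightarrow> vker n x y * f y) \<partial>\<mu>) \<in> borel_measurable \<mu>"
    by (rule borel_measurable_lebesgue_integral) (simp add: split_beta')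
  then show ?thesis
    unfolding vavg_def[abs_def] by simp
qed

lemma vavg_diff:
  assumes "x \<in> vilenkin p" "f \<in> L2 \<mu>" "g \<in> L2 \<mu>"
  shows "vavg p \<mu> n (\<lambda>x. f x - g x) x = vavg p \<mu> n f x - vavg p \<mu> n g x"
  using integrable_vker_mult[OF assms(1,2)] integrable_vker_mult[OF assms(1,3)]
  by (simp add: vavg_def right_diff_distrib)

lemma vavg_add:
  assumes "x \<in> vilenkin p" "f \<in> L2 \<mu>" "g \<in> L2 \<mu>"
  shows "vavg p \<mu> n (\<lambda>x. f x + g x) x = vavg p \<mu> n f x + vavg p \<mu> n g x"
  using integrable_vker_mult[OF assms(1,2)] integrable_vker_mult[OF assms(1,3)]
  by (simp add: vavg_def distrib_left)

lemma vavg_scale: "vavg p \<mu> n (\<lambda>x. c * f x) x = c * vavg p \<mu> n f x"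
proof -
  have "(\<integral>y. vker n x y * (c * f y) \<partial>\<mu>) = c * (\<integral>y. vker n x y * f y \<partial>\<mu>)"
    by (subst Bochner_Integration.integral_mult_right_zero[symmetric]) (simp add: mult.left_commute)
  then show ?thesis
    by (simp add: vavg_def)
qed

lemma vavg_eq_self:
  assumes "x \<in> vilenkin p" "\<And>y. y \<in> vcoset p n x \<Longrightarrow> f y = f x"
  shows "vavg p \<mu> n f x = f x"
proof -
  have "(\<integral>y. vker n x y * f y \<partial>\<mu>) = (\<integral>y. vker n x y * f x \<partial>\<mu>)"
    by (rule Bochner_Integration.integral_cong) (auto simp: vker_def mem_vcoset intro!: assms(2))
  also have "\<dots> = complex_of_real (real p powi (- n)) * f x"
    using integral_vker(1)[OF assms(1)] by simp
  finally have "vavg p \<mu> n f x = complex_of_real (real p powi n * real p powi (- n)) * f x"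
    by (simp add: vavg_def)
  then show ?thesis
    by (simp add: powi_mult_powi_minus del: of_real_mult)
qed

lemma vavg_vavg: "x \<in> vilenkin p \<Longrightarrow> vavg p \<mu> n (vavg p \<mu> n f) x = vavg p \<mu> n f x"
  by (rule vavg_eq_self) (auto simp: mem_vcoset intro!: vavg_cong)

lemma cmod_vavg: "cmod (vavg p \<mu> n f x) = real p powi n * cmod (\<integral>y. vker n x y * f y \<partial>\<mu>)"
  unfolding vavg_def norm_mult norm_of_real by simp

text \<open>Jensen's inequality for the average, from Cauchy-Schwarz for \<open>vker * f\<close> and
  \<open>vker\<close>; this works because the kernel equals its own square.\<close>

lemma cmod_vavg_power2_le:
  assumes x: "x \<in> vilenkin p" and f: "f \<in> L2 \<mu>"
  shows "(cmod (vavg p \<mu> n f x))\<^sup>2 \<le> real p powi n * (\<integral>y. cmod (vker n x y) * (cmod (f y))\<^sup>2 \<partial>\<mu>)"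
proof -
  let ?I = "\<integral>y. cmod (vker n x y) * (cmod (f y))\<^sup>2 \<partial>\<mu>"
  have [measurable]: "f \<in> borel_measurable \<mu>"
    using f by (rule L2_measurable)
  have kf: "(\<lambda>y. vker n x y * f y) \<in> L2 \<mu>"
    by (rule L2_bounded[OF f]) (auto simp: vker_def)
  have "l2inner \<mu> (\<lambda>y. vker n x y * f y) (vker n x) = (\<integral>y. vker n x y * f y \<partial>\<mu>)"
    unfolding l2inner_def
    by (rule Bochner_Integration.integral_cong) (auto simp: vker_def)
  then have "cmod (\<integral>y. vker n x y * f y \<partial>\<mu>) \<le> l2norm \<mu> (\<lambda>y. vker n x y * f y) * l2norm \<mu> (vker n x)"
    using l2_Cauchy_Schwarz[OF kf vker_L2[OF x]] by metis
  then have "(cmod (\<integral>y. vker n x y * f y \<partial>\<mu>))\<^sup>2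
      \<le> (l2norm \<mu> (\<lambda>y. vker n x y * f y))\<^sup>2 * (l2norm \<mu> (vker n x))\<^sup>2"
    by (simp add: power_mono flip: power_mult_distrib)
  also have "\<dots> = ?I * real p powi (- n)"
    unfolding l2norm_power2 by (simp add: norm_mult power_mult_distrib integral_vker(2)[OF x])
  finally have "(cmod (vavg p \<mu> n f x))\<^sup>2 \<le> (real p powi n)\<^sup>2 * (?I * real p powi (- n))"
    unfolding cmod_vavg power_mult_distrib by (rule mult_left_mono) simp
  also have "\<dots> = (real p powi n * real p powi (- n)) * (real p powi n * ?I)"
    by (simp add: power2_eq_square mult_ac)
  finally show ?thesis
    by (simp add: powi_mult_powi_minus)
qed

text \<open>Integrating the previous bound over \<open>x\<close> and exchanging the integrals leaves
  the integral of the symmetric kernel in \<open>x\<close>, which cancels the factor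
  \<open>p^n\<close>.\<close>

lemma vavg_L2: "f \<in> L2 \<mu> \<Longrightarrow> vavg p \<mu> n f \<in> L2 \<mu>"
  and l2norm_vavg_le: "f \<in> L2 \<mu> \<Longrightarrow> l2norm \<mu> (vavg p \<mu> n f) \<le> l2norm \<mu> f"
proof -
  assume f: "f \<in> L2 \<mu>"
  have [measurable]: "f \<in> borel_measurable \<mu>"
    using f by (rule L2_measurable)
  have "(\<integral>\<^sup>+x. ennreal ((cmod (vavg p \<mu> n f x))\<^sup>2) \<partial>\<mu>)
      \<le> (\<integral>\<^sup>+x. (\<integral>\<^sup>+y. ennreal (real p powi n) * (ennreal (cmod (vker n x y)) * ennreal ((cmod (f y))\<^sup>2)) \<partial>\<mu>) \<partial>\<mu>)"
  proof (rule nn_integral_mono)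
    fix x assume "x \<in> space \<mu>"
    then have x: "x \<in> vilenkin p"
      by simp
    have int: "integrable \<mu> (\<lambda>y. cmod (vker n x y) * (cmod (f y))\<^sup>2)"
      by (rule Bochner_Integration.integrable_bound[OF L2_square_integrable[OF f]]) (auto simp: vker_def)
    have "ennreal ((cmod (vavg p \<mu> n f x))\<^sup>2)
        \<le> ennreal (real p powi n) * ennreal (\<integral>y. cmod (vker n x y) * (cmod (f y))\<^sup>2 \<partial>\<mu>)"
      using cmod_vavg_power2_le[OF x f, of n] by (simp add: ennreal_leI flip: ennreal_mult)
    also have "ennreal (\<integral>y. cmod (vker n x y) * (cmod (f y))\<^sup>2 \<partial>\<mu>)
        = (\<integral>\<^sup>+y. ennreal (cmod (vker n x y) * (cmod (f y))\<^sup>2) \<partial>\<mu>)"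
      by (rule nn_integral_eq_integral[symmetric, OF int]) auto
    also have "ennreal (real p powi n) * \<dots>
        = (\<integral>\<^sup>+y. ennreal (real p powi n) * (ennreal (cmod (vker n x y)) * ennreal ((cmod (f y))\<^sup>2)) \<partial>\<mu>)"
      by (simp add: nn_integral_cmult ennreal_mult)
    finally show "ennreal ((cmod (vavg p \<mu> n f x))\<^sup>2)
        \<le> (\<integral>\<^sup>+y. ennreal (real p powi n) * (ennreal (cmod (vker n x y)) * ennreal ((cmod (f y))\<^sup>2)) \<partial>\<mu>)" .
  qed
  also have "\<dots> = (\<integral>\<^sup>+y. (\<integral>\<^sup>+x. ennreal (real p powi n) * (ennreal (cmod (vker n x y)) * ennreal ((cmod (f y))\<^sup>2)) \<partial>\<mu>) \<partial>\<mu>)"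
    by (rule P.Fubini'[symmetric]) (simp add: split_beta')
  also have "\<dots> = (\<integral>\<^sup>+y. ennreal ((cmod (f y))\<^sup>2) \<partial>\<mu>)"
  proof (rule nn_integral_cong)
    fix y assume y: "y \<in> space \<mu>"
    have "(\<integral>\<^sup>+x. ennreal (real p powi n) * (ennreal (cmod (vker n x y)) * ennreal ((cmod (f y))\<^sup>2)) \<partial>\<mu>)
        = (\<integral>\<^sup>+x. (ennreal (real p powi n) * ennreal ((cmod (f y))\<^sup>2)) * ennreal (cmod (vker n y x)) \<partial>\<mu>)"
      by (simp add: vker_commute[of n _ y] mult_ac)
    also have "\<dots> = ennreal (real p powi n) * ennreal ((cmod (f y))\<^sup>2) * ennreal (real p powi (- n))"
      using y integral_vker(4)[of y n] by (simp add: nn_integral_cmult)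
    also have "\<dots> = ennreal (real p powi n * real p powi (- n)) * ennreal ((cmod (f y))\<^sup>2)"
      by (simp add: ennreal_mult mult_ac)
    also have "\<dots> = ennreal ((cmod (f y))\<^sup>2)"
      by (simp add: powi_mult_powi_minus)
    finally show "(\<integral>\<^sup>+x. ennreal (real p powi n) * (ennreal (cmod (vker n x y)) * ennreal ((cmod (f y))\<^sup>2)) \<partial>\<mu>)
        = ennreal ((cmod (f y))\<^sup>2)" .
  qed
  also have "\<dots> = ennreal ((l2norm \<mu> f)\<^sup>2)"
    by (rule L2_nn_integral[OF f])
  finally show "vavg p \<mu> n f \<in> L2 \<mu>" "l2norm \<mu> (vavg p \<mu> n f) \<le> l2norm \<mu> f"
    by (auto intro!: L2_I_nn_integral)
qed

lemma l2inner_vavg: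
  assumes f: "f \<in> L2 \<mu>" and g: "g \<in> L2 \<mu>"
  shows "l2inner \<mu> (vavg p \<mu> n f) g = l2inner \<mu> f (vavg p \<mu> n g)"
proof -
  have [measurable]: "f \<in> borel_measurable \<mu>" "g \<in> borel_measurable \<mu>"
    using f g by (auto simp: L2_def)
  \<comment> \<open>Prepares absolute integrability for Fubini: the inner integral of the norms is
    \<open>p^-n\<close> times the average of \<open>af\<close> times the modulus of
    \<open>g\<close>, a product of two L2 functions.\<close>
  define af where "af y = complex_of_real (cmod (f y))" for y
  have af: "af \<in> L2 \<mu>"
    by (rule L2_bounded[OF f]) (simp_all add: af_def[abs_def])
  have int: "integrable (\<mu> \<Otimes>\<^sub>M \<mu>) (\<lambda>(x, y). vker n x y * f y * cnj (g x))"
  proof (rule P.Fubini_integrable)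
    have "(\<integral>y. norm (vker n x y * f y * cnj (g x)) \<partial>\<mu>)
        = norm (complex_of_real (real p powi (- n)) * (vavg p \<mu> n af x * cnj (g x)))" for x
    proof -
      have eq: "vker n x y * af y = complex_of_real (cmod (vker n x y * f y))" for y
        by (simp add: vker_def af_def)
      have "cmod (vavg p \<mu> n af x) = real p powi n * (\<integral>y. cmod (vker n x y * f y) \<partial>\<mu>)"
        unfolding cmod_vavg eq integral_complex_of_real by simp
      moreover have "(\<integral>y. norm (vker n x y * f y * cnj (g x)) \<partial>\<mu>)
          = (\<integral>y. cmod (vker n x y * f y) \<partial>\<mu>) * cmod (g x)"
        by (simp add: norm_mult)
      ultimately show ?thesis
        using powi_mult_powi_minus[of n] unfolding norm_mult norm_of_real
          by (simp add: mult.commute)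
    qed
    then show "integrable \<mu> (\<lambda>x. \<integral>y. norm (case (x, y) of (x, y) \<Rightarrow> vker n x y * f y * cnj (g x)) \<partial>\<mu>)"
      using L2_integrable_mult[OF vavg_L2[OF af, of n] g]
      by (simp only: prod.case) (intro integrable_norm integrable_mult_right)
    show "AE x in \<mu>. integrable \<mu> (\<lambda>y. case (x, y) of (x, y) \<Rightarrow> vker n x y * f y * cnj (g x))"
      using integrable_vker_mult[OF _ f, of _ n] by (intro AE_I2) simp
  qed (simp add: split_beta')
  have "l2inner \<mu> (vavg p \<mu> n f) g
      = complex_of_real (real p powi n) * (\<integral>x. \<integral>y. vker n x y * f y * cnj (g x) \<partial>\<mu> \<partial>\<mu>)"
    unfolding l2inner_def vavg_def Bochner_Integration.integral_mult_left_zero mult.assoc[of "complex_of_real _"]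
    by (rule Bochner_Integration.integral_mult_right_zero)
  also have "(\<integral>x. \<integral>y. vker n x y * f y * cnj (g x) \<partial>\<mu> \<partial>\<mu>)
      = (\<integral>y. \<integral>x. vker n x y * f y * cnj (g x) \<partial>\<mu> \<partial>\<mu>)"
    by (rule P.Fubini_integral[symmetric, OF int])
  also have "\<dots> = (\<integral>y. f y * cnj (\<integral>x. vker n y x * g x \<partial>\<mu>) \<partial>\<mu>)"
  proof (rule Bochner_Integration.integral_cong[OF refl])
    fix y
    have "(\<integral>x. vker n x y * f y * cnj (g x) \<partial>\<mu>) = (\<integral>x. f y * cnj (vker n y x * g x) \<partial>\<mu>)"
      by (simp add: vker_commute[of n _ y] mult_ac)
    then show "(\<integral>x. vker n x y * f y * cnj (g x) \<partial>\<mu>) = f y * cnj (\<integral>x. vker n y x * g x \<partial>\<mu>)"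
      by (simp only: Bochner_Integration.integral_cnj[symmetric] Bochner_Integration.integral_mult_right_zero)
  qed
  also have "complex_of_real (real p powi n) * \<dots> = l2inner \<mu> f (vavg p \<mu> n g)"
    by (subst Bochner_Integration.integral_mult_right_zero[symmetric])
       (simp add: l2inner_def vavg_def mult_ac)
  finally show ?thesis .
qed

text \<open>Averaging is idempotent and self-adjoint, hence an orthogonal projection; Pythagoras
  follows from this form.\<close>

lemma l2inner_vavg_right:
  assumes "f \<in> L2 \<mu>"
  shows "l2inner \<mu> f (vavg p \<mu> n f) = complex_of_real ((l2norm \<mu> (vavg p \<mu> n f))\<^sup>2)"
proof -
  have "l2inner \<mu> f (vavg p \<mu> n f) = l2inner \<mu> f (vavg p \<mu> n (vavg p \<mu> n f))"
    unfolding l2inner_def by (rule Bochner_Integration.integral_cong) (simp_all add: vavg_vavg)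
  also have "\<dots> = l2inner \<mu> (vavg p \<mu> n f) (vavg p \<mu> n f)"
    by (rule l2inner_vavg[symmetric, OF assms vavg_L2[OF assms]])
  finally show ?thesis
    by (simp add: l2inner_self)
qed

lemma l2norm_diff_vavg_power2:
  assumes "f \<in> L2 \<mu>"
  shows "(l2norm \<mu> (\<lambda>x. f x - vavg p \<mu> n f x))\<^sup>2 = (l2norm \<mu> f)\<^sup>2 - (l2norm \<mu> (vavg p \<mu> n f))\<^sup>2"
  using l2norm_diff_power2[OF assms vavg_L2[OF assms, of n]]
  by (simp add: l2inner_vavg_right[OF assms] del: of_real_power)

text \<open>Auxiliary class for \<open>vavg_tendsto\<close>: it contains the indicators of cosets
  and is closed under linear combinations and L2 limits, so in the end it is all of L2.\<close>

definition avg_convergent :: "((int \<Rightarrow> nat) \<Rightarrow> complex) \<Rightarrow> bool" where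
  "avg_convergent f \<longleftrightarrow>
     f \<in> L2 \<mu> \<and> (\<lambda>n::nat. l2norm \<mu> (\<lambda>x. f x - vavg p \<mu> (int n) f x)) \<longlonglongrightarrow> 0"

lemma l2norm_eq_zeroI:
  assumes "\<And>x. x \<in> vilenkin p \<Longrightarrow> h x = 0"
  shows "l2norm \<mu> h = 0"
proof -
  have "(\<integral>x. (cmod (h x))\<^sup>2 \<partial>\<mu>) = (\<integral>x. 0 \<partial>\<mu>)"
    by (rule Bochner_Integration.integral_cong) (simp_all add: assms)
  then show ?thesis
    by (simp add: l2norm_def)
qed

text \<open>A three-epsilon argument: since averaging is a contraction, the average of
  \<open>g k - f\<close> is small uniformly in \<open>n\<close>.\<close>

lemma avg_convergentI_limit:
  assumes f: "f \<in> L2 \<mu>" and g: "\<And>k::nat. avg_convergent (g k)"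
    and lim: "(\<lambda>k. l2norm \<mu> (\<lambda>x. f x - g k x)) \<longlonglongrightarrow> 0"
  shows "avg_convergent f"
  unfolding avg_convergent_def
proof (intro conjI f LIMSEQ_I)
  fix e :: real assume e: "e > 0"
  obtain k where k: "l2norm \<mu> (\<lambda>x. f x - g k x) < e / 4"
    using LIMSEQ_D[OF lim, of "e / 4"] e by auto
  have gk: "g k \<in> L2 \<mu>" "(\<lambda>n::nat. l2norm \<mu> (\<lambda>x. g k x - vavg p \<mu> (int n) (g k) x)) \<longlonglongrightarrow> 0"
    using g by (auto simp: avg_convergent_def)
  obtain N where N: "\<And>n. n \<ge> N \<Longrightarrow> l2norm \<mu> (\<lambda>x. g k x - vavg p \<mu> (int n) (g k) x) < e / 4"
    using LIMSEQ_D[OF gk(2), of "e / 4"] e by auto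
  have "l2norm \<mu> (\<lambda>x. f x - vavg p \<mu> (int n) f x) < e" if "n \<ge> N" for n
  proof -
    have "l2norm \<mu> (\<lambda>x. f x - vavg p \<mu> (int n) f x)
        \<le> l2norm \<mu> (\<lambda>x. f x - vavg p \<mu> (int n) (g k) x)
          + l2norm \<mu> (\<lambda>x. vavg p \<mu> (int n) (g k) x - vavg p \<mu> (int n) f x)"
      by (intro l2norm_triangle_diff f vavg_L2 gk(1))
    also have "l2norm \<mu> (\<lambda>x. f x - vavg p \<mu> (int n) (g k) x)
        \<le> l2norm \<mu> (\<lambda>x. f x - g k x) + l2norm \<mu> (\<lambda>x. g k x - vavg p \<mu> (int n) (g k) x)"
      by (intro l2norm_triangle_diff f vavg_L2 gk(1))
    also have "l2norm \<mu> (\<lambda>x. vavg p \<mu> (int n) (g k) x - vavg p \<mu> (int n) f x)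
        = l2norm \<mu> (vavg p \<mu> (int n) (\<lambda>x. g k x - f x))"
      unfolding l2norm_def
      by (intro arg_cong[of _ _ sqrt] Bochner_Integration.integral_cong) (auto simp: vavg_diff gk(1) f)
    also have "\<dots> \<le> l2norm \<mu> (\<lambda>x. g k x - f x)"
      by (intro l2norm_vavg_le L2_diff gk(1) f)
    also have "\<dots> = l2norm \<mu> (\<lambda>x. f x - g k x)"
      by (rule l2norm_minus_commute)
    finally show ?thesis
      using k N[OF that] e by linarith
  qed
  then show "\<exists>no. \<forall>n\<ge>no. norm (l2norm \<mu> (\<lambda>x. f x - vavg p \<mu> (int n) f x) - 0) < e"
    by auto
qed

lemma avg_convergent_add:
  assumes "avg_convergent f" "avg_convergent g"
  shows "avg_convergent (\<lambda>x. f x + g x)"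
proof -
  have L2: "f \<in> L2 \<mu>" "g \<in> L2 \<mu>"
    using assms by (auto simp: avg_convergent_def)
  have "l2norm \<mu> (\<lambda>x. (f x + g x) - vavg p \<mu> n (\<lambda>x. f x + g x) x)
      = l2norm \<mu> (\<lambda>x. (f x - vavg p \<mu> n f x) + (g x - vavg p \<mu> n g x))" for n
    unfolding l2norm_def
    by (intro arg_cong[of _ _ sqrt] Bochner_Integration.integral_cong) (auto simp: vavg_add L2 algebra_simps)
  then have "l2norm \<mu> (\<lambda>x. (f x + g x) - vavg p \<mu> n (\<lambda>x. f x + g x) x)
      \<le> l2norm \<mu> (\<lambda>x. f x - vavg p \<mu> n f x) + l2norm \<mu> (\<lambda>x. g x - vavg p \<mu> n g x)" for n
    using l2norm_triangle[OF L2_diff[OF L2(1) vavg_L2] L2_diff[OF L2(2) vavg_L2]] L2 by simp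
  moreover have "(\<lambda>n::nat. l2norm \<mu> (\<lambda>x. f x - vavg p \<mu> (int n) f x)
      + l2norm \<mu> (\<lambda>x. g x - vavg p \<mu> (int n) g x)) \<longlonglongrightarrow> 0 + 0"
    using assms by (intro tendsto_add) (auto simp: avg_convergent_def)
  ultimately show ?thesis
    unfolding avg_convergent_def
    by (auto intro!: L2_add L2 Lim_null_comparison[where g = "\<lambda>n::nat. l2norm \<mu> (\<lambda>x. f x - vavg p \<mu> (int n) f x)
      + l2norm \<mu> (\<lambda>x. g x - vavg p \<mu> (int n) g x)"])
qed

lemma avg_convergent_scale:
  assumes "avg_convergent f"
  shows "avg_convergent (\<lambda>x. c * f x)"
proof -
  have "l2norm \<mu> (\<lambda>x. c * f x - vavg p \<mu> n (\<lambda>x. c * f x) x)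
      = cmod c * l2norm \<mu> (\<lambda>x. f x - vavg p \<mu> n f x)" for n
    by (simp add: vavg_scale l2norm_scale flip: right_diff_distrib)
  then show ?thesis
    using assms tendsto_mult_right_zero[of "\<lambda>n::nat. l2norm \<mu> (\<lambda>x. f x - vavg p \<mu> (int n) f x)"]
    by (auto simp: avg_convergent_def L2_scale)
qed

lemma avg_convergent_zero: "avg_convergent (\<lambda>x. 0)"
  by (simp add: avg_convergent_def L2_zero vavg_def l2norm_def)

lemma avg_convergent_empty: "avg_convergent (indicator {})"
  using avg_convergent_zero by (simp add: indicator_def[abs_def])

lemma avg_convergent_sum:
  "(\<And>t. t \<in> F \<Longrightarrow> avg_convergent (g t)) \<Longrightarrow> avg_convergent (\<lambda>x. \<Sum>t\<in>F. g t x)"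
  by (induction F rule: infinite_finite_induct) (auto intro: avg_convergent_add avg_convergent_zero)

lemma avg_convergent_cong:
  assumes "avg_convergent f" "\<And>x. x \<in> vilenkin p \<Longrightarrow> f x = g x"
  shows "avg_convergent g"
proof -
  have f: "f \<in> L2 \<mu>"
    using assms(1) by (simp add: avg_convergent_def)
  have "g \<in> L2 \<mu>"
    by (rule L2_bounded[OF f]) (use assms(2) measurable_cong[of \<mu> f g] L2_measurable[OF f] in auto)
  moreover have "l2norm \<mu> (\<lambda>x. g x - f x) = 0"
    by (rule l2norm_eq_zeroI) (simp add: assms(2))
  ultimately show ?thesis
    using avg_convergentI_limit[of g "\<lambda>k. f"] assms(1) by simp
qed

lemma indicator_L2:
  assumes "A \<in> sets \<mu>" "emeasure \<mu> A < \<infinity>"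
  shows "(indicator A :: _ \<Rightarrow> complex) \<in> L2 \<mu>"
proof -
  have "integrable \<mu> (indicator A :: _ \<Rightarrow> real)"
    using assms by (intro integrable_real_indicator) auto
  moreover have "(\<lambda>x. (cmod (indicator A x))\<^sup>2) = (indicator A :: (int \<Rightarrow> nat) \<Rightarrow> real)"
    by (auto simp: indicator_def)
  ultimately show ?thesis
    using assms by (auto simp: L2_def)
qed

lemma emeasure_ball_finite: "emeasure \<mu> (A \<inter> vcoset p n vzero) < \<infinity>"
proof -
  have "emeasure \<mu> (A \<inter> vcoset p n vzero) \<le> emeasure \<mu> (vcoset p n vzero)"
    by (rule emeasure_mono) auto
  also have "\<dots> < \<infinity>"
    by (simp add: emeasure_vcoset_vzero)
  finally show ?thesis .
qed

text \<open>As soon as \<open>n >= m\<close>, the indicator is constant on cosets of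
  \<open>U_n\<close> and averaging leaves it unchanged, so the error is eventually zero.\<close>

lemma avg_convergent_indicator_vcoset: "avg_convergent (indicator (vcoset p m x))"
proof (cases "vcoset p m x = {}")
  case True
  then show ?thesis
    using avg_convergent_empty by simp
next
  case False
  then obtain z where z: "z \<in> vilenkin p" "vcoset p m x = vcoset p m z"
    by (metis ex_in_conv mem_vcoset vcoset_eqI)
  have L2: "(indicator (vcoset p m x) :: _ \<Rightarrow> complex) \<in> L2 \<mu>"
    by (rule indicator_L2) (auto simp: z emeasure_vcoset)
  have "l2norm \<mu> (\<lambda>y. indicator (vcoset p m x) y - vavg p \<mu> (int n) (indicator (vcoset p m x)) y) = 0"
    if "n \<ge> nat m" for n
  proof -
    have "vavg p \<mu> (int n) (indicator (vcoset p m x)) y = indicator (vcoset p m x) y"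
      if "y \<in> vilenkin p" for y
      by (rule vavg_eq_self) (use that \<open>n \<ge> nat m\<close> in \<open>auto simp: indicator_def mem_vcoset\<close>)
    then show ?thesis
      by (intro l2norm_eq_zeroI) simp
  qed
  then show ?thesis
    using L2 by (auto simp: avg_convergent_def intro!: tendsto_eventually eventually_sequentiallyI)
qed

text \<open>Induction over the generated sigma-algebra. Intersecting with a ball keeps all
  indicators in L2, in particular in the complement step, and supplies the dominating function for
  countable unions.\<close>

lemma avg_convergent_indicator:
  assumes "A \<in> sets \<mu>"
  shows "avg_convergent (indicator (A \<inter> vcoset p n vzero))"
proof -
  let ?U = "vcoset p n vzero"
  have closed: "vcosets p \<subseteq> Pow (vilenkin p)"
    by (auto simp: vcosets_def mem_vcoset)
  have "A \<in> sigma_sets (vilenkin p) (vcosets p)"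
    using assms by (simp add: sets_mu)
  with Int_stable_vcosets closed show ?thesis
  proof (induction rule: sigma_sets_induct_disjoint)
    show "avg_convergent (indicator (A \<inter> ?U))" if "A \<in> vcosets p" for A
    proof -
      have "A \<inter> ?U \<in> vcosets p"
        using that Int_stable_vcosets vcoset_in_vcosets by (auto simp: Int_stable_def)
      then show ?thesis
        unfolding vcosets_def using avg_convergent_indicator_vcoset avg_convergent_empty by auto
    qed
    show "avg_convergent (indicator ({} \<inter> ?U))"
      using avg_convergent_empty by simp
    show "avg_convergent (indicator ((vilenkin p - A) \<inter> ?U))" if "avg_convergent (indicator (A \<inter> ?U))" for A
    proof (rule avg_convergent_cong)
      show "avg_convergent (\<lambda>x. indicator ?U x + (-1) * indicator (A \<inter> ?U) x)"
        by (intro avg_convergent_add avg_convergent_scale avg_convergent_indicator_vcoset that)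
    qed (auto simp: indicator_def)
    fix A :: "nat \<Rightarrow> _"
    assume A: "disjoint_family A" "range A \<subseteq> sigma_sets (vilenkin p) (vcosets p)"
      and IH: "\<And>i. avg_convergent (indicator (A i \<inter> ?U))"
    then have [measurable]: "\<And>i. A i \<in> sets \<mu>"
      by (auto simp: sets_mu)
    let ?s = "\<lambda>k x. (\<Sum>i<k. indicator (A i \<inter> ?U) x :: complex)"
    have s: "?s k x = indicator ((\<Union>i<k. A i) \<inter> ?U) x" for k x
    proof (induction k)
      case (Suc k)
      have "x \<notin> (\<Union>i<k. A i)" if "x \<in> A k"
      proof
        assume "x \<in> (\<Union>i<k. A i)"
        then obtain i where "i < k" "x \<in> A i"
          by blast
        then show False
          using disjoint_family_onD[OF A(1), of i k] that by auto
      qed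
      then have "indicator ((\<Union>i<k. A i) \<inter> ?U) x + indicator (A k \<inter> ?U) x
          = (indicator ((\<Union>i<Suc k. A i) \<inter> ?U) x :: complex)"
        by (auto simp: indicator_def lessThan_Suc)
      then show ?case
        by (simp only: sum.lessThan_Suc Suc)
    qed simp
    show "avg_convergent (indicator (\<Union> (range A) \<inter> ?U))"
    proof (rule avg_convergentI_limit)
      show "(indicator (\<Union> (range A) \<inter> ?U) :: _ \<Rightarrow> complex) \<in> L2 \<mu>"
        by (rule indicator_L2[OF _ emeasure_ball_finite]) measurable
      show "avg_convergent (?s k)" for k
        by (intro avg_convergent_sum IH)
      have "(\<lambda>k. \<integral>x. (cmod (indicator (\<Union> (range A) \<inter> ?U) x - ?s k x))\<^sup>2 \<partial>\<mu>) \<longlonglongrightarrow> (\<integral>x. 0 \<partial>\<mu>)"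
      proof (rule integral_dominated_convergence)
        show "integrable \<mu> (indicator ?U :: _ \<Rightarrow> real)"
          by (rule integrable_real_indicator) (auto simp: emeasure_vcoset_vzero)
        show "AE x in \<mu>. (\<lambda>k. (cmod (indicator (\<Union> (range A) \<inter> ?U) x - ?s k x))\<^sup>2) \<longlonglongrightarrow> 0"
        proof (rule AE_I2)
          fix x
          have "\<exists>N. \<forall>k\<ge>N. indicator (\<Union> (range A) \<inter> ?U) x = ?s k x"
            unfolding s
          proof (cases "\<exists>i. x \<in> A i")
            case True
            then obtain i where "x \<in> A i" ..
            then have "x \<in> (\<Union>i<k. A i)" if "k \<ge> Suc i" for k
              using that by (auto simp: Suc_le_eq)
            moreover have "x \<in> \<Union> (range A)"
              using \<open>x \<in> A i\<close> by blast
            ultimately have "\<forall>k\<ge>Suc i. indicator (\<Union> (range A) \<inter> ?U) x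
                = (indicator ((\<Union>i<k. A i) \<inter> ?U) x :: complex)"
              by (simp add: indicator_def)
            then show "\<exists>N. \<forall>k\<ge>N. indicator (\<Union> (range A) \<inter> ?U) x
                = (indicator ((\<Union>i<k. A i) \<inter> ?U) x :: complex)" ..
          qed (auto simp: indicator_def)
          then show "(\<lambda>k. (cmod (indicator (\<Union> (range A) \<inter> ?U) x - ?s k x))\<^sup>2) \<longlonglongrightarrow> 0"
            by (intro tendsto_eventually) (auto simp: eventually_sequentially)
        qed
        show "AE x in \<mu>. norm ((cmod (indicator (\<Union> (range A) \<inter> ?U) x - ?s k x))\<^sup>2) \<le> indicator ?U x" for k
          unfolding s by (auto simp: indicator_def)
      qed auto
      then have "(\<lambda>k. sqrt (\<integral>x. (cmod (indicator (\<Union> (range A) \<inter> ?U) x - ?s k x))\<^sup>2 \<partial>\<mu>)) \<longlonglongrightarrow> sqrt 0"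
        by (intro tendsto_real_sqrt) simp
      then show "(\<lambda>k. l2norm \<mu> (\<lambda>x. indicator (\<Union> (range A) \<inter> ?U) x - ?s k x)) \<longlonglongrightarrow> 0"
        by (simp add: l2norm_def)
    qed
  qed
qed

lemma eventually_mem_ball:
  assumes "x \<in> vilenkin p"
  shows "\<forall>\<^sub>F k in sequentially. x \<in> vcoset p (- int k) vzero"
proof -
  obtain N :: nat where "\<forall>j. j \<le> - int N \<longrightarrow> x j = 0"
    using vilenkin_support_bounded[OF assms] by blast
  then show ?thesis
    using assms by (intro eventually_sequentiallyI[of N]) (auto simp: mem_vcoset vzero_def)
qed

text \<open>The factor 2 is the one that approximation by simple functions provides; it yields the
  domination constant \<open>9 = (1 + 2)^2\<close>.\<close>

lemma l2norm_dominated_tendsto: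
  assumes f: "f \<in> L2 \<mu>" and s: "\<And>k. s k \<in> borel_measurable \<mu>"
    and bound: "\<And>k x. x \<in> vilenkin p \<Longrightarrow> cmod (s k x) \<le> 2 * cmod (f x)"
    and lim: "\<And>x. x \<in> vilenkin p \<Longrightarrow> (\<lambda>k. s k x) \<longlonglongrightarrow> f x"
  shows "(\<lambda>k. l2norm \<mu> (\<lambda>x. f x - s k x)) \<longlonglongrightarrow> 0"
proof -
  have [measurable]: "f \<in> borel_measurable \<mu>" "\<And>k. s k \<in> borel_measurable \<mu>"
    using f s by (auto simp: L2_def)
  have "(\<lambda>k. \<integral>x. (cmod (f x - s k x))\<^sup>2 \<partial>\<mu>) \<longlonglongrightarrow> (\<integral>x. 0 \<partial>\<mu>)"
  proof (rule integral_dominated_convergence)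
    show "integrable \<mu> (\<lambda>x. 9 * (cmod (f x))\<^sup>2)"
      using f by (simp add: L2_square_integrable)
    show "AE x in \<mu>. (\<lambda>k. (cmod (f x - s k x))\<^sup>2) \<longlonglongrightarrow> 0"
    proof (rule AE_I2)
      fix x assume "x \<in> space \<mu>"
      then have "(\<lambda>k. (cmod (f x - s k x))\<^sup>2) \<longlonglongrightarrow> (cmod (f x - f x))\<^sup>2"
        by (intro tendsto_intros lim) simp
      then show "(\<lambda>k. (cmod (f x - s k x))\<^sup>2) \<longlonglongrightarrow> 0"
        by simp
    qed
    show "AE x in \<mu>. norm ((cmod (f x - s k x))\<^sup>2) \<le> 9 * (cmod (f x))\<^sup>2" for k
    proof (rule AE_I2)
      fix x assume "x \<in> space \<mu>"
      then have "cmod (f x - s k x) \<le> 3 * cmod (f x)"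
        using norm_triangle_ineq4[of "f x" "s k x"] bound[of x k] by simp
      then have "(cmod (f x - s k x))\<^sup>2 \<le> (3 * cmod (f x))\<^sup>2"
        by (rule power_mono) simp
      then show "norm ((cmod (f x - s k x))\<^sup>2) \<le> 9 * (cmod (f x))\<^sup>2"
        by (simp add: power_mult_distrib)
    qed
  qed auto
  then have "(\<lambda>k. sqrt (\<integral>x. (cmod (f x - s k x))\<^sup>2 \<partial>\<mu>)) \<longlonglongrightarrow> sqrt 0"
    by (intro tendsto_real_sqrt) simp
  then show ?thesis
    by (simp add: l2norm_def)
qed

lemma vavg_tendsto:
  assumes f: "f \<in> L2 \<mu>"
  shows "(\<lambda>n::nat. l2norm \<mu> (\<lambda>x. f x - vavg p \<mu> (int n) f x)) \<longlonglongrightarrow> 0"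
proof -
  obtain s where s: "\<And>i. simple_function \<mu> (s i)" "\<And>x. x \<in> space \<mu> \<Longrightarrow> (\<lambda>i. s i x) \<longlonglongrightarrow> f x"
    "\<And>i x. x \<in> space \<mu> \<Longrightarrow> dist (s i x) 0 \<le> 2 * dist (f x) 0"
    using borel_measurable_implies_sequence_metric[OF L2_measurable[OF f], of 0] by blast
  \<comment> \<open>Truncation to a growing ball gives the level sets the form required by
    \<open>avg_convergent_indicator\<close>. Each point enters the ball eventually, so the pointwise
    limit is unchanged.\<close>
  define t where "t k x = indicator (vcoset p (- int k) vzero) x * s k x" for k x
  have [measurable]: "s k \<in> borel_measurable \<mu>" for k
    by (rule borel_measurable_simple_function[OF s(1)])
  have "avg_convergent (t k)" for k
  proof -
    let ?A = "\<lambda>v. s k -` {v} \<inter> space \<mu>"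
    have fin: "finite (s k ` space \<mu>)"
      using s(1) by (rule simple_functionD)
    have "avg_convergent (\<lambda>x. \<Sum>v\<in>s k ` space \<mu>. v * indicator (?A v \<inter> vcoset p (- int k) vzero) x)"
    proof (rule avg_convergent_sum)
      show "avg_convergent (\<lambda>x. v * indicator (?A v \<inter> vcoset p (- int k) vzero) x)" for v
        by (rule avg_convergent_scale[OF avg_convergent_indicator[OF simple_functionD(2)[OF s(1)]]])
    qed
    then show ?thesis
    proof (rule avg_convergent_cong)
      fix x assume x: "x \<in> vilenkin p"
      have "(\<Sum>v\<in>s k ` space \<mu>. v * indicator (?A v \<inter> vcoset p (- int k) vzero) x)
          = (\<Sum>v\<in>{s k x}. v * indicator (?A v \<inter> vcoset p (- int k) vzero) x)"
        by (rule sum.mono_neutral_right) (use x fin in \<open>auto simp: indicator_def\<close>)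
      also have "\<dots> = t k x"
        using x by (simp add: t_def indicator_def)
      finally show "(\<Sum>v\<in>s k ` space \<mu>. v * indicator (?A v \<inter> vcoset p (- int k) vzero) x) = t k x" .
    qed
  qed
  moreover have "(\<lambda>k. l2norm \<mu> (\<lambda>x. f x - t k x)) \<longlonglongrightarrow> 0"
  proof (rule l2norm_dominated_tendsto[OF f])
    show "t k \<in> borel_measurable \<mu>" for k
      unfolding t_def[abs_def] by measurable
    show "cmod (t k x) \<le> 2 * cmod (f x)" if "x \<in> vilenkin p" for k x
      using s(3)[of x k] that by (auto simp: t_def indicator_def)
    show "(\<lambda>k. t k x) \<longlonglongrightarrow> f x" if x: "x \<in> vilenkin p" for x
    proof (rule Lim_transform_eventually)
      show "(\<lambda>i. s i x) \<longlonglongrightarrow> f x"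
        using s(2) x by simp
      show "\<forall>\<^sub>F k in sequentially. s k x = t k x"
        using eventually_mem_ball[OF x] by eventually_elim (simp add: t_def)
    qed
  qed
  ultimately have "avg_convergent f"
    using avg_convergentI_limit[OF f] by blast
  then show ?thesis
    by (simp add: avg_convergent_def)
qed

end

subsection \<open>Characters and Plancherel's theorem\<close>

definition vroot :: "nat \<Rightarrow> nat \<Rightarrow> complex" where
  "vroot p k = exp (2 * of_real pi * \<i> * of_nat k / of_nat p)"

lemma vroot_add: "vroot p (a + b) = vroot p a * vroot p b"
  unfolding vroot_def exp_add[symmetric] by (simp add: add_divide_distrib distrib_left)

lemma vroot_zero [simp]: "vroot p 0 = 1"
  by (simp add: vroot_def)

lemma vroot_eq_iff: "p > 0 \<Longrightarrow> vroot p a = vroot p b \<longleftrightarrow> a mod p = b mod p"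
  unfolding vroot_def by (rule complex_root_unity_eq) simp

lemma cmod_vroot [simp]: "cmod (vroot p k) = 1"
  unfolding vroot_def by simp

lemma vroot_mult_mod:
  assumes "p > 0"
  shows "vroot p (a * ((b + c) mod p)) = vroot p (a * b) * vroot p (a * c)"
proof -
  have "vroot p (a * ((b + c) mod p)) = vroot p (a * b + a * c)"
    unfolding vroot_eq_iff[OF assms] by (simp add: mod_mult_right_eq distrib_left)
  then show ?thesis
    by (simp add: vroot_add)
qed

text \<open>Any finite set outside which the terms vanish may serve as \<open>S\<close>, which
  allows one common window for several characters.\<close>

lemma vchar_eq_prod:
  assumes "finite S" "\<And>j. j \<notin> S \<Longrightarrow> x j * \<omega> (1 - j) = 0"
  shows "vchar p x \<omega> = (\<Prod>j\<in>S. vroot p (x j * \<omega> (1 - j)))"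
proof -
  have "(\<Sum>\<^sub>\<infinity>j\<in>UNIV. of_nat (x j * \<omega> (1 - j)) :: complex) = (\<Sum>\<^sub>\<infinity>j\<in>S. of_nat (x j * \<omega> (1 - j)))"
    by (rule infsum_cong_neutral) (use assms(2) in auto)
  also have "\<dots> = (\<Sum>j\<in>S. of_nat (x j * \<omega> (1 - j)))"
    by (rule infsum_finite) (rule assms(1))
  finally show ?thesis
    unfolding vchar_def vroot_def exp_sum[OF assms(1), symmetric]
    by (simp add: sum_distrib_left)
qed

text \<open>Far to the left \<open>x j\<close> vanishes, far to the right
  \<open>\<omega> (1 - j)\<close> does. Every \<open>K\<close> beyond \<open>N\<close> is covered,
  so that windows can be enlarged to a common one or exhausted in a limit.\<close>

lemma vchar_window:
  assumes "x \<in> vilenkin p" "\<omega> \<in> vilenkin p"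
  shows "\<exists>N::nat. \<forall>K\<ge>N. \<forall>j. j \<notin> {- int K..int K} \<longrightarrow> x j * \<omega> (1 - j) = 0"
proof -
  obtain N M :: nat where N: "\<And>j. j \<le> - int N \<Longrightarrow> x j = 0" and M: "\<And>j. j \<le> - int M \<Longrightarrow> \<omega> j = 0"
    using vilenkin_support_bounded assms by metis
  have "x j * \<omega> (1 - j) = 0" if "K \<ge> N + M + 1" "j \<notin> {- int K..int K}" for K j
    using N[of j] M[of "1 - j"] that by (cases "j < 0") auto
  then show ?thesis
    by blast
qed

lemma vchar_vadd:
  assumes "p > 0" "x \<in> vilenkin p" "\<omega> \<in> vilenkin p" "\<eta> \<in> vilenkin p"
  shows "vchar p x (vadd p \<omega> \<eta>) = vchar p x \<omega> * vchar p x \<eta>"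
proof -
  obtain K where K: "\<And>j. j \<notin> {- int K..int K} \<Longrightarrow> x j * \<omega> (1 - j) = 0"
      "\<And>j. j \<notin> {- int K..int K} \<Longrightarrow> x j * \<eta> (1 - j) = 0"
    using vchar_window[OF assms(2,3)] vchar_window[OF assms(2,4)] by (metis nle_le)
  have "x j * vadd p \<omega> \<eta> (1 - j) = 0" if "j \<notin> {- int K..int K}" for j
    using K[OF that] by (auto simp: vadd_def)
  then show ?thesis
    using vchar_eq_prod[of "{- int K..int K}" x] K
    by (simp add: vadd_def vroot_mult_mod[OF assms(1)] prod.distrib)
qed

lemma cmod_vchar:
  assumes "x \<in> vilenkin p" "\<omega> \<in> vilenkin p"
  shows "cmod (vchar p x \<omega>) = 1"
proof -
  obtain K :: nat where "\<And>j. j \<notin> {- int K..int K} \<Longrightarrow> x j * \<omega> (1 - j) = 0"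
    using vchar_window[OF assms] by blast
  then show ?thesis
    using vchar_eq_prod[of "{- int K..int K}" x \<omega> p] by (simp add: prod_norm[symmetric])
qed

context vilenkin_haar
begin

text \<open>The products over finite windows are measurable and, at each point of the product,
  eventually equal to the character.\<close>

lemma measurable_vchar_pair [measurable]:
  "(\<lambda>z. vchar p (fst z) (snd z)) \<in> borel_measurable (\<mu> \<Otimes>\<^sub>M \<mu>)"
proof (rule borel_measurable_LIMSEQ_metric)
  have [measurable]: "(\<lambda>z. fst z j) \<in> measurable (\<mu> \<Otimes>\<^sub>M \<mu>) (count_space UNIV)"
    "(\<lambda>z. snd z j) \<in> measurable (\<mu> \<Otimes>\<^sub>M \<mu>) (count_space UNIV)" for j
    by (rule measurable_compose[OF measurable_fst measurable_coordinate]
        measurable_compose[OF measurable_snd measurable_coordinate])+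
  show "(\<lambda>z. \<Prod>j\<in>{- int K..int K}. vroot p (fst z j * snd z (1 - j))) \<in> borel_measurable (\<mu> \<Otimes>\<^sub>M \<mu>)" for K
    by measurable
  fix z assume "z \<in> space (\<mu> \<Otimes>\<^sub>M \<mu>)"
  then have "fst z \<in> vilenkin p" "snd z \<in> vilenkin p"
    by (auto simp: space_pair_measure)
  then obtain N :: nat where
    "\<And>K j. K \<ge> N \<Longrightarrow> j \<notin> {- int K..int K} \<Longrightarrow> fst z j * snd z (1 - j) = 0"
    using vchar_window by blast
  then have "(\<Prod>j\<in>{- int K..int K}. vroot p (fst z j * snd z (1 - j))) = vchar p (fst z) (snd z)"
    if "K \<ge> N" for K
    using that by (intro vchar_eq_prod[symmetric]) auto
  then show "(\<lambda>K. \<Prod>j\<in>{- int K..int K}. vroot p (fst z j * snd z (1 - j))) \<longlonglongrightarrow> vchar p (fst z) (snd z)"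
    by (intro tendsto_eventually eventually_sequentiallyI)
qed

lemma measurable_vchar [measurable]:
  assumes "x \<in> vilenkin p"
  shows "vchar p x \<in> borel_measurable \<mu>" "(\<lambda>y. vchar p y x) \<in> borel_measurable \<mu>"
  using measurable_compose[OF measurable_Pair1' measurable_vchar_pair, of x]
    measurable_compose[OF measurable_Pair2' measurable_vchar_pair, of x] assms by simp_all

lemma distr_translate:
  assumes e: "e \<in> vilenkin p"
  shows "vadd p e \<in> measurable \<mu> \<mu>" "distr \<mu> \<mu> (vadd p e) = \<mu>"
proof -
  have pre: "vadd p e -` vcoset p n y \<inter> vilenkin p = vcoset p n (vdiff p y e)"
    if "y \<in> vilenkin p" for n y
    using vadd_mem_vcoset_iff[OF _ e that, of _ n] by (auto simp: mem_vcoset)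
  show meas: "vadd p e \<in> measurable \<mu> \<mu>"
    by (rule measurable_vcosetI) (auto simp: pre vadd_closed[OF e])
  have "distr \<mu> \<mu> (vadd p e) = density \<mu> (\<lambda>_. ennreal 1)"
    by (rule distr_eq_density_const[OF meas]) (auto simp: pre emeasure_vcoset vdiff_closed[OF _ e])
  also have "\<dots> = \<mu>"
    by (simp add: density_1)
  finally show "distr \<mu> \<mu> (vadd p e) = \<mu>" .
qed

text \<open>Since \<open>x j\<close> is paired with \<open>\<omega> (1 - j)\<close>, frequencies in
  \<open>U_{-n}\<close> see only the coordinates up to \<open>n\<close>. If \<open>x\<close> and
  \<open>y\<close> agree there, the integrand is the indicator of that ball, of measure
  \<open>p^n\<close>; otherwise a translation within the ball multiplies the integral by a constant
  different from 1.\<close>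

lemma vchar_orthogonality:
  assumes x: "x \<in> vilenkin p" and y: "y \<in> vilenkin p"
  shows "(\<integral>\<omega>. vker (- n) vzero \<omega> * (vchar p x \<omega> * cnj (vchar p y \<omega>)) \<partial>\<mu>)
      = complex_of_real (real p powi n) * vker n x y"
proof (cases "\<forall>j\<le>n. y j = x j")
  case True
  have "(\<integral>\<omega>. vker (- n) vzero \<omega> * (vchar p x \<omega> * cnj (vchar p y \<omega>)) \<partial>\<mu>) = (\<integral>\<omega>. vker (- n) vzero \<omega> \<partial>\<mu>)"
  proof (rule Bochner_Integration.integral_cong[OF refl])
    fix \<omega> assume "\<omega> \<in> space \<mu>"
    then have \<omega>: "\<omega> \<in> vilenkin p"
      by simp
    show "vker (- n) vzero \<omega> * (vchar p x \<omega> * cnj (vchar p y \<omega>)) = vker (- n) vzero \<omega>"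
    proof (cases "\<forall>j\<le>- n. \<omega> j = 0")
      case 0: True
      have "x j * \<omega> (1 - j) = y j * \<omega> (1 - j)" for j
        using True 0 by (cases "j \<le> n") auto
      then have "vchar p x \<omega> = vchar p y \<omega>"
        by (simp only: vchar_def)
      then show ?thesis
        using cmod_vchar[OF y \<omega>] by (simp add: complex_norm_square[symmetric])
    qed (auto simp: vker_def vzero_def)
  qed
  also have "\<dots> = complex_of_real (real p powi n) * vker n x y"
    using True integral_vker(1)[OF vzero_closed, of "- n"] by (simp add: vker_def)
  finally show ?thesis .
next
  case False
  then obtain k where k: "k \<le> n" "y k \<noteq> x k"
    by auto
  \<comment> \<open>The digit at index \<open>1 - k\<close> pairs with coordinate \<open>k\<close>,
    where \<open>x\<close> and \<open>y\<close> differ; \<open>k <= n\<close> puts it above index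
    \<open>-n\<close>, so translation by \<open>e\<close> preserves the ball.\<close>
  define e where "e = (vzero :: int \<Rightarrow> nat)(1 - k := 1)"
  define g where "g \<omega> = vker (- n) vzero \<omega> * (vchar p x \<omega> * cnj (vchar p y \<omega>))" for \<omega>
  define c where "c = vchar p x e * cnj (vchar p y e)"
  have e: "e \<in> vilenkin p"
    by (rule vilenkinI[of _ _ "- k"]) (use p2 in \<open>auto simp: e_def vzero_def\<close>)
  have char_e: "vchar p z e = vroot p (z k)" for z
    using vchar_eq_prod[of "{k}" z e p] by (auto simp: e_def vzero_def)
  have "c \<noteq> 1"
  proof
    assume "c = 1"
    then have 1: "vroot p (x k) * cnj (vroot p (y k)) = 1"
      by (simp add: c_def char_e)
    have 2: "cnj (vroot p (y k)) * vroot p (y k) = 1"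
      by (metis cmod_vroot complex_norm_square mult.commute of_real_1 power_one)
    have "vroot p (x k) = (vroot p (x k) * cnj (vroot p (y k))) * vroot p (y k)"
      by (simp only: mult.assoc 2 mult_1_right)
    then have "vroot p (x k) = vroot p (y k)"
      by (simp only: 1 mult_1)
    then show False
      using k vilenkin_less[OF x, of k] vilenkin_less[OF y, of k] by (simp add: vroot_eq_iff)
  qed
  have g_shift: "g (vadd p e \<omega>) = c * g \<omega>" if \<omega>: "\<omega> \<in> vilenkin p" for \<omega>
  proof -
    have "vadd p e \<omega> j = \<omega> j" if "j \<le> - n" for j
      using that k vilenkin_less[OF \<omega>, of j] by (simp add: e_def vadd_def vzero_def)
    then have "vker (- n) vzero (vadd p e \<omega>) = vker (- n) vzero \<omega>"
      by (auto simp: vker_def)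
    then show ?thesis
      by (simp add: g_def c_def vchar_vadd[OF p_pos x e \<omega>] vchar_vadd[OF p_pos y e \<omega>])
  qed
  have [measurable]: "g \<in> borel_measurable \<mu>"
    using x y unfolding g_def[abs_def] by measurable
  have "integral\<^sup>L \<mu> g = integral\<^sup>L (distr \<mu> \<mu> (vadd p e)) g"
    by (simp add: distr_translate(2)[OF e])
  also have "\<dots> = (\<integral>\<omega>. g (vadd p e \<omega>) \<partial>\<mu>)"
    by (rule integral_distr[OF distr_translate(1)[OF e]]) measurable
  also have "\<dots> = (\<integral>\<omega>. c * g \<omega> \<partial>\<mu>)"
    by (rule Bochner_Integration.integral_cong) (auto simp: g_shift)
  also have "\<dots> = c * integral\<^sup>L \<mu> g"
    by (rule Bochner_Integration.integral_mult_right_zero)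
  finally have "integral\<^sup>L \<mu> g = 0"
    using \<open>c \<noteq> 1\<close> by simp
  moreover have "vker n x y = 0"
    using False by (auto simp: vker_def)
  ultimately show ?thesis
    by (simp add: g_def[abs_def])
qed

text \<open>Common justification of the Fubini exchanges below, in which characters enter only as
  bounded factors.\<close>

lemma integrable_pair_bounded:
  fixes a b :: "(int \<Rightarrow> nat) \<Rightarrow> complex" and \<phi> :: "(int \<Rightarrow> nat) \<Rightarrow> (int \<Rightarrow> nat) \<Rightarrow> complex"
  assumes a: "integrable \<mu> a" and b: "integrable \<mu> b"
    and [measurable]: "case_prod \<phi> \<in> borel_measurable (\<mu> \<Otimes>\<^sub>M \<mu>)"
    and \<phi>: "\<And>x y. x \<in> vilenkin p \<Longrightarrow> y \<in> vilenkin p \<Longrightarrow> cmod (\<phi> x y) \<le> 1"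
  shows "integrable (\<mu> \<Otimes>\<^sub>M \<mu>) (\<lambda>(x, y). a x * b y * \<phi> x y)"
proof -
  have [measurable]: "a \<in> borel_measurable \<mu>" "b \<in> borel_measurable \<mu>"
    using a b by auto
  have [measurable]: "(\<lambda>z. \<phi> (fst z) (snd z)) \<in> borel_measurable (\<mu> \<Otimes>\<^sub>M \<mu>)"
    using assms(3) by (simp add: split_beta')
  have "integrable (\<mu> \<Otimes>\<^sub>M \<mu>) (\<lambda>(x, y). a x * b y)"
  proof (rule P.Fubini_integrable)
    show "integrable \<mu> (\<lambda>x. \<integral>y. norm (case (x, y) of (x, y) \<Rightarrow> a x * b y) \<partial>\<mu>)"
      using a by (simp add: norm_mult)
    show "AE x in \<mu>. integrable \<mu> (\<lambda>y. case (x, y) of (x, y) \<Rightarrow> a x * b y)"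
      using b by simp
  qed (simp add: split_beta')
  then show ?thesis
  proof (rule Bochner_Integration.integrable_bound)
    show "AE z in \<mu> \<Otimes>\<^sub>M \<mu>. norm (case z of (x, y) \<Rightarrow> a x * b y * \<phi> x y) \<le> norm (case z of (x, y) \<Rightarrow> a x * b y)"
    proof (rule AE_I2)
      fix z assume "z \<in> space (\<mu> \<Otimes>\<^sub>M \<mu>)"
      then have "cmod (\<phi> (fst z) (snd z)) \<le> 1"
        by (intro \<phi>) (auto simp: space_pair_measure)
      then show "norm (case z of (x, y) \<Rightarrow> a x * b y * \<phi> x y) \<le> norm (case z of (x, y) \<Rightarrow> a x * b y)"
        using mult_left_mono[of "cmod (\<phi> (fst z) (snd z))" 1 "cmod (a (fst z) * b (snd z))"]
        by (simp add: split_beta' norm_mult)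
    qed
  qed (simp add: split_beta')
qed

section \<open>The Fourier transform on integrable functions and Plancherel's identity\<close>

lemma measurable_vfourier [measurable]:
  assumes [measurable]: "u \<in> borel_measurable \<mu>"
  shows "vfourier p \<mu> u \<in> borel_measurable \<mu>"
proof -
  have [measurable]: "(\<lambda>z. vchar p (snd z) (fst z)) \<in> borel_measurable (\<mu> \<Otimes>\<^sub>M \<mu>)"
    using measurable_compose[OF measurable_pair_swap' measurable_vchar_pair] by (simp add: split_beta')
  have "(\<lambda>\<omega>. \<integral>x. (case (\<omega>, x) of (\<omega>, x) \<Rightarrow> u x * cnj (vchar p x \<omega>)) \<partial>\<mu>) \<in> borel_measurable \<mu>"
    by (rule borel_measurable_lebesgue_integral) (simp add: split_beta')
  then show ?thesis
    unfolding vfourier_def[abs_def] by simp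
qed

lemma cmod_vfourier_le:
  assumes "\<omega> \<in> vilenkin p"
  shows "cmod (vfourier p \<mu> u \<omega>) \<le> (\<integral>x. cmod (u x) \<partial>\<mu>)"
proof -
  have "cmod (vfourier p \<mu> u \<omega>) \<le> (\<integral>x. cmod (u x * cnj (vchar p x \<omega>)) \<partial>\<mu>)"
    unfolding vfourier_def by (rule integral_norm_bound)
  also have "\<dots> = (\<integral>x. cmod (u x) \<partial>\<mu>)"
    by (rule Bochner_Integration.integral_cong) (auto simp: norm_mult cmod_vchar assms)
  finally show ?thesis .
qed

text \<open>Fourier inversion truncated to a ball of frequencies: by orthogonality its Dirichlet
  kernel is \<open>p^n\<close> times \<open>vker n\<close>, which is exactly the averaging
  kernel.\<close>

lemma integral_vker_vfourier_vchar:
  assumes u: "integrable \<mu> u" and x: "x \<in> vilenkin p"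
  shows "(\<integral>\<omega>. vker (- n) vzero \<omega> * (vchar p x \<omega> * vfourier p \<mu> u \<omega>) \<partial>\<mu>) = vavg p \<mu> n u x"
proof -
  have [measurable]: "u \<in> borel_measurable \<mu>"
    using u by auto
  have [measurable]: "(\<lambda>z. vchar p (snd z) (fst z)) \<in> borel_measurable (\<mu> \<Otimes>\<^sub>M \<mu>)"
    using measurable_compose[OF measurable_pair_swap' measurable_vchar_pair] by (simp add: split_beta')
  have [measurable]: "(\<lambda>z. vchar p x (fst z)) \<in> borel_measurable (\<mu> \<Otimes>\<^sub>M \<mu>)"
    using measurable_compose[OF measurable_fst measurable_vchar(1)[OF x]] .
  have int: "integrable (\<mu> \<Otimes>\<^sub>M \<mu>)
      (\<lambda>(\<omega>, y). vker (- n) vzero \<omega> * u y * (vchar p x \<omega> * cnj (vchar p y \<omega>)))"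
    by (rule integrable_pair_bounded[OF integral_vker(3)[OF vzero_closed] u])
       (auto simp: split_beta' norm_mult cmod_vchar x)
  have "(\<integral>\<omega>. vker (- n) vzero \<omega> * (vchar p x \<omega> * vfourier p \<mu> u \<omega>) \<partial>\<mu>)
      = (\<integral>\<omega>. \<integral>y. vker (- n) vzero \<omega> * u y * (vchar p x \<omega> * cnj (vchar p y \<omega>)) \<partial>\<mu> \<partial>\<mu>)"
    unfolding vfourier_def Bochner_Integration.integral_mult_right_zero[symmetric] by (simp add: mult_ac)
  also have "\<dots> = (\<integral>y. \<integral>\<omega>. vker (- n) vzero \<omega> * u y * (vchar p x \<omega> * cnj (vchar p y \<omega>)) \<partial>\<mu> \<partial>\<mu>)"
    by (rule P.Fubini_integral[symmetric, OF int])
  also have "\<dots> = (\<integral>y. complex_of_real (real p powi n) * (vker n x y * u y) \<partial>\<mu>)"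
  proof (rule Bochner_Integration.integral_cong[OF refl])
    fix y assume "y \<in> space \<mu>"
    then have "(\<integral>\<omega>. u y * (vker (- n) vzero \<omega> * (vchar p x \<omega> * cnj (vchar p y \<omega>))) \<partial>\<mu>)
        = u y * (complex_of_real (real p powi n) * vker n x y)"
      unfolding Bochner_Integration.integral_mult_right_zero by (simp add: vchar_orthogonality x)
    then show "(\<integral>\<omega>. vker (- n) vzero \<omega> * u y * (vchar p x \<omega> * cnj (vchar p y \<omega>)) \<partial>\<mu>)
        = complex_of_real (real p powi n) * (vker n x y * u y)"
      by (simp add: mult_ac)
  qed
  also have "\<dots> = vavg p \<mu> n u x"
    unfolding vavg_def by (rule Bochner_Integration.integral_mult_right_zero)
  finally show ?thesis .
qed

text \<open>One of the two factors \<open>vfourier\<close> is expanded; after Fubini the other one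
  forms, with the cut-off, the conjugate of the truncated inversion. What remains is the inner
  product of \<open>u\<close> with its average, and averaging is a projection.\<close>

lemma integral_low_frequencies:
  assumes u: "integrable \<mu> u" "u \<in> L2 \<mu>"
  shows "(\<integral>\<omega>. cmod (vker (- n) vzero \<omega>) * (cmod (vfourier p \<mu> u \<omega>))\<^sup>2 \<partial>\<mu>) = (l2norm \<mu> (vavg p \<mu> n u))\<^sup>2"
proof -
  let ?F = "vfourier p \<mu> u"
  let ?k = "vker (- n) vzero"
  have [measurable]: "u \<in> borel_measurable \<mu>"
    using u by auto
  have [measurable]: "(\<lambda>z. vchar p (snd z) (fst z)) \<in> borel_measurable (\<mu> \<Otimes>\<^sub>M \<mu>)"
    using measurable_compose[OF measurable_pair_swap' measurable_vchar_pair] by (simp add: split_beta')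
  \<comment> \<open>The transform is bounded by the L1 norm of \<open>u\<close> and the ball has
    finite measure, so square integrability of the transform is not presupposed here.\<close>
  have "integrable \<mu> (\<lambda>\<omega>. ?k \<omega> * complex_of_real (\<integral>x. cmod (u x) \<partial>\<mu>))"
    using integral_vker(3)[OF vzero_closed] by (rule integrable_mult_left)
  then have kF: "integrable \<mu> (\<lambda>\<omega>. ?k \<omega> * cnj (?F \<omega>))"
    by (rule Bochner_Integration.integrable_bound)
       (auto simp: norm_mult intro!: mult_left_mono cmod_vfourier_le)
  have int: "integrable (\<mu> \<Otimes>\<^sub>M \<mu>) (\<lambda>(\<omega>, x). (?k \<omega> * cnj (?F \<omega>)) * u x * cnj (vchar p x \<omega>))"
    by (rule integrable_pair_bounded[OF kF u(1)]) (auto simp: split_beta' cmod_vchar)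
  have eq: "complex_of_real (cmod (?k \<omega>) * (cmod (?F \<omega>))\<^sup>2) = (?k \<omega> * cnj (?F \<omega>)) * ?F \<omega>" for \<omega>
    by (auto simp: vker_def complex_norm_square[symmetric] mult.commute)
  have "complex_of_real (\<integral>\<omega>. cmod (?k \<omega>) * (cmod (?F \<omega>))\<^sup>2 \<partial>\<mu>) = (\<integral>\<omega>. (?k \<omega> * cnj (?F \<omega>)) * ?F \<omega> \<partial>\<mu>)"
    unfolding integral_complex_of_real[symmetric] eq ..
  also have "\<dots> = (\<integral>\<omega>. \<integral>x. (?k \<omega> * cnj (?F \<omega>)) * u x * cnj (vchar p x \<omega>) \<partial>\<mu> \<partial>\<mu>)"
    unfolding vfourier_def mult.assoc[of _ "u _"]
    unfolding Bochner_Integration.integral_mult_right_zero ..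
  also have "\<dots> = (\<integral>x. \<integral>\<omega>. (?k \<omega> * cnj (?F \<omega>)) * u x * cnj (vchar p x \<omega>) \<partial>\<mu> \<partial>\<mu>)"
    by (rule P.Fubini_integral[symmetric, OF int])
  also have "\<dots> = (\<integral>x. u x * cnj (vavg p \<mu> n u x) \<partial>\<mu>)"
  proof (rule Bochner_Integration.integral_cong[OF refl])
    fix x assume "x \<in> space \<mu>"
    then have x: "x \<in> vilenkin p"
      by simp
    have "(\<integral>\<omega>. (?k \<omega> * cnj (?F \<omega>)) * u x * cnj (vchar p x \<omega>) \<partial>\<mu>)
        = (\<integral>\<omega>. u x * cnj (?k \<omega> * (vchar p x \<omega> * ?F \<omega>)) \<partial>\<mu>)"
      by (simp add: mult_ac)
    also have "\<dots> = u x * cnj (\<integral>\<omega>. ?k \<omega> * (vchar p x \<omega> * ?F \<omega>) \<partial>\<mu>)"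
      by (simp only: Bochner_Integration.integral_cnj Bochner_Integration.integral_mult_right_zero)
    finally show "(\<integral>\<omega>. (?k \<omega> * cnj (?F \<omega>)) * u x * cnj (vchar p x \<omega>) \<partial>\<mu>) = u x * cnj (vavg p \<mu> n u x)"
      by (simp add: integral_vker_vfourier_vchar[OF u(1) x])
  qed
  also have "\<dots> = complex_of_real ((l2norm \<mu> (vavg p \<mu> n u))\<^sup>2)"
    using l2inner_vavg_right[OF u(2), of n] by (simp only: l2inner_def)
  finally show ?thesis
    by (simp only: of_real_eq_iff)
qed

lemma tendsto_vker_ball:
  assumes "x \<in> vilenkin p"
  shows "(\<lambda>n::nat. cmod (vker (- int n) vzero x)) \<longlonglongrightarrow> 1"
  using eventually_mem_ball[OF assms]
  by (intro tendsto_eventually) (auto elim!: eventually_mono simp: vker_def mem_vcoset)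

text \<open>Averages are contractions, so the energies in growing frequency balls stay below the
  squared norm of \<open>u\<close>; Fatou lets the balls exhaust the group.\<close>

lemma vfourier_L2_member:
  assumes u: "integrable \<mu> u" "u \<in> L2 \<mu>"
  shows "vfourier p \<mu> u \<in> L2 \<mu>"
proof -
  let ?F = "vfourier p \<mu> u"
  let ?k = "\<lambda>n::nat. vker (- int n) vzero"
  have [measurable]: "u \<in> borel_measurable \<mu>"
    using u by auto
  have bound: "(\<integral>\<^sup>+\<omega>. ennreal (cmod (?k n \<omega>) * (cmod (?F \<omega>))\<^sup>2) \<partial>\<mu>) \<le> ennreal ((l2norm \<mu> u)\<^sup>2)" for n
  proof -
    have "integrable \<mu> (\<lambda>\<omega>. cmod (?k n \<omega>) * (\<integral>x. cmod (u x) \<partial>\<mu>)\<^sup>2)"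
      using integrable_norm[OF integral_vker(3)[OF vzero_closed]] by (rule integrable_mult_left)
    then have "integrable \<mu> (\<lambda>\<omega>. cmod (?k n \<omega>) * (cmod (?F \<omega>))\<^sup>2)"
      by (rule Bochner_Integration.integrable_bound)
         (auto intro!: mult_left_mono power_mono cmod_vfourier_le)
    then have "(\<integral>\<^sup>+\<omega>. ennreal (cmod (?k n \<omega>) * (cmod (?F \<omega>))\<^sup>2) \<partial>\<mu>) = ennreal ((l2norm \<mu> (vavg p \<mu> (int n) u))\<^sup>2)"
      unfolding integral_low_frequencies[OF u, symmetric] by (rule nn_integral_eq_integral) simp
    also have "\<dots> \<le> ennreal ((l2norm \<mu> u)\<^sup>2)"
      by (intro ennreal_leI power_mono l2norm_vavg_le u) simp
    finally show ?thesis .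
  qed
  have "(\<integral>\<^sup>+\<omega>. ennreal ((cmod (?F \<omega>))\<^sup>2) \<partial>\<mu>)
      = (\<integral>\<^sup>+\<omega>. liminf (\<lambda>n. ennreal (cmod (?k n \<omega>) * (cmod (?F \<omega>))\<^sup>2)) \<partial>\<mu>)"
  proof (rule nn_integral_cong)
    fix \<omega> assume "\<omega> \<in> space \<mu>"
    then have "(\<lambda>n. ennreal (cmod (?k n \<omega>) * (cmod (?F \<omega>))\<^sup>2)) \<longlonglongrightarrow> ennreal (1 * (cmod (?F \<omega>))\<^sup>2)"
      by (intro tendsto_ennrealI tendsto_mult tendsto_vker_ball tendsto_const) simp
    from lim_imp_Liminf[OF sequentially_bot this] show "ennreal ((cmod (?F \<omega>))\<^sup>2) = liminf (\<lambda>n. ennreal (cmod (?k n \<omega>) * (cmod (?F \<omega>))\<^sup>2))"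
      by (simp del: ennreal_mult')
  qed
  also have "\<dots> \<le> liminf (\<lambda>n. \<integral>\<^sup>+\<omega>. ennreal (cmod (?k n \<omega>) * (cmod (?F \<omega>))\<^sup>2) \<partial>\<mu>)"
    by (rule nn_integral_liminf) simp
  also have "\<dots> \<le> liminf (\<lambda>n::nat. ennreal ((l2norm \<mu> u)\<^sup>2))"
    by (rule Liminf_mono) (simp add: bound)
  also have "\<dots> = ennreal ((l2norm \<mu> u)\<^sup>2)"
    by (simp add: Liminf_const)
  finally show ?thesis
    by (intro L2_I_nn_integral(1)) auto
qed

text \<open>Limit of \<open>integral_low_frequencies\<close> along growing balls: dominated
  convergence on the frequency side, \<open>vavg_tendsto\<close> on the other.\<close>

lemma l2norm_vfourier:
  assumes u: "integrable \<mu> u" "u \<in> L2 \<mu>"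
  shows "l2norm \<mu> (vfourier p \<mu> u) = l2norm \<mu> u"
proof -
  let ?F = "vfourier p \<mu> u"
  have F: "?F \<in> L2 \<mu>"
    by (rule vfourier_L2_member[OF u])
  have [measurable]: "?F \<in> borel_measurable \<mu>"
    by (rule L2_measurable[OF F])
  have "(\<lambda>n::nat. \<integral>\<omega>. cmod (vker (- int n) vzero \<omega>) * (cmod (?F \<omega>))\<^sup>2 \<partial>\<mu>) \<longlonglongrightarrow> (\<integral>\<omega>. (cmod (?F \<omega>))\<^sup>2 \<partial>\<mu>)"
  proof (rule integral_dominated_convergence)
    show "AE \<omega> in \<mu>. (\<lambda>n::nat. cmod (vker (- int n) vzero \<omega>) * (cmod (?F \<omega>))\<^sup>2) \<longlonglongrightarrow> (cmod (?F \<omega>))\<^sup>2"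
    proof (rule AE_I2)
      fix \<omega> assume "\<omega> \<in> space \<mu>"
      then have "(\<lambda>n::nat. cmod (vker (- int n) vzero \<omega>) * (cmod (?F \<omega>))\<^sup>2) \<longlonglongrightarrow> 1 * (cmod (?F \<omega>))\<^sup>2"
        by (intro tendsto_mult tendsto_vker_ball tendsto_const) simp
      then show "(\<lambda>n::nat. cmod (vker (- int n) vzero \<omega>) * (cmod (?F \<omega>))\<^sup>2) \<longlonglongrightarrow> (cmod (?F \<omega>))\<^sup>2"
        by simp
    qed
    show "AE \<omega> in \<mu>. norm (cmod (vker (- int n) vzero \<omega>) * (cmod (?F \<omega>))\<^sup>2) \<le> (cmod (?F \<omega>))\<^sup>2" for n :: nat
      by (auto simp: vker_def)
  qed (use F in \<open>auto simp: L2_square_integrable\<close>)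
  then have 1: "(\<lambda>n::nat. (l2norm \<mu> (vavg p \<mu> (int n) u))\<^sup>2) \<longlonglongrightarrow> (l2norm \<mu> ?F)\<^sup>2"
    unfolding integral_low_frequencies[OF u] l2norm_power2[of \<mu> ?F] .
  have "(\<lambda>n::nat. l2norm \<mu> (vavg p \<mu> (int n) u)) \<longlonglongrightarrow> l2norm \<mu> u"
    using vavg_tendsto[OF u(2)] l2norm_minus_commute[of \<mu> u]
    by (intro tendsto_l2norm vavg_L2 u(2)) simp
  then have "(\<lambda>n::nat. (l2norm \<mu> (vavg p \<mu> (int n) u))\<^sup>2) \<longlonglongrightarrow> (l2norm \<mu> u)\<^sup>2"
    by (rule tendsto_power)
  with 1 have "(l2norm \<mu> ?F)\<^sup>2 = (l2norm \<mu> u)\<^sup>2"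
    by (rule LIMSEQ_unique)
  then show ?thesis
    by (simp add: power2_eq_iff_nonneg)
qed

text \<open>Plancherel minus the low-frequency identity, combined with Pythagoras for the
  projection.\<close>

lemma l2norm_high_frequencies_integrable:
  assumes u: "integrable \<mu> u" "u \<in> L2 \<mu>"
  shows "l2norm \<mu> (\<lambda>x. u x - vavg p \<mu> n u x) = l2norm \<mu> (\<lambda>\<omega>. (1 - vker (- n) vzero \<omega>) * vfourier p \<mu> u \<omega>)"
proof -
  let ?F = "vfourier p \<mu> u"
  have F: "?F \<in> L2 \<mu>"
    by (rule vfourier_L2_member[OF u])
  have [measurable]: "?F \<in> borel_measurable \<mu>"
    by (rule L2_measurable[OF F])
  have int: "integrable \<mu> (\<lambda>\<omega>. cmod (vker (- n) vzero \<omega>) * (cmod (?F \<omega>))\<^sup>2)"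
    by (rule Bochner_Integration.integrable_bound[OF L2_square_integrable[OF F]]) (auto simp: vker_def)
  have "(l2norm \<mu> (\<lambda>x. u x - vavg p \<mu> n u x))\<^sup>2
      = (\<integral>\<omega>. (cmod (?F \<omega>))\<^sup>2 \<partial>\<mu>) - (\<integral>\<omega>. cmod (vker (- n) vzero \<omega>) * (cmod (?F \<omega>))\<^sup>2 \<partial>\<mu>)"
    unfolding l2norm_diff_vavg_power2[OF u(2)] integral_low_frequencies[OF u] l2norm_vfourier[OF u, symmetric]
      l2norm_power2[of \<mu> ?F] ..
  also have "\<dots> = (\<integral>\<omega>. (cmod (?F \<omega>))\<^sup>2 - cmod (vker (- n) vzero \<omega>) * (cmod (?F \<omega>))\<^sup>2 \<partial>\<mu>)"
    using int F by (simp add: L2_square_integrable)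
  also have "\<dots> = (l2norm \<mu> (\<lambda>\<omega>. (1 - vker (- n) vzero \<omega>) * ?F \<omega>))\<^sup>2"
    unfolding l2norm_power2 by (rule Bochner_Integration.integral_cong) (auto simp: vker_def)
  finally show ?thesis
    by (simp add: power2_eq_iff_nonneg)
qed

lemma l2norm_cong: "(\<And>x. x \<in> vilenkin p \<Longrightarrow> f x = g x) \<Longrightarrow> l2norm \<mu> f = l2norm \<mu> g"
  unfolding l2norm_def by (intro arg_cong[of _ _ sqrt] Bochner_Integration.integral_cong) auto

section \<open>Extension of the Fourier transform to L2\<close>

lemma vfourier_diff:
  assumes "integrable \<mu> u" "integrable \<mu> v" "\<omega> \<in> vilenkin p"
  shows "vfourier p \<mu> (\<lambda>x. u x - v x) \<omega> = vfourier p \<mu> u \<omega> - vfourier p \<mu> v \<omega>"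
proof -
  note [measurable] = measurable_vchar(2)[OF assms(3)]
  have "integrable \<mu> (\<lambda>x. w x * cnj (vchar p x \<omega>))" if "integrable \<mu> w" for w
    by (rule Bochner_Integration.integrable_bound[OF that])
       (use that assms(3) in \<open>auto simp: norm_mult cmod_vchar\<close>)
  then show ?thesis
    using assms by (simp add: vfourier_def left_diff_distrib)
qed

text \<open>Truncations to balls are integrable and converge to \<open>f\<close>; their transforms
  are Cauchy by Plancherel and converge by completeness. The statement has the form of the choice in
  \<open>vfourier_L2\<close>, which it justifies.\<close>

lemma vfourier_L2_exists:
  assumes f: "f \<in> L2 \<mu>"
  shows "\<exists>F. F \<in> L2 \<mu> \<and>
     (\<exists>u :: nat \<Rightarrow> (int \<Rightarrow> nat) \<Rightarrow> complex.
        (\<forall>n. integrable \<mu> (u n) \<and> u n \<in> L2 \<mu> \<and> vfourier p \<mu> (u n) \<in> L2 \<mu>) \<and>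
        (\<lambda>n. l2norm \<mu> (\<lambda>x. u n x - f x)) \<longlonglongrightarrow> 0 \<and>
        (\<lambda>n. l2norm \<mu> (\<lambda>\<omega>. vfourier p \<mu> (u n) \<omega> - F \<omega>)) \<longlonglongrightarrow> 0)"
proof -
  define u where "u n x = vker (- int n) vzero x * f x" for n x
  have [measurable]: "f \<in> borel_measurable \<mu>"
    by (rule L2_measurable[OF f])
  have int: "integrable \<mu> (u n)" for n
    unfolding u_def[abs_def] by (rule integrable_vker_mult[OF vzero_closed f])
  have L2: "u n \<in> L2 \<mu>" for n
    unfolding u_def[abs_def] by (rule L2_bounded[OF f]) (auto simp: vker_def)
  have lim: "(\<lambda>n. l2norm \<mu> (\<lambda>x. f x - u n x)) \<longlonglongrightarrow> 0"
  proof (rule l2norm_dominated_tendsto[OF f])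
    show "cmod (u k x) \<le> 2 * cmod (f x)" for k x
      by (simp add: u_def vker_def)
    show "(\<lambda>k. u k x) \<longlonglongrightarrow> f x" if "x \<in> vilenkin p" for x
      by (rule tendsto_eventually, rule eventually_mono[OF eventually_mem_ball[OF that]])
         (simp add: u_def vker_def mem_vcoset)
  qed (use int in auto)
  have "\<exists>N. \<forall>m\<ge>N. \<forall>n\<ge>N. l2norm \<mu> (\<lambda>\<omega>. vfourier p \<mu> (u m) \<omega> - vfourier p \<mu> (u n) \<omega>) \<le> e"
    if e: "e > 0" for e
  proof -
    obtain N where N: "\<And>n. n \<ge> N \<Longrightarrow> l2norm \<mu> (\<lambda>x. f x - u n x) < e / 2"
      using LIMSEQ_D[OF lim, of "e / 2"] e by auto
    have "l2norm \<mu> (\<lambda>\<omega>. vfourier p \<mu> (u m) \<omega> - vfourier p \<mu> (u n) \<omega>) \<le> e" if "m \<ge> N" "n \<ge> N" for m n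
    proof -
      have "l2norm \<mu> (\<lambda>\<omega>. vfourier p \<mu> (u m) \<omega> - vfourier p \<mu> (u n) \<omega>)
          = l2norm \<mu> (vfourier p \<mu> (\<lambda>x. u m x - u n x))"
        by (rule l2norm_cong) (simp add: vfourier_diff int)
      also have "\<dots> = l2norm \<mu> (\<lambda>x. u m x - u n x)"
        by (rule l2norm_vfourier) (simp_all add: int L2 L2_diff)
      also have "\<dots> \<le> l2norm \<mu> (\<lambda>x. u m x - f x) + l2norm \<mu> (\<lambda>x. f x - u n x)"
        by (rule l2norm_triangle_diff[OF L2 f L2])
      also have "\<dots> \<le> e"
        using N[OF that(1)] N[OF that(2)] l2norm_minus_commute[of \<mu> f "u m"] by linarith
      finally show ?thesis .
    qed
    then show ?thesis
      by blast
  qed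
  then obtain F where "F \<in> L2 \<mu>" "(\<lambda>n. l2norm \<mu> (\<lambda>\<omega>. vfourier p \<mu> (u n) \<omega> - F \<omega>)) \<longlonglongrightarrow> 0"
    using l2_complete[of "\<lambda>n. vfourier p \<mu> (u n)" \<mu>] vfourier_L2_member[OF int L2] by blast
  moreover have "(\<lambda>n. l2norm \<mu> (\<lambda>x. u n x - f x)) \<longlonglongrightarrow> 0"
    using lim l2norm_minus_commute[of \<mu> f] by simp
  ultimately show ?thesis
    using int L2 vfourier_L2_member[OF int L2] by blast
qed

lemma l2norm_diff_vavg_le:
  assumes "f \<in> L2 \<mu>"
  shows "l2norm \<mu> (\<lambda>x. f x - vavg p \<mu> n f x) \<le> l2norm \<mu> f"
  by (rule power2_le_imp_le) (simp_all add: l2norm_diff_vavg_power2[OF assms])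

text \<open>The chosen function comes with an approximating sequence \<open>u\<close>. The
  identities hold for each \<open>u k\<close> and survive the limit because the cut-off and the
  subtraction of the average do not increase L2 norms.\<close>

lemma vfourier_L2_props:
  assumes f: "f \<in> L2 \<mu>"
  shows "vfourier_L2 p \<mu> f \<in> L2 \<mu>"
    and "l2norm \<mu> (vfourier_L2 p \<mu> f) = l2norm \<mu> f"
    and "l2norm \<mu> (\<lambda>x. f x - vavg p \<mu> n f x)
      = l2norm \<mu> (\<lambda>\<omega>. (1 - vker (- n) vzero \<omega>) * vfourier_L2 p \<mu> f \<omega>)"
proof -
  let ?F = "vfourier_L2 p \<mu> f"
  have "?F \<in> L2 \<mu> \<and>
     (\<exists>u :: nat \<Rightarrow> (int \<Rightarrow> nat) \<Rightarrow> complex.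
        (\<forall>n. integrable \<mu> (u n) \<and> u n \<in> L2 \<mu> \<and> vfourier p \<mu> (u n) \<in> L2 \<mu>) \<and>
        (\<lambda>n. l2norm \<mu> (\<lambda>x. u n x - f x)) \<longlonglongrightarrow> 0 \<and>
        (\<lambda>n. l2norm \<mu> (\<lambda>\<omega>. vfourier p \<mu> (u n) \<omega> - ?F \<omega>)) \<longlonglongrightarrow> 0)"
    using someI_ex[OF vfourier_L2_exists[OF f]] unfolding vfourier_L2_def .
  then obtain u where F: "?F \<in> L2 \<mu>" and u: "\<And>k. integrable \<mu> (u k)" "\<And>k. u k \<in> L2 \<mu>"
      "\<And>k. vfourier p \<mu> (u k) \<in> L2 \<mu>"
    and uf: "(\<lambda>k. l2norm \<mu> (\<lambda>x. u k x - f x)) \<longlonglongrightarrow> 0"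
    and uF: "(\<lambda>k. l2norm \<mu> (\<lambda>\<omega>. vfourier p \<mu> (u k) \<omega> - ?F \<omega>)) \<longlonglongrightarrow> 0"
    by blast
  show "?F \<in> L2 \<mu>"
    by (rule F)
  have "(\<lambda>k. l2norm \<mu> (vfourier p \<mu> (u k))) \<longlonglongrightarrow> l2norm \<mu> ?F"
    by (rule tendsto_l2norm[OF u(3) F uF])
  moreover have "(\<lambda>k. l2norm \<mu> (u k)) \<longlonglongrightarrow> l2norm \<mu> f"
    by (rule tendsto_l2norm[OF u(2) f uf])
  ultimately show "l2norm \<mu> ?F = l2norm \<mu> f"
    by (simp add: l2norm_vfourier u LIMSEQ_unique)
  let ?k = "\<lambda>\<omega>. 1 - vker (- n) vzero \<omega>"
  have kL2: "(\<lambda>\<omega>. ?k \<omega> * g \<omega>) \<in> L2 \<mu>" if "g \<in> L2 \<mu>" for g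
    by (rule L2_bounded[OF that]) (use L2_measurable[OF that] in \<open>auto simp: vker_def\<close>)
  have "(\<lambda>k. l2norm \<mu> (\<lambda>\<omega>. ?k \<omega> * vfourier p \<mu> (u k) \<omega>)) \<longlonglongrightarrow> l2norm \<mu> (\<lambda>\<omega>. ?k \<omega> * ?F \<omega>)"
  proof (rule tendsto_l2norm[OF kL2[OF u(3)] kL2[OF F]])
    have "l2norm \<mu> (\<lambda>\<omega>. ?k \<omega> * vfourier p \<mu> (u k) \<omega> - ?k \<omega> * ?F \<omega>)
        \<le> l2norm \<mu> (\<lambda>\<omega>. vfourier p \<mu> (u k) \<omega> - ?F \<omega>)" for k
      unfolding l2norm_def
    proof (intro real_sqrt_le_mono integral_mono)
      show "integrable \<mu> (\<lambda>\<omega>. (cmod (?k \<omega> * vfourier p \<mu> (u k) \<omega> - ?k \<omega> * ?F \<omega>))\<^sup>2)"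
        by (intro L2_square_integrable L2_diff kL2 u F)
      show "integrable \<mu> (\<lambda>\<omega>. (cmod (vfourier p \<mu> (u k) \<omega> - ?F \<omega>))\<^sup>2)"
        by (intro L2_square_integrable L2_diff u F)
    qed (auto simp: vker_def)
    then show "(\<lambda>k. l2norm \<mu> (\<lambda>\<omega>. ?k \<omega> * vfourier p \<mu> (u k) \<omega> - ?k \<omega> * ?F \<omega>)) \<longlonglongrightarrow> 0"
      by (intro Lim_null_comparison[OF _ uF]) (auto intro!: always_eventually)
  qed
  moreover have "(\<lambda>k. l2norm \<mu> (\<lambda>x. u k x - vavg p \<mu> n (u k) x)) \<longlonglongrightarrow> l2norm \<mu> (\<lambda>x. f x - vavg p \<mu> n f x)"
  proof (rule tendsto_l2norm)
    have "l2norm \<mu> (\<lambda>x. (u k x - vavg p \<mu> n (u k) x) - (f x - vavg p \<mu> n f x))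
        \<le> l2norm \<mu> (\<lambda>x. u k x - f x)" for k
    proof -
      have "l2norm \<mu> (\<lambda>x. (u k x - vavg p \<mu> n (u k) x) - (f x - vavg p \<mu> n f x))
          = l2norm \<mu> (\<lambda>x. (u k x - f x) - vavg p \<mu> n (\<lambda>x. u k x - f x) x)"
        by (rule l2norm_cong) (simp add: vavg_diff u f)
      also have "\<dots> \<le> l2norm \<mu> (\<lambda>x. u k x - f x)"
        by (rule l2norm_diff_vavg_le[OF L2_diff[OF u(2) f]])
      finally show ?thesis .
    qed
    then show "(\<lambda>k. l2norm \<mu> (\<lambda>x. (u k x - vavg p \<mu> n (u k) x) - (f x - vavg p \<mu> n f x))) \<longlonglongrightarrow> 0"
      by (intro Lim_null_comparison[OF _ uf]) (auto intro!: always_eventually)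
  qed (intro L2_diff u f vavg_L2)+
  ultimately show "l2norm \<mu> (\<lambda>x. f x - vavg p \<mu> n f x) = l2norm \<mu> (\<lambda>\<omega>. ?k \<omega> * ?F \<omega>)"
    by (simp add: l2norm_high_frequencies_integrable u LIMSEQ_unique)
qed

section \<open>Approximation of Sobolev functions by averages\<close>

lemma vnorm_nonneg: "0 \<le> vnorm p \<omega>"
  by (simp add: vnorm_def)

text \<open>The leading index of \<open>\<omega>\<close> is at most \<open>j\<close>. Looking only
  at indices up to \<open>j\<close> makes the set of candidates finite, as the support is bounded
  below.\<close>

lemma vnorm_ge:
  assumes \<omega>: "\<omega> \<in> vilenkin p" and j: "\<omega> j \<noteq> 0"
  shows "real p powi (- j) \<le> vnorm p \<omega>"
proof -
  obtain N :: nat where N: "\<And>j. j \<le> - int N \<Longrightarrow> \<omega> j = 0"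
    using vilenkin_support_bounded[OF \<omega>] by blast
  let ?S = "{i. i \<le> j \<and> \<omega> i \<noteq> 0}"
  have "i \<in> {- int N..j}" if "i \<in> ?S" for i
    using N[of i] that by (cases "i \<le> - int N") auto
  then have fin: "finite ?S"
    by (intro finite_subset[of ?S "{- int N..j}"]) auto
  have ne: "?S \<noteq> {}"
    using j by blast
  define k where "k = Min ?S"
  have k: "k \<le> j" "\<omega> k \<noteq> 0"
    using Min_in[OF fin ne] by (auto simp: k_def)
  have below: "\<omega> i = 0" if "i < k" for i
  proof (rule ccontr)
    assume "\<omega> i \<noteq> 0"
    then have "i \<in> ?S"
      using that k by auto
    then show False
      using Min_le[OF fin, of i] that by (simp add: k_def)
  qed
  have "(THE k. \<omega> k \<noteq> 0 \<and> (\<forall>j<k. \<omega> j = 0)) = k"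
  proof (rule the_equality)
    show "\<omega> k \<noteq> 0 \<and> (\<forall>j<k. \<omega> j = 0)"
      using k below by blast
    show "i = k" if "\<omega> i \<noteq> 0 \<and> (\<forall>j<i. \<omega> j = 0)" for i
      using that k(2) below[of i] by (cases i k rule: linorder_cases) auto
  qed
  moreover have "\<omega> \<noteq> vzero"
    using j by (auto simp: vzero_def)
  ultimately have "vnorm p \<omega> = real p powi (- k)"
    by (simp add: vnorm_def)
  moreover have "real p powi (- j) \<le> real p powi (- k)"
    using k(1) p2 by (intro power_int_increasing) auto
  ultimately show ?thesis
    by simp
qed

text \<open>A frequency outside \<open>U_{-l}\<close> has a nonzero coordinate at some index
  \<open>j <= -l\<close>, hence norm at least \<open>p^l\<close>; on these frequencies the weight
  \<open>vnorm p \<omega> ^ (2 * m)\<close> is at least \<open>p^(2 l m)\<close>.\<close>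

lemma l2norm_diff_vavg_sobolev:
  assumes f: "f \<in> sobolev p \<mu> m"
  shows "l2norm \<mu> (\<lambda>x. f x - vavg p \<mu> l f x) \<le> real p powi (- (l * int m)) * sobolev_norm p \<mu> m f"
proof -
  let ?F = "vfourier_L2 p \<mu> f"
  have fL2: "f \<in> L2 \<mu>"
    and int: "integrable \<mu> (\<lambda>\<omega>. vnorm p \<omega> ^ (2 * m) * (cmod (?F \<omega>))\<^sup>2)"
    using f by (auto simp: sobolev_def)
  have F: "?F \<in> L2 \<mu>"
    by (rule vfourier_L2_props(1)[OF fL2])
  have [measurable]: "?F \<in> borel_measurable \<mu>"
    by (rule L2_measurable[OF F])
  let ?q = "real p powi (- (l * int m))"
  have q: "?q\<^sup>2 * (real p powi l) ^ (2 * m) = 1"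
  proof -
    have "?q * (real p powi l) ^ m = 1"
      using p_pos by (simp add: power_int_mult power_int_minus flip: power_int_power)
    then have "(?q * (real p powi l) ^ m)\<^sup>2 = 1"
      by simp
    then show ?thesis
      by (simp add: power_mult_distrib power_even_eq)
  qed
  have "(l2norm \<mu> (\<lambda>\<omega>. (1 - vker (- l) vzero \<omega>) * ?F \<omega>))\<^sup>2
      \<le> (\<integral>\<omega>. ?q\<^sup>2 * (vnorm p \<omega> ^ (2 * m) * (cmod (?F \<omega>))\<^sup>2) \<partial>\<mu>)"
    unfolding l2norm_power2
  proof (rule integral_mono)
    show "integrable \<mu> (\<lambda>\<omega>. (cmod ((1 - vker (- l) vzero \<omega>) * ?F \<omega>))\<^sup>2)"
      by (rule L2_square_integrable, rule L2_bounded[OF F]) (auto simp: vker_def)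
    show "integrable \<mu> (\<lambda>\<omega>. ?q\<^sup>2 * (vnorm p \<omega> ^ (2 * m) * (cmod (?F \<omega>))\<^sup>2))"
      using int by simp
    fix \<omega> assume "\<omega> \<in> space \<mu>"
    then have \<omega>: "\<omega> \<in> vilenkin p"
      by simp
    show "(cmod ((1 - vker (- l) vzero \<omega>) * ?F \<omega>))\<^sup>2 \<le> ?q\<^sup>2 * (vnorm p \<omega> ^ (2 * m) * (cmod (?F \<omega>))\<^sup>2)"
    proof (cases "\<forall>j\<le>- l. \<omega> j = 0")
      case True
      then show ?thesis
        by (simp add: vker_def vzero_def vnorm_nonneg)
    next
      case False
      then obtain j where j: "j \<le> - l" "\<omega> j \<noteq> 0"
        by blast
      have "real p powi l \<le> real p powi (- j)"
        using j p2 by (intro power_int_increasing) auto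
      also have "\<dots> \<le> vnorm p \<omega>"
        by (rule vnorm_ge[OF \<omega> j(2)])
      finally have "(real p powi l) ^ (2 * m) \<le> vnorm p \<omega> ^ (2 * m)"
        by (rule power_mono) simp
      then have "?q\<^sup>2 * (real p powi l) ^ (2 * m) \<le> ?q\<^sup>2 * vnorm p \<omega> ^ (2 * m)"
        by (rule mult_left_mono) simp
      then have "1 * (cmod (?F \<omega>))\<^sup>2 \<le> ?q\<^sup>2 * vnorm p \<omega> ^ (2 * m) * (cmod (?F \<omega>))\<^sup>2"
        unfolding q by (rule mult_right_mono) simp
      then show ?thesis
        using False by (auto simp: vker_def vzero_def mult.assoc)
    qed
  qed
  also have "\<dots> = ?q\<^sup>2 * (\<integral>\<omega>. vnorm p \<omega> ^ (2 * m) * (cmod (?F \<omega>))\<^sup>2 \<partial>\<mu>)"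
    by simp
  finally have "l2norm \<mu> (\<lambda>\<omega>. (1 - vker (- l) vzero \<omega>) * ?F \<omega>)
      \<le> sqrt (?q\<^sup>2 * (\<integral>\<omega>. vnorm p \<omega> ^ (2 * m) * (cmod (?F \<omega>))\<^sup>2 \<partial>\<mu>))"
    by (rule real_le_rsqrt)
  also have "\<dots> = ?q * sqrt (\<integral>\<omega>. vnorm p \<omega> ^ (2 * m) * (cmod (?F \<omega>))\<^sup>2 \<partial>\<mu>)"
    by (simp add: real_sqrt_mult)
  also have "\<dots> \<le> ?q * sobolev_norm p \<mu> m f"
    unfolding sobolev_norm_def
    by (intro mult_left_mono member_le_sum[of m "{0..m}"
          "\<lambda>k. sqrt (\<integral>\<omega>. vnorm p \<omega> ^ (2 * k) * (cmod (?F \<omega>))\<^sup>2 \<partial>\<mu>)"])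
       (auto intro!: Bochner_Integration.integral_nonneg simp: vnorm_nonneg)
  finally show ?thesis
    unfolding vfourier_L2_props(3)[OF fL2] .
qed

text \<open>Plancherel in the form in which the case \<open>m = 0\<close> uses it.\<close>

lemma l2norm_eq_sobolev_norm_zero:
  assumes "f \<in> L2 \<mu>"
  shows "l2norm \<mu> f = sobolev_norm p \<mu> 0 f"
  using vfourier_L2_props(2)[OF assms] by (simp add: sobolev_norm_def l2norm_def)

end

subsection \<open>Tight frames\<close>

text \<open>Frame theory over an arbitrary measure and index set. \<open>B_nonneg\<close> is assumed
  because the frame identity forces it only if some function has positive norm.\<close>

locale l2_tight_frame =
  fixes M :: "'a measure" and w :: "'i \<Rightarrow> 'a \<Rightarrow> complex" and T :: "'i set" and B :: real
  assumes w_L2: "t \<in> T \<Longrightarrow> w t \<in> L2 M"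
    and frame: "f \<in> L2 M \<Longrightarrow> ((\<lambda>t. (cmod (l2inner M f (w t)))\<^sup>2) has_sum (B * (l2norm M f)\<^sup>2)) T"
    and B_nonneg: "B \<ge> 0"
begin

lemma coefficients_le:
  assumes "f \<in> L2 M" "finite F" "F \<subseteq> T"
  shows "(\<Sum>t\<in>F. (cmod (l2inner M f (w t)))\<^sup>2) \<le> B * (l2norm M f)\<^sup>2"
  by (rule finite_sum_le_has_sum[OF frame[OF assms(1)] assms(2,3)]) simp

lemma synthesis_L2: "F \<subseteq> T \<Longrightarrow> (\<lambda>x. \<Sum>t\<in>F. c t * w t x) \<in> L2 M"
  by (intro L2_sum L2_scale w_L2) auto

text \<open>Duality: the squared norm of the synthesised \<open>g\<close> is the pairing of
  \<open>c\<close> with the coefficients of \<open>g\<close>. Cauchy-Schwarz and the frame bound for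
  \<open>g\<close> then leave one squared norm of \<open>g\<close> to be cancelled.\<close>

lemma synthesis_le:
  assumes F: "finite F" "F \<subseteq> T"
  shows "(l2norm M (\<lambda>x. \<Sum>t\<in>F. c t * w t x))\<^sup>2 \<le> B * (\<Sum>t\<in>F. (cmod (c t))\<^sup>2)"
proof -
  define g where "g x = (\<Sum>t\<in>F. c t * w t x)" for x
  have g: "g \<in> L2 M"
    unfolding g_def[abs_def] by (rule synthesis_L2[OF F(2)])
  let ?S = "\<Sum>t\<in>F. (cmod (c t))\<^sup>2"
  have "complex_of_real ((l2norm M g)\<^sup>2) = l2inner M (\<lambda>x. \<Sum>t\<in>F. c t * w t x) g"
    by (simp add: l2inner_self flip: g_def)
  also have "\<dots> = (\<Sum>t\<in>F. c t * l2inner M (w t) g)"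
    using F(2) by (subst l2inner_sum_left) (auto simp: g L2_scale w_L2 l2inner_scale_left subset_iff)
  finally have eq: "complex_of_real ((l2norm M g)\<^sup>2) = (\<Sum>t\<in>F. c t * l2inner M (w t) g)" .
  have "(l2norm M g)\<^sup>2 = cmod (complex_of_real ((l2norm M g)\<^sup>2))"
    unfolding norm_of_real by simp
  also have "\<dots> \<le> (\<Sum>t\<in>F. cmod (c t) * cmod (l2inner M g (w t)))"
    unfolding eq using norm_sum[of "\<lambda>t. c t * l2inner M (w t) g" F] l2inner_commute[of M g]
    by (simp add: norm_mult)
  finally have "((l2norm M g)\<^sup>2)\<^sup>2 \<le> (\<Sum>t\<in>F. cmod (c t) * cmod (l2inner M g (w t)))\<^sup>2"
    by (rule power_mono) simp
  also have "\<dots> \<le> ?S * (\<Sum>t\<in>F. (cmod (l2inner M g (w t)))\<^sup>2)"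
    by (rule Cauchy_Schwarz_ineq_sum)
  also have "\<dots> \<le> ?S * (B * (l2norm M g)\<^sup>2)"
    by (intro mult_left_mono coefficients_le g F sum_nonneg) auto
  finally have *: "(l2norm M g)\<^sup>2 * (l2norm M g)\<^sup>2 \<le> (B * ?S) * (l2norm M g)\<^sup>2"
    by (simp add: power2_eq_square mult_ac)
  have "(l2norm M g)\<^sup>2 \<le> B * ?S"
  proof (cases "l2norm M g = 0")
    case True
    then show ?thesis
      using B_nonneg by (simp add: sum_nonneg)
  next
    case False
    then show ?thesis
      by (intro mult_right_le_imp_le[OF *]) simp
  qed
  then show ?thesis
    by (simp add: g_def[abs_def])
qed

abbreviation partial_sum :: "('a \<Rightarrow> complex) \<Rightarrow> 'i set \<Rightarrow> 'a \<Rightarrow> complex" where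
  "partial_sum f F \<equiv> \<lambda>x. \<Sum>t\<in>F. l2inner M f (w t) * w t x"

lemma partial_sum_diff:
  assumes "F' \<subseteq> F" "finite F"
  shows "partial_sum f F x - partial_sum f F' x = partial_sum f (F - F') x"
  using assms by (simp add: sum_diff)

lemma partial_sum_Cauchy:
  assumes f: "f \<in> L2 M" and I: "I \<subseteq> T" and e: "e > 0"
  shows "\<exists>F. finite F \<and> F \<subseteq> I \<and> (\<forall>G. finite G \<and> G \<subseteq> I - F \<longrightarrow> l2norm M (partial_sum f G) \<le> e)"
proof -
  let ?c = "\<lambda>t. (cmod (l2inner M f (w t)))\<^sup>2"
  \<comment> \<open>The denominator is \<open>B + 1\<close> rather than \<open>B\<close>, which may
    be zero.\<close>
  define d where "d = e\<^sup>2 / (B + 1)"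
  have d: "d > 0" "B * d \<le> e\<^sup>2"
    using e B_nonneg by (auto simp: d_def field_simps)
  have "?c summable_on I"
    by (rule summable_on_subset_banach[OF has_sum_imp_summable[OF frame[OF f]] I])
  then obtain S where S: "(?c has_sum S) I"
    by (auto simp: summable_on_def)
  then have "(sum ?c \<longlongrightarrow> S) (finite_subsets_at_top I)"
    by (simp add: has_sum_def)
  from order_tendstoD(1)[OF this, of "S - d"] d have "\<forall>\<^sub>F F in finite_subsets_at_top I. S - d < sum ?c F"
    by simp
  then obtain F where F: "finite F" "F \<subseteq> I"
    "\<And>F'. finite F' \<Longrightarrow> F \<subseteq> F' \<Longrightarrow> F' \<subseteq> I \<Longrightarrow> S - d < sum ?c F'"
    unfolding eventually_finite_subsets_at_top by auto
  have "l2norm M (partial_sum f G) \<le> e" if G: "finite G" "G \<subseteq> I - F" for G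
  proof (rule power2_le_imp_le)
    have "sum ?c F + sum ?c G = sum ?c (F \<union> G)"
      using F G by (subst sum.union_disjoint) auto
    also have "\<dots> \<le> S"
      by (rule finite_sum_le_has_sum[OF S]) (use F G in auto)
    finally have "sum ?c G \<le> d"
      using F(3)[of F] F(1,2) by simp
    then have "B * sum ?c G \<le> B * d"
      using B_nonneg by (rule mult_left_mono)
    moreover have "(l2norm M (partial_sum f G))\<^sup>2 \<le> B * sum ?c G"
      using G I by (intro synthesis_le) auto
    ultimately show "(l2norm M (partial_sum f G))\<^sup>2 \<le> e\<^sup>2"
      using d by linarith
  qed (use e in simp)
  then show ?thesis
    using F by blast
qed

lemma l2_has_sum_exists:
  assumes f: "f \<in> L2 M" and I: "I \<subseteq> T"
  shows "\<exists>s. l2_has_sum M (\<lambda>t x. l2inner M f (w t) * w t x) I s"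
proof -
  have "\<forall>n::nat. \<exists>F. finite F \<and> F \<subseteq> I \<and>
      (\<forall>G. finite G \<and> G \<subseteq> I - F \<longrightarrow> l2norm M (partial_sum f G) \<le> inverse (real (Suc n)))"
    using partial_sum_Cauchy[OF f I] by simp
  then obtain F where F: "\<And>n. finite (F n)" "\<And>n. F n \<subseteq> I"
    and small: "\<And>n G. finite G \<Longrightarrow> G \<subseteq> I - F n \<Longrightarrow> l2norm M (partial_sum f G) \<le> inverse (real (Suc n))"
    by metis
  \<comment> \<open>The unions make the exhausting sets increasing, so differences of later partial
    sums are partial sums over sets that avoid \<open>F n\<close>.\<close>
  define E where "E n = (\<Union>k\<le>n. F k)" for n
  have E: "finite (E n)" "E n \<subseteq> I" for n
    using F by (auto simp: E_def)
  have EF: "F k \<subseteq> E n" if "k \<le> n" for k n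
    using that by (auto simp: E_def)
  have mono: "E m \<subseteq> E n" if "m \<le> n" for m n
    using that by (force simp: E_def)
  have L2: "partial_sum f G \<in> L2 M" if "G \<subseteq> I" for G
    by (rule synthesis_L2) (use that I in blast)
  have diff: "l2norm M (\<lambda>x. partial_sum f G x - partial_sum f G' x) \<le> inverse (real (Suc n))"
    if "F n \<subseteq> G'" "G' \<subseteq> G" "G \<subseteq> I" "finite G" for n G G'
  proof -
    have "l2norm M (\<lambda>x. partial_sum f G x - partial_sum f G' x) = l2norm M (partial_sum f (G - G'))"
      using that by (simp add: partial_sum_diff)
    also have "\<dots> \<le> inverse (real (Suc n))"
      by (rule small) (use that in auto)
    finally show ?thesis .
  qed
  have "\<exists>N. \<forall>m\<ge>N. \<forall>n\<ge>N. l2norm M (\<lambda>x. partial_sum f (E m) x - partial_sum f (E n) x) \<le> e"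
    if "e > 0" for e
  proof -
    obtain N where N: "inverse (real (Suc N)) < e"
      using reals_Archimedean[OF \<open>e > 0\<close>] by blast
    have *: "l2norm M (\<lambda>x. partial_sum f (E m) x - partial_sum f (E n) x) \<le> e" if "N \<le> n" "n \<le> m" for m n
      using diff[OF EF[OF that(1)] mono[OF that(2)] E(2,1)] N by linarith
    have "l2norm M (\<lambda>x. partial_sum f (E m) x - partial_sum f (E n) x) \<le> e" if "N \<le> m" "N \<le> n" for m n
      using *[of n m] *[of m n] that l2norm_minus_commute[of M "partial_sum f (E m)" "partial_sum f (E n)"]
      by (cases "n \<le> m") auto
    then show ?thesis
      by blast
  qed
  then obtain s where s: "s \<in> L2 M" "(\<lambda>n. l2norm M (\<lambda>x. partial_sum f (E n) x - s x)) \<longlonglongrightarrow> 0"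
    using l2_complete[of "\<lambda>n. partial_sum f (E n)" M] L2[OF E(2)] by blast
  have "((\<lambda>G. l2norm M (\<lambda>x. s x - partial_sum f G x)) \<longlongrightarrow> 0) (finite_subsets_at_top I)"
  proof (rule tendstoI)
    fix e :: real assume e: "e > 0"
    obtain N where N: "inverse (real (Suc N)) < e / 2"
      using reals_Archimedean[of "e / 2"] e by auto
    obtain K where K: "\<And>n. n \<ge> K \<Longrightarrow> l2norm M (\<lambda>x. partial_sum f (E n) x - s x) < e / 2"
      using LIMSEQ_D[OF s(2), of "e / 2"] e by auto
    let ?n = "max N K"
    have "dist (l2norm M (\<lambda>x. s x - partial_sum f G x)) 0 < e"
      if G: "finite G" "E ?n \<subseteq> G" "G \<subseteq> I" for G
    proof -
      have "l2norm M (\<lambda>x. s x - partial_sum f G x)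
          \<le> l2norm M (\<lambda>x. s x - partial_sum f (E ?n) x)
            + l2norm M (\<lambda>x. partial_sum f (E ?n) x - partial_sum f G x)"
        by (rule l2norm_triangle_diff[OF s(1) L2[OF E(2)] L2[OF G(3)]])
      moreover have "l2norm M (\<lambda>x. partial_sum f G x - partial_sum f (E ?n) x) \<le> inverse (real (Suc N))"
        by (rule diff[OF EF[of N ?n] G(2,3,1)]) simp
      ultimately show ?thesis
        using K[of ?n] N l2norm_minus_commute[of M s "partial_sum f (E ?n)"]
          l2norm_minus_commute[of M "partial_sum f G" "partial_sum f (E ?n)"]
        by simp
    qed
    then show "\<forall>\<^sub>F G in finite_subsets_at_top I. dist (l2norm M (\<lambda>x. s x - partial_sum f G x)) 0 < e"
      unfolding eventually_finite_subsets_at_top by (intro exI[of _ "E ?n"]) (simp add: E)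
  qed
  then have "l2_has_sum M (\<lambda>t x. l2inner M f (w t) * w t x) I s"
    using s(1) I by (auto simp: l2_has_sum_def L2_scale w_L2 subset_iff)
  then show ?thesis
    by (rule exI[of _ s])
qed

lemma l2_has_sum_approx:
  assumes "l2_has_sum M (\<lambda>t x. l2inner M f (w t) * w t x) I s" "e > 0"
  obtains F where "finite F" "F \<subseteq> I"
    "\<And>G. finite G \<Longrightarrow> F \<subseteq> G \<Longrightarrow> G \<subseteq> I \<Longrightarrow> l2norm M (\<lambda>x. s x - partial_sum f G x) < e"
proof -
  have "((\<lambda>G. l2norm M (\<lambda>x. s x - partial_sum f G x)) \<longlongrightarrow> 0) (finite_subsets_at_top I)"
    using assms(1) by (simp add: l2_has_sum_def)
  from order_tendstoD(2)[OF this assms(2)] obtain F where "finite F" "F \<subseteq> I"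
    "\<forall>G. finite G \<and> F \<subseteq> G \<and> G \<subseteq> I \<longrightarrow> l2norm M (\<lambda>x. s x - partial_sum f G x) < e"
    unfolding eventually_finite_subsets_at_top by auto
  then show ?thesis
    by (intro that[of F]) auto
qed

text \<open>Analysis and synthesis each contribute a factor \<open>sqrt B\<close> to the norm
  estimate.\<close>

lemma l2norm_sum_le:
  assumes f: "f \<in> L2 M" and I: "I \<subseteq> T"
    and s: "l2_has_sum M (\<lambda>t x. l2inner M f (w t) * w t x) I s"
  shows "l2norm M s \<le> B * l2norm M f"
proof (rule field_le_epsilon)
  fix e :: real assume "e > 0"
  obtain F where F: "finite F" "F \<subseteq> I" and
    approx: "\<And>G. finite G \<Longrightarrow> F \<subseteq> G \<Longrightarrow> G \<subseteq> I \<Longrightarrow> l2norm M (\<lambda>x. s x - partial_sum f G x) < e"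
    by (rule l2_has_sum_approx[OF s \<open>e > 0\<close>]) (rule that, simp_all)
  have "F \<subseteq> T"
    using F(2) I by blast
  have "(l2norm M (partial_sum f F))\<^sup>2 \<le> B * (\<Sum>t\<in>F. (cmod (l2inner M f (w t)))\<^sup>2)"
    by (rule synthesis_le[OF F(1) \<open>F \<subseteq> T\<close>])
  also have "\<dots> \<le> B * (B * (l2norm M f)\<^sup>2)"
    by (intro mult_left_mono coefficients_le f F(1) \<open>F \<subseteq> T\<close> B_nonneg)
  also have "\<dots> = (B * l2norm M f)\<^sup>2"
    by (simp add: power2_eq_square)
  finally have "l2norm M (partial_sum f F) \<le> B * l2norm M f"
    by (rule power2_le_imp_le) (simp add: B_nonneg)
  moreover have "l2norm M s \<le> l2norm M (partial_sum f F) + l2norm M (\<lambda>x. s x - partial_sum f F x)"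
    using s by (intro l2norm_le_diff synthesis_L2 \<open>F \<subseteq> T\<close>) (simp add: l2_has_sum_def)
  ultimately show "l2norm M s \<le> B * l2norm M f + e"
    using approx[OF F(1) subset_refl F(2)] by linarith
qed

text \<open>For frame constant 1, \<open>\<parallel>f - \<Sum>\<^sub>F\<parallel>\<^sup>2 = \<parallel>f\<parallel>\<^sup>2 - 2 \<Sum>\<^sub>F |\<langle>f, w\<^sub>t\<rangle>|\<^sup>2 + \<parallel>\<Sum>\<^sub>F\<parallel>\<^sup>2\<close> is at most
  \<open>\<parallel>f\<parallel>\<^sup>2 - \<Sum>\<^sub>F |\<langle>f, w\<^sub>t\<rangle>|\<^sup>2\<close>, which tends to 0; no polarisation is needed.\<close>

lemma reconstruction:
  assumes f: "f \<in> L2 M" and "B = 1" and e: "e > 0"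
  obtains F where "finite F" "F \<subseteq> T"
    "\<And>G. finite G \<Longrightarrow> F \<subseteq> G \<Longrightarrow> G \<subseteq> T \<Longrightarrow> l2norm M (\<lambda>x. f x - partial_sum f G x) < e"
proof -
  let ?c = "\<lambda>t. (cmod (l2inner M f (w t)))\<^sup>2"
  have "(sum ?c \<longlongrightarrow> (l2norm M f)\<^sup>2) (finite_subsets_at_top T)"
    using frame[OF f] \<open>B = 1\<close> by (simp add: has_sum_def)
  from order_tendstoD(1)[OF this, of "(l2norm M f)\<^sup>2 - e\<^sup>2"] e
  obtain F where F: "finite F" "F \<subseteq> T"
    "\<And>G. finite G \<Longrightarrow> F \<subseteq> G \<Longrightarrow> G \<subseteq> T \<Longrightarrow> (l2norm M f)\<^sup>2 - e\<^sup>2 < sum ?c G"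
    unfolding eventually_finite_subsets_at_top by auto
  have "l2norm M (\<lambda>x. f x - partial_sum f G x) < e" if G: "finite G" "F \<subseteq> G" "G \<subseteq> T" for G
  proof -
    have "l2inner M (partial_sum f G) f = (\<Sum>t\<in>G. l2inner M f (w t) * l2inner M (w t) f)"
      using G(3) by (subst l2inner_sum_left) (auto simp: f L2_scale w_L2 l2inner_scale_left subset_iff)
    also have "\<dots> = (\<Sum>t\<in>G. complex_of_real (?c t))"
      unfolding l2inner_commute[of M "w _" f] by (simp only: complex_norm_square)
    finally have "l2inner M (partial_sum f G) f = complex_of_real (sum ?c G)"
      by (simp only: of_real_sum)
    moreover have "l2inner M f (partial_sum f G) = cnj (l2inner M (partial_sum f G) f)"
      by (rule l2inner_commute)
    ultimately have "Re (l2inner M f (partial_sum f G)) = sum ?c G"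
      by (simp only: complex_cnj_complex_of_real Re_complex_of_real)
    then have "(l2norm M (\<lambda>x. f x - partial_sum f G x))\<^sup>2
        = (l2norm M f)\<^sup>2 - 2 * sum ?c G + (l2norm M (partial_sum f G))\<^sup>2"
      using l2norm_diff_power2[OF f synthesis_L2[OF G(3)]] by simp
    also have "\<dots> < e\<^sup>2"
      using synthesis_le[OF G(1,3), of "\<lambda>t. l2inner M f (w t)"] F(3)[OF G] \<open>B = 1\<close> by simp
    finally show ?thesis
      using e by (simp add: power2_less_imp_less)
  qed
  then show ?thesis
    using that[OF F(1,2)] by blast
qed

text \<open>A large finite set makes the partial sum close to \<open>f\<close> and its part inside
  \<open>I\<close> close to \<open>s\<close>; the rest is synthesised from finitely many
  coefficients outside \<open>I\<close>, whose energy is bounded by \<open>D\<close>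
  squared.\<close>

lemma l2norm_remainder_le:
  assumes f: "f \<in> L2 M" and "B = 1" and I: "I \<subseteq> T"
    and s: "l2_has_sum M (\<lambda>t x. l2inner M f (w t) * w t x) I s"
    and D: "\<And>F. finite F \<Longrightarrow> F \<subseteq> T - I \<Longrightarrow> (\<Sum>t\<in>F. (cmod (l2inner M f (w t)))\<^sup>2) \<le> D\<^sup>2"
    and "D \<ge> 0"
  shows "l2norm M (\<lambda>x. f x - s x) \<le> D"
proof (rule field_le_epsilon)
  fix e :: real assume "e > 0"
  then have e: "e / 2 > 0"
    by simp
  obtain F0 where F0: "finite F0" "F0 \<subseteq> T"
    "\<And>G. finite G \<Longrightarrow> F0 \<subseteq> G \<Longrightarrow> G \<subseteq> T \<Longrightarrow> l2norm M (\<lambda>x. f x - partial_sum f G x) < e / 2"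
    by (rule reconstruction[OF f \<open>B = 1\<close> e]) (rule that, simp_all)
  obtain F1 where F1: "finite F1" "F1 \<subseteq> I"
    "\<And>G. finite G \<Longrightarrow> F1 \<subseteq> G \<Longrightarrow> G \<subseteq> I \<Longrightarrow> l2norm M (\<lambda>x. s x - partial_sum f G x) < e / 2"
    by (rule l2_has_sum_approx[OF s e]) (rule that, simp_all)
  let ?G = "F0 \<union> F1"
  have G: "finite ?G" "?G \<subseteq> T"
    using F0 F1 I by auto
  have L2: "partial_sum f ?G \<in> L2 M" "partial_sum f (?G \<inter> I) \<in> L2 M" "s \<in> L2 M"
    using G s by (auto intro!: synthesis_L2 simp: l2_has_sum_def)
  have 1: "l2norm M (\<lambda>x. f x - partial_sum f ?G x) < e / 2"
    by (rule F0(3)) (use G in auto)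
  have 2: "l2norm M (\<lambda>x. s x - partial_sum f (?G \<inter> I) x) < e / 2"
    by (rule F1(3)) (use G F1 in auto)
  have 3: "l2norm M (\<lambda>x. partial_sum f ?G x - partial_sum f (?G \<inter> I) x) \<le> D"
  proof (rule power2_le_imp_le)
    have "l2norm M (\<lambda>x. partial_sum f ?G x - partial_sum f (?G \<inter> I) x)
        = l2norm M (partial_sum f (?G - ?G \<inter> I))"
      using G(1) by (subst partial_sum_diff) auto
    moreover have "(l2norm M (partial_sum f (?G - ?G \<inter> I)))\<^sup>2 \<le> D\<^sup>2"
    proof -
      have H: "finite (?G - ?G \<inter> I)" "?G - ?G \<inter> I \<subseteq> T - I" "?G - ?G \<inter> I \<subseteq> T"
        using G by auto
      show ?thesis
        using synthesis_le[OF H(1,3), of "\<lambda>t. l2inner M f (w t)"] D[OF H(1,2)]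
        unfolding \<open>B = 1\<close> mult_1 by (rule order_trans)
    qed
    ultimately show "(l2norm M (\<lambda>x. partial_sum f ?G x - partial_sum f (?G \<inter> I) x))\<^sup>2 \<le> D\<^sup>2"
      by simp
  qed (rule \<open>D \<ge> 0\<close>)
  have "l2norm M (\<lambda>x. f x - s x) \<le> l2norm M (\<lambda>x. f x - partial_sum f ?G x)
      + l2norm M (\<lambda>x. partial_sum f ?G x - s x)"
    by (rule l2norm_triangle_diff[OF f L2(1,3)])
  also have "l2norm M (\<lambda>x. partial_sum f ?G x - s x)
      \<le> l2norm M (\<lambda>x. partial_sum f ?G x - partial_sum f (?G \<inter> I) x)
        + l2norm M (\<lambda>x. partial_sum f (?G \<inter> I) x - s x)"
    by (rule l2norm_triangle_diff[OF L2])
  finally show "l2norm M (\<lambda>x. f x - s x) \<le> D + e"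
    using 1 2 3 l2norm_minus_commute[of M s "partial_sum f (?G \<inter> I)"] by linarith
qed

end

subsection \<open>Wavelets\<close>

lemma digit_sum_div_mod:
  fixes d :: "nat \<Rightarrow> nat"
  assumes "\<And>t. d t < p" "p > 0"
  shows "(\<Sum>t<N. d t * p ^ t) div p ^ s mod p = (if s < N then d s else 0)"
  using assms(1)
proof (induction N arbitrary: d s)
  case 0
  then show ?case
    by simp
next
  case (Suc N)
  have eq: "(\<Sum>t<Suc N. d t * p ^ t) = d 0 + p * (\<Sum>t<N. d (Suc t) * p ^ t)"
    by (simp add: sum.lessThan_Suc_shift sum_distrib_left mult_ac del: sum.lessThan_Suc)
  show ?case
  proof (cases s)
    case 0
    then show ?thesis
      using Suc.prems[of 0] unfolding eq by simp
  next
    case (Suc s')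
    have "(\<Sum>t<Suc N. d t * p ^ t) div p = (\<Sum>t<N. d (Suc t) * p ^ t)"
      using Suc.prems[of 0] assms(2) unfolding eq by simp
    then have "(\<Sum>t<Suc N. d t * p ^ t) div p ^ s = (\<Sum>t<N. d (Suc t) * p ^ t) div p ^ s'"
      by (simp only: Suc power_Suc div_mult2_eq)
    then show ?thesis
      using Suc.IH[of "\<lambda>t. d (Suc t)" s'] Suc.prems Suc by simp
  qed
qed

lemma sum_digits_eq_mod: "(\<Sum>t<N. (k div p ^ t mod p) * p ^ t) = k mod p ^ (N::nat)" for k p :: nat
proof (induction N)
  case (Suc N)
  then show ?case
    using mod_mult2_eq[of k "p ^ N" p] by (simp add: mult_ac)
qed simp

text \<open>Explicit candidate for \<open>vh p k\<close>: \<open>vlambda\<close> weights index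
  \<open>j\<close> by \<open>p^-j\<close>, so the digit belonging to \<open>p^t\<close> sits at
  index \<open>-t\<close>.\<close>

definition vdigits :: "nat \<Rightarrow> nat \<Rightarrow> int \<Rightarrow> nat" where
  "vdigits p k j = (if j \<le> 0 then k div p ^ nat (- j) mod p else 0)"

context vilenkin_haar
begin

lemma vdigits_eq_zero: "k < p ^ i \<Longrightarrow> j \<le> - int i \<Longrightarrow> vdigits p k j = 0"
proof -
  assume k: "k < p ^ i" and "j \<le> - int i"
  then have "i \<le> nat (- j)"
    by auto
  then have "k < p ^ nat (- j)"
    using k p2 by (meson order_less_le_trans power_increasing le_trans one_le_numeral)
  then show ?thesis
    by (simp add: vdigits_def)
qed

lemma vlambda_eq_sum:
  assumes "h \<in> vH p" "\<And>j. j \<le> - int N \<Longrightarrow> h j = 0"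
  shows "vlambda p h = real (\<Sum>t<N. h (- int t) * p ^ t)"
proof -
  let ?S = "(\<lambda>t. - int t) ` {..<N}"
  have zero: "h j = 0" if "j \<notin> ?S" for j
  proof (cases "j > 0")
    case True
    then show ?thesis
      using assms(1) by (simp add: vH_def)
  next
    case False
    then have "j = - int (nat (- j))"
      by simp
    with that have "nat (- j) \<notin> {..<N}"
      by blast
    then show ?thesis
      using False by (intro assms(2)) auto
  qed
  have "vlambda p h = (\<Sum>\<^sub>\<infinity>j\<in>?S. real (h j) * real p powi (- j))"
    unfolding vlambda_def by (rule infsum_cong_neutral) (use zero in auto)
  also have "\<dots> = (\<Sum>j\<in>?S. real (h j) * real p powi (- j))"
    by (rule infsum_finite) simp
  also have "\<dots> = (\<Sum>t<N. real (h (- int t)) * real p powi (int t))"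
    by (subst sum.reindex) (auto simp: inj_on_def)
  finally show ?thesis
    by simp
qed

lemma vdigits_in_vH: "vdigits p k \<in> vH p"
proof -
  have "k < p ^ k"
    using p2 by (intro power_gt_expt) auto
  then have "vdigits p k \<in> vilenkin p"
    by (intro vilenkinI[of _ _ "- int k"]) (auto simp: vdigits_eq_zero, auto simp: vdigits_def)
  then show ?thesis
    by (simp add: vH_def vdigits_def)
qed

text \<open>Existence is the base-\<open>p\<close> expansion of \<open>k\<close>; for uniqueness,
  \<open>digit_sum_div_mod\<close> reads the digits back from the value.\<close>

lemma vh_eq_vdigits: "vh p k = vdigits p k"
  unfolding vh_def
proof (rule the_equality)
  \<comment> \<open>This makes \<open>k\<close> a crude but sufficient bound on its own number of
    digits.\<close>
  have k: "k < p ^ k"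
    using p2 by (intro power_gt_expt) auto
  have "vlambda p (vdigits p k) = real (\<Sum>t<k. vdigits p k (- int t) * p ^ t)"
    by (rule vlambda_eq_sum[OF vdigits_in_vH vdigits_eq_zero[OF k]])
  also have "(\<Sum>t<k. vdigits p k (- int t) * p ^ t) = (\<Sum>t<k. (k div p ^ t mod p) * p ^ t)"
    by (rule sum.cong) (auto simp: vdigits_def)
  also have "\<dots> = k"
    using k by (simp add: sum_digits_eq_mod)
  finally show "vdigits p k \<in> vH p \<and> vlambda p (vdigits p k) = real k"
    using vdigits_in_vH by simp
next
  fix h assume h: "h \<in> vH p \<and> vlambda p h = real k"
  then have hG: "h \<in> vilenkin p"
    by (simp add: vH_def)
  obtain N :: nat where N: "\<And>j. j \<le> - int N \<Longrightarrow> h j = 0"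
    using vilenkin_support_bounded[OF hG] by blast
  have "vlambda p h = real (\<Sum>t<N. h (- int t) * p ^ t)"
    using h N by (intro vlambda_eq_sum) auto
  then have k: "k = (\<Sum>t<N. h (- int t) * p ^ t)"
    using h by (simp only: of_nat_eq_iff)
  show "h = vdigits p k"
  proof
    fix j
    show "h j = vdigits p k j"
    proof (cases "j > 0")
      case True
      then show ?thesis
        using h by (simp add: vH_def vdigits_def)
    next
      case False
      have "k div p ^ nat (- j) mod p = (if nat (- j) < N then h (- int (nat (- j))) else 0)"
        unfolding k by (rule digit_sum_div_mod) (simp_all add: vilenkin_less[OF hG])
      then show ?thesis
        using False N[of j] by (auto simp: vdigits_def)
    qed
  qed
qed

lemma vh_closed: "vh p k \<in> vilenkin p"
  using vdigits_in_vH by (simp add: vh_eq_vdigits vH_def)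

text \<open>The preimage of a coset of level \<open>n\<close> is a coset of level
  \<open>n + i\<close>, whose measure is \<open>p^-i\<close> times as large; the translation only
  moves the centre.\<close>

lemma distr_affine:
  fixes i :: int and h :: "int \<Rightarrow> nat"
  defines "\<tau> \<equiv> \<lambda>x. vdiff p (vdilate i x) h"
  assumes h: "h \<in> vilenkin p"
  shows "\<tau> \<in> measurable \<mu> \<mu>" "distr \<mu> \<mu> \<tau> = density \<mu> (\<lambda>_. ennreal (real p powi (- i)))"
proof -
  have pre: "\<tau> -` vcoset p n y \<inter> vilenkin p = vcoset p (n + i) (vdilate (- i) (vadd p y h))"
    if y: "y \<in> vilenkin p" for n y
    unfolding \<tau>_def using vdiff_mem_vcoset_iff[OF vdilate_closed h y] vdilate_mem_vcoset_iff
    by (auto simp: mem_vcoset)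
  show meas: "\<tau> \<in> measurable \<mu> \<mu>"
    by (rule measurable_vcosetI) (simp_all add: pre, simp add: \<tau>_def vdiff_closed vdilate_closed h)
  show "distr \<mu> \<mu> \<tau> = density \<mu> (\<lambda>_. ennreal (real p powi (- i)))"
  proof (rule distr_eq_density_const[OF meas])
    fix n y assume y: "y \<in> vilenkin p"
    have "real p powi (- (n + i)) = real p powi (- i) * real p powi (- n)"
      using p2 power_int_add[of "real p" "- n" "- i"] by simp
    then show "emeasure \<mu> (\<tau> -` vcoset p n y \<inter> vilenkin p) = ennreal (real p powi (- i) * real p powi (- n))"
      by (simp only: pre[OF y] emeasure_vcoset[OF vdilate_closed[OF vadd_closed[OF y h]]])
  qed simp
qed

section \<open>Integral, support and inner products of the wavelets\<close>

lemma wavelet_L2: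
  assumes \<psi>: "\<psi> \<in> L2 \<mu>"
  shows "wavelet p \<psi> i k \<in> L2 \<mu>"
proof -
  let ?\<tau> = "\<lambda>x. vdiff p (vdilate i x) (vh p k)"
  note [measurable] = L2_measurable[OF \<psi>] distr_affine(1)[OF vh_closed]
  have "integrable (density \<mu> (\<lambda>_. ennreal (real p powi (- i)))) (\<lambda>x. (cmod (\<psi> x))\<^sup>2)"
    using L2_square_integrable[OF \<psi>] by (subst integrable_density) auto
  then have "integrable \<mu> (\<lambda>x. (cmod (\<psi> (?\<tau> x)))\<^sup>2)"
    unfolding distr_affine(2)[OF vh_closed[of k], symmetric] by (rule integrable_distr[rotated]) measurable
  then have "(\<lambda>x. \<psi> (?\<tau> x)) \<in> L2 \<mu>"
    by (simp add: L2_def)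
  then show ?thesis
    unfolding wavelet_def[abs_def] by (rule L2_scale)
qed

lemma integral_wavelet:
  assumes [measurable]: "\<psi> \<in> borel_measurable \<mu>"
  shows "(\<integral>x. wavelet p \<psi> i k x \<partial>\<mu>)
    = complex_of_real (real p powr (of_int i / 2) * real p powi (- i)) * integral\<^sup>L \<mu> \<psi>"
proof -
  let ?\<tau> = "\<lambda>x. vdiff p (vdilate i x) (vh p k)"
  have "(\<integral>x. \<psi> (?\<tau> x) \<partial>\<mu>) = integral\<^sup>L (distr \<mu> \<mu> ?\<tau>) \<psi>"
    by (rule integral_distr[symmetric, OF distr_affine(1)[OF vh_closed]]) measurable
  also have "\<dots> = (\<integral>x. real p powi (- i) *\<^sub>R \<psi> x \<partial>\<mu>)"
    unfolding distr_affine(2)[OF vh_closed] by (rule integral_density) auto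
  also have "\<dots> = complex_of_real (real p powi (- i)) * integral\<^sup>L \<mu> \<psi>"
    unfolding scaleR_conv_of_real by (rule Bochner_Integration.integral_mult_right_zero)
  finally show ?thesis
    unfolding wavelet_def Bochner_Integration.integral_mult_right_zero by (simp only: of_real_mult mult.assoc)
qed

text \<open>The pushforward of \<open>\<mu>\<close> under the affine map is a multiple of
  \<open>\<mu>\<close>, so null sets pull back to null sets. This transfers the support condition,
  which is known only almost everywhere.\<close>

lemma wavelet_support:
  assumes "AE x in \<mu>. x \<notin> vcoset p (- L) vzero \<longrightarrow> \<psi> x = 0"
  shows "AE x in \<mu>. x \<notin> vcoset p (i - L) (vdilate (- i) (vh p k)) \<longrightarrow> wavelet p \<psi> i k x = 0"
proof -
  let ?\<tau> = "\<lambda>x. vdiff p (vdilate i x) (vh p k)"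
  have "AE x in density \<mu> (\<lambda>_. ennreal (real p powi (- i))). x \<notin> vcoset p (- L) vzero \<longrightarrow> \<psi> x = 0"
    using assms by (subst AE_density) auto
  then have "AE x in \<mu>. ?\<tau> x \<notin> vcoset p (- L) vzero \<longrightarrow> \<psi> (?\<tau> x) = 0"
    unfolding distr_affine(2)[OF vh_closed[of k], symmetric] by (rule AE_distrD[OF distr_affine(1)[OF vh_closed]])
  then show ?thesis
  proof (rule AE_mp, intro AE_I2 impI)
    fix x assume x: "x \<in> space \<mu>" and "?\<tau> x \<notin> vcoset p (- L) vzero \<longrightarrow> \<psi> (?\<tau> x) = 0"
      and nx: "x \<notin> vcoset p (i - L) (vdilate (- i) (vh p k))"
    have "vadd p vzero (vh p k) = vh p k"
      using vilenkin_less[OF vh_closed] by (auto simp: vadd_def vzero_def)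
    then have "?\<tau> x \<in> vcoset p (- L) vzero \<longleftrightarrow> x \<in> vcoset p (i - L) (vdilate (- i) (vh p k))"
      using x by (simp add: vdiff_mem_vcoset_iff vdilate_closed vh_closed vdilate_mem_vcoset_iff)
    then show "wavelet p \<psi> i k x = 0"
      using nx \<open>?\<tau> x \<notin> vcoset p (- L) vzero \<longrightarrow> \<psi> (?\<tau> x) = 0\<close> by (simp add: wavelet_def)
  qed
qed

text \<open>On the support of the wavelet \<open>g\<close> is the constant \<open>a\<close>, so only
  the integral of the wavelet remains. With \<open>a = 1\<close> this detects the mean of
  \<open>\<psi>\<close>; once the mean is zero, it gives orthogonality to averages.\<close>

lemma l2inner_wavelet_locally_constant:
  assumes \<psi>: "\<psi> \<in> L2 \<mu>" and supp: "AE x in \<mu>. x \<notin> vcoset p (- L) vzero \<longrightarrow> \<psi> x = 0"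
    and [measurable]: "g \<in> borel_measurable \<mu>"
    and g: "\<And>y. y \<in> vcoset p (i - L) (vdilate (- i) (vh p k)) \<Longrightarrow> g y = a"
  shows "l2inner \<mu> g (wavelet p \<psi> i k)
    = a * cnj (complex_of_real (real p powr (of_int i / 2) * real p powi (- i)) * integral\<^sup>L \<mu> \<psi>)"
proof -
  note [measurable] = L2_measurable[OF wavelet_L2[OF \<psi>]]
  have "l2inner \<mu> g (wavelet p \<psi> i k) = (\<integral>x. a * cnj (wavelet p \<psi> i k x) \<partial>\<mu>)"
    unfolding l2inner_def
  proof (rule integral_cong_AE)
    show "AE x in \<mu>. g x * cnj (wavelet p \<psi> i k x) = a * cnj (wavelet p \<psi> i k x)"
      using wavelet_support[OF supp, of i k] by eventually_elim (use g in auto)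
  qed auto
  also have "\<dots> = a * cnj (\<integral>x. wavelet p \<psi> i k x \<partial>\<mu>)"
    by (simp only: Bochner_Integration.integral_mult_right_zero Bochner_Integration.integral_cnj)
  finally show ?thesis
    by (simp only: integral_wavelet[OF L2_measurable[OF \<psi>]])
qed

text \<open>Compactness selects finitely many of the nested balls \<open>U_{-N}\<close> that exhaust
  the group. All larger radii are included so that one radius can later serve every
  generator.\<close>

lemma compactly_supported_ball:
  assumes "compactly_supported p \<mu> f"
  shows "\<exists>L::nat. \<forall>L'\<ge>L. AE x in \<mu>. x \<notin> vcoset p (- int L') vzero \<longrightarrow> f x = 0"
proof -
  obtain K where K: "compactin (vtopology p) K" "AE x in \<mu>. x \<notin> K \<longrightarrow> f x = 0"
    using assms by (auto simp: compactly_supported_def)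
  let ?\<U> = "range (\<lambda>N::nat. vcoset p (- int N) vzero)"
  have "K \<subseteq> \<Union>?\<U>"
    using compactin_subset_topspace[OF K(1)] vilenkin_eq_Union[of p] by (simp add: topspace_vtopology)
  then have "\<exists>\<F>. finite \<F> \<and> \<F> \<subseteq> ?\<U> \<and> K \<subseteq> \<Union>\<F>"
    by (intro compactinD[OF K(1)]) (auto simp: openin_vcoset)
  then obtain \<F> where \<F>: "finite \<F>" "\<F> \<subseteq> ?\<U>" "K \<subseteq> \<Union>\<F>"
    by (elim exE conjE)
  obtain S where S: "finite S" "\<F> = (\<lambda>N::nat. vcoset p (- int N) vzero) ` S"
    using \<F>(1,2) by (meson finite_subset_image)
  obtain L where L: "\<And>N. N \<in> S \<Longrightarrow> N \<le> L"
    using S(1) by (meson finite_nat_set_iff_bounded_le)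
  have "AE x in \<mu>. x \<notin> vcoset p (- int L') vzero \<longrightarrow> f x = 0" if "L' \<ge> L" for L'
  proof -
    have "vcoset p (- int N) vzero \<subseteq> vcoset p (- int L') vzero" if "N \<in> S" for N
      using L[OF that] \<open>L' \<ge> L\<close> by (intro vcoset_antimono) simp
    then have "K \<subseteq> vcoset p (- int L') vzero"
      using \<F>(3) S(2) by blast
    then show ?thesis
      using K(2) by (auto elim: eventually_mono)
  qed
  then show ?thesis
    by blast
qed

text \<open>A bump \<open>1\<^sub>U\<close> meets \<open>p\<^sup>i\<close> wavelets of each level \<open>i \<ge> L\<close>, each with coefficient of modulus
  \<open>p\<^sup>-\<^sup>i\<^sup>/\<^sup>2 \<bar>\<integral>\<psi>\<bar>\<close>, so every such level contributes \<open>\<bar>\<integral>\<psi>\<bar>\<^sup>2\<close> to the Bessel sum.\<close>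

lemma wavelet_mean_zero:
  assumes \<psi>: "\<psi> \<in> L2 \<mu>" and supp: "AE x in \<mu>. x \<notin> vcoset p (- int L) vzero \<longrightarrow> \<psi> x = 0"
    and bessel: "\<And>f F. f \<in> L2 \<mu> \<Longrightarrow> finite F \<Longrightarrow>
      (\<Sum>(i, k)\<in>F. (cmod (l2inner \<mu> f (wavelet p \<psi> i k)))\<^sup>2) \<le> C * (l2norm \<mu> f)\<^sup>2"
  shows "integral\<^sup>L \<mu> \<psi> = 0"
proof (rule ccontr)
  assume nz: "integral\<^sup>L \<mu> \<psi> \<noteq> 0"
  define c where "c = (cmod (integral\<^sup>L \<mu> \<psi>))\<^sup>2"
  have c: "c > 0"
    using nz by (simp add: c_def)
  define f where "f = (indicator (vcoset p 0 vzero) :: _ \<Rightarrow> complex)"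
  have f: "f \<in> L2 \<mu>"
    unfolding f_def by (rule indicator_L2) (simp_all add: emeasure_vcoset_vzero)
  have coeff: "(cmod (l2inner \<mu> f (wavelet p \<psi> (int i) k)))\<^sup>2 = c / real p ^ i"
    if "L \<le> i" "k < p ^ i" for i k
  proof -
    have "f y = 1" if "y \<in> vcoset p (int i - int L) (vdilate (- int i) (vh p k))" for y
    proof -
      \<comment> \<open>\<open>k < p^i\<close> puts the digits of \<open>vh p k\<close> at indices
        above \<open>-i\<close>, and the dilation moves them above 0; \<open>L <= i\<close> ensures
        that the support coset fixes all coordinates up to index 0.\<close>
      have "y j = 0" if "j \<le> 0" for j
        using \<open>y \<in> _\<close> \<open>L \<le> i\<close> that vdigits_eq_zero[OF \<open>k < p ^ i\<close>, of "j - int i"]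
        by (simp add: mem_vcoset vdilate_def vh_eq_vdigits)
      then show ?thesis
        using \<open>y \<in> _\<close> by (simp add: f_def mem_vcoset vzero_def indicator_def)
    qed
    from l2inner_wavelet_locally_constant[OF \<psi> supp L2_measurable[OF f] this]
    have "cmod (l2inner \<mu> f (wavelet p \<psi> (int i) k))
        = real p powr (real i / 2) * real p powi (- int i) * cmod (integral\<^sup>L \<mu> \<psi>)"
      by (simp add: norm_mult norm_power norm_inverse power_int_minus)
    then have "(cmod (l2inner \<mu> f (wavelet p \<psi> (int i) k)))\<^sup>2
        = (real p powr (real i / 2))\<^sup>2 * (real p powi (- int i))\<^sup>2 * c"
      by (simp add: power_mult_distrib c_def)
    also have "(real p powr (real i / 2))\<^sup>2 = real p ^ i"
      using p2 by (simp add: powr_power powr_realpow)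
    also have "real p ^ i * (real p powi (- int i))\<^sup>2 * c = c / real p ^ i"
      using p2 by (simp add: power_int_minus power2_eq_square field_simps)
    finally show ?thesis .
  qed
  have "real M * c \<le> C * (l2norm \<mu> f)\<^sup>2" for M :: nat
  proof -
    let ?D = "SIGMA i:{L..<L + M}. {..<p ^ i}"
    let ?F = "(\<lambda>(i, k). (int i, k)) ` ?D"
    have "(\<Sum>(i, k)\<in>?F. (cmod (l2inner \<mu> f (wavelet p \<psi> i k)))\<^sup>2)
        = (\<Sum>(i, k)\<in>?D. (cmod (l2inner \<mu> f (wavelet p \<psi> (int i) k)))\<^sup>2)"
      by (subst sum.reindex) (auto simp: inj_on_def intro!: sum.cong)
    also have "\<dots> = (\<Sum>i\<in>{L..<L + M}. \<Sum>k<p ^ i. (cmod (l2inner \<mu> f (wavelet p \<psi> (int i) k)))\<^sup>2)"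
      by (rule sum.Sigma[symmetric]) auto
    also have "\<dots> = (\<Sum>i\<in>{L..<L + M}. \<Sum>k<p ^ i. c / real p ^ i)"
      by (intro sum.cong refl coeff) auto
    also have "\<dots> = real M * c"
      using p2 by simp
    finally show ?thesis
      using bessel[OF f, of ?F] by simp
  qed
  moreover obtain M :: nat where "C * (l2norm \<mu> f)\<^sup>2 < real M * c"
    using reals_Archimedean3[OF c] by blast
  ultimately show False
    by (meson not_le)
qed

text \<open>\<open>l <= i - L\<close> makes the average over cosets of \<open>U_l\<close> constant
  on the support of the wavelet, whose mean is zero.\<close>

lemma l2inner_vavg_wavelet:
  assumes \<psi>: "\<psi> \<in> L2 \<mu>" and supp: "AE x in \<mu>. x \<notin> vcoset p (- int L) vzero \<longrightarrow> \<psi> x = 0"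
    and "integral\<^sup>L \<mu> \<psi> = 0" and f: "f \<in> L2 \<mu>" and "l \<le> i - int L"
  shows "l2inner \<mu> (\<lambda>x. f x - vavg p \<mu> l f x) (wavelet p \<psi> i k) = l2inner \<mu> f (wavelet p \<psi> i k)"
proof -
  let ?z = "vdilate (- i) (vh p k)"
  have "vavg p \<mu> l f y = vavg p \<mu> l f ?z" if "y \<in> vcoset p (i - int L) ?z" for y
    using that \<open>l \<le> i - int L\<close> by (intro vavg_cong) (simp add: mem_vcoset)
  from l2inner_wavelet_locally_constant[OF \<psi> supp L2_measurable[OF vavg_L2[OF f]] this]
  have "l2inner \<mu> (vavg p \<mu> l f) (wavelet p \<psi> i k) = 0"
    using \<open>integral\<^sup>L \<mu> \<psi> = 0\<close> by simp
  then show ?thesis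
    by (simp add: l2inner_diff_left[OF f vavg_L2[OF f] wavelet_L2[OF \<psi>]])
qed

end

theorem theorem14:
  fixes p r m :: nat and \<mu> :: "(int \<Rightarrow> nat) measure"
    and \<psi> :: "nat \<Rightarrow> (int \<Rightarrow> nat) \<Rightarrow> complex" and B :: real
  assumes "p \<ge> 2" and "r \<ge> 1"
    and "haar_measure p \<mu>"
    and "tight_wavelet_frame p \<mu> r \<psi> B"
    and "\<forall>\<nu>\<in>{1..r}. compactly_supported p \<mu> (\<psi> \<nu>)"
    and "m > 0 \<longrightarrow> B = 1"
  shows "\<exists>C::real. \<forall>f\<in>sobolev p \<mu> m. \<forall>j::int.
    \<exists>s. l2_has_sum \<mu>
          (\<lambda>(i, \<nu>, k) x. l2inner \<mu> f (wavelet p (\<psi> \<nu>) i k) * wavelet p (\<psi> \<nu>) i k x)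
          ({..j} \<times> {1..r} \<times> (UNIV :: nat set)) s \<and>
        l2norm \<mu> (\<lambda>x. f x - s x)
          \<le> C * real p powi (- (j * int m)) * sobolev_norm p \<mu> m f"
proof -
  interpret vilenkin_haar p \<mu>
    by unfold_locales (use assms in auto)
  have \<psi>: "\<psi> \<nu> \<in> L2 \<mu>" if "\<nu> \<in> {1..r}" for \<nu>
    using assms(4) that by (simp add: tight_wavelet_frame_def)
  define w where "w = (\<lambda>(i, \<nu>, k). wavelet p (\<psi> \<nu>) i k)"
  define T where "T = (UNIV :: int set) \<times> {1..r} \<times> (UNIV :: nat set)"
  have w_simp: "w (i, \<nu>, k) = wavelet p (\<psi> \<nu>) i k" for i \<nu> k
    by (simp add: w_def)
  have frame: "((\<lambda>t. (cmod (l2inner \<mu> f (w t)))\<^sup>2) has_sum (B * (l2norm \<mu> f)\<^sup>2)) T" if "f \<in> L2 \<mu>" for f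
    using assms(4) that by (simp add: tight_wavelet_frame_def w_def T_def split_beta')
  \<comment> \<open>Testing the frame identity on the indicator of \<open>U\<close>, which has norm
    1, gives the sign that the abstract frame locale requires.\<close>
  have B: "B \<ge> 0"
  proof -
    let ?f = "indicator (vcoset p 0 vzero) :: _ \<Rightarrow> complex"
    have f: "?f \<in> L2 \<mu>"
      by (rule indicator_L2) (simp_all add: emeasure_vcoset_vzero)
    have "(cmod (indicator (vcoset p 0 vzero) x))\<^sup>2 = indicator (vcoset p 0 vzero) x" for x :: "int \<Rightarrow> nat"
      by (simp add: indicator_def)
    then have "(l2norm \<mu> ?f)\<^sup>2 = 1"
      unfolding l2norm_power2 using measure_vcoset[OF vzero_closed, of 0]
      by (simp add: Int_absorb2 vcoset_def)
    moreover have "B * (l2norm \<mu> ?f)\<^sup>2 \<ge> 0"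
      by (rule has_sum_nonneg[OF frame[OF f]]) simp
    ultimately show ?thesis
      by simp
  qed
  have w_L2: "w t \<in> L2 \<mu>" if "t \<in> T" for t
  proof -
    obtain i \<nu> k where t: "t = (i, \<nu>, k)" "\<nu> \<in> {1..r}"
      using \<open>t \<in> T\<close> unfolding T_def by blast
    show ?thesis
      unfolding t(1) w_simp by (rule wavelet_L2[OF \<psi>[OF t(2)]])
  qed
  interpret l2_tight_frame \<mu> w T B
    by unfold_locales (use w_L2 frame B in auto)
  have "\<forall>\<nu>\<in>{1..r}. \<exists>L::nat. \<forall>L'\<ge>L. AE x in \<mu>. x \<notin> vcoset p (- int L') vzero \<longrightarrow> \<psi> \<nu> x = 0"
    using assms(5) compactly_supported_ball by blast
  from bchoice[OF this] obtain Ls :: "nat \<Rightarrow> nat" where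
    Ls: "\<forall>\<nu>\<in>{1..r}. \<forall>L'\<ge>Ls \<nu>. AE x in \<mu>. x \<notin> vcoset p (- int L') vzero \<longrightarrow> \<psi> \<nu> x = 0"
    by (rule exE)
  \<comment> \<open>The sum is at least each of its terms and so serves as a common support radius
    for all generators.\<close>
  define L where "L = (\<Sum>\<nu>\<in>{1..r}. Ls \<nu>)"
  have supp: "AE x in \<mu>. x \<notin> vcoset p (- int L) vzero \<longrightarrow> \<psi> \<nu> x = 0" if "\<nu> \<in> {1..r}" for \<nu>
    by (rule Ls[rule_format, OF that]) (use that in \<open>auto simp: L_def intro!: member_le_sum\<close>)
  have mean: "integral\<^sup>L \<mu> (\<psi> \<nu>) = 0" if \<nu>: "\<nu> \<in> {1..r}" for \<nu>
  proof (rule wavelet_mean_zero[OF \<psi>[OF \<nu>] supp[OF \<nu>]])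
    fix f F assume f: "f \<in> L2 \<mu>" and F: "finite (F :: (int \<times> nat) set)"
    have "(\<Sum>(i, k)\<in>F. (cmod (l2inner \<mu> f (wavelet p (\<psi> \<nu>) i k)))\<^sup>2)
        = (\<Sum>t\<in>(\<lambda>(i, k). (i, \<nu>, k)) ` F. (cmod (l2inner \<mu> f (w t)))\<^sup>2)"
      by (subst sum.reindex) (auto simp: inj_on_def w_simp intro!: sum.cong)
    also have "\<dots> \<le> B * (l2norm \<mu> f)\<^sup>2"
      using F \<nu> by (intro coefficients_le f) (auto simp: T_def)
    finally show "(\<Sum>(i, k)\<in>F. (cmod (l2inner \<mu> f (wavelet p (\<psi> \<nu>) i k)))\<^sup>2) \<le> B * (l2norm \<mu> f)\<^sup>2" .
  qed
  \<comment> \<open>For \<open>m = 0\<close> the two summands bound \<open>f\<close> and the frame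
    sum separately. Otherwise \<open>p^(L m)\<close> pays for averaging over cosets of
    \<open>U_{j-L}\<close> instead of \<open>U_j\<close>.\<close>
  define C where "C = (if m = 0 then 1 + B else real p powi (int L * int m))"
  have "\<exists>s. l2_has_sum \<mu> (\<lambda>t x. l2inner \<mu> f (w t) * w t x) ({..j} \<times> {1..r} \<times> UNIV) s \<and>
      l2norm \<mu> (\<lambda>x. f x - s x) \<le> C * real p powi (- (j * int m)) * sobolev_norm p \<mu> m f"
    if fS: "f \<in> sobolev p \<mu> m" for f and j :: int
  proof -
    let ?I = "{..j} \<times> {1..r} \<times> (UNIV :: nat set)"
    have f: "f \<in> L2 \<mu>"
      using fS by (simp add: sobolev_def)
    have I: "?I \<subseteq> T"
      by (auto simp: T_def)
    obtain s where s: "l2_has_sum \<mu> (\<lambda>t x. l2inner \<mu> f (w t) * w t x) ?I s"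
      using l2_has_sum_exists[OF f I] by blast
    have "l2norm \<mu> (\<lambda>x. f x - s x) \<le> C * real p powi (- (j * int m)) * sobolev_norm p \<mu> m f"
    proof (cases "m = 0")
      case True
      have "l2norm \<mu> (\<lambda>x. f x - s x) \<le> l2norm \<mu> f + l2norm \<mu> s"
        using l2norm_triangle_diff[OF f L2_zero, of s] s l2norm_scale[of \<mu> "-1" s]
        by (simp add: l2_has_sum_def)
      also have "\<dots> \<le> (1 + B) * l2norm \<mu> f"
        using l2norm_sum_le[OF f I s] by (simp add: distrib_right)
      finally show ?thesis
        using True by (simp add: C_def l2norm_eq_sobolev_norm_zero[OF f])
    next
      case False
      \<comment> \<open>With this level \<open>?l <= i - int L\<close> holds for every
        \<open>i > j\<close>, so subtracting the average changes none of the coefficients outside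
        \<open>?I\<close>.\<close>
      let ?l = "j - int L"
      have "l2norm \<mu> (\<lambda>x. f x - s x) \<le> l2norm \<mu> (\<lambda>x. f x - vavg p \<mu> ?l f x)"
      proof (rule l2norm_remainder_le[OF f _ I s])
        show "B = 1"
          using assms(6) False by simp
        fix F assume F: "finite F" "F \<subseteq> T - ?I"
        have "(\<Sum>t\<in>F. (cmod (l2inner \<mu> f (w t)))\<^sup>2)
            = (\<Sum>t\<in>F. (cmod (l2inner \<mu> (\<lambda>x. f x - vavg p \<mu> ?l f x) (w t)))\<^sup>2)"
        proof (rule sum.cong[OF refl])
          fix t assume "t \<in> F"
          with F(2) have "t \<in> T - ?I"
            by blast
          then obtain i \<nu> k where t: "t = (i, \<nu>, k)" "\<nu> \<in> {1..r}" "i > j"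
            by (cases t) (auto simp: T_def)
          then show "(cmod (l2inner \<mu> f (w t)))\<^sup>2
              = (cmod (l2inner \<mu> (\<lambda>x. f x - vavg p \<mu> ?l f x) (w t)))\<^sup>2"
            using l2inner_vavg_wavelet[OF \<psi>[OF t(2)] supp[OF t(2)] mean[OF t(2)] f, of ?l i k]
            by (simp add: w_simp)
        qed
        also have "\<dots> \<le> B * (l2norm \<mu> (\<lambda>x. f x - vavg p \<mu> ?l f x))\<^sup>2"
          using F by (intro coefficients_le L2_diff f vavg_L2) auto
        finally show "(\<Sum>t\<in>F. (cmod (l2inner \<mu> f (w t)))\<^sup>2)
            \<le> (l2norm \<mu> (\<lambda>x. f x - vavg p \<mu> ?l f x))\<^sup>2"
          using \<open>B = 1\<close> by simp
      qed simp
      also have "\<dots> \<le> real p powi (- (?l * int m)) * sobolev_norm p \<mu> m f"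
        by (rule l2norm_diff_vavg_sobolev[OF fS])
      also have "real p powi (- (?l * int m)) = C * real p powi (- (j * int m))"
        using False p2 by (simp add: C_def left_diff_distrib flip: power_int_add)
      finally show ?thesis .
    qed
    with s show ?thesis
      by blast
  qed
  moreover have "(\<lambda>(i, \<nu>, k) x. l2inner \<mu> f (wavelet p (\<psi> \<nu>) i k) * wavelet p (\<psi> \<nu>) i k x)
      = (\<lambda>t x. l2inner \<mu> f (w t) * w t x)" for f
    by (auto simp: w_simp fun_eq_iff)
  ultimately show ?thesis
    by (intro exI[of _ C]) simp
qed

end
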